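(* Let $\Lambda$ be a countable, finitely aligned left cancellative small category. Then the map $$\Phi:\mathcal{G}_{|\partial\Lambda}\to\mathcal{S}_\Lambda\rtimes\Lambda_{tight},\qquad [\alpha,\beta,F]\mapsto[\tau^\alpha\sigma^\beta,\ \tau^\beta\cdot F]$$ is an isomorphism of topological groupoids, where $\mathcal{G}_{|\partial\Lambda}$ is Spielberg's groupoid of $\Lambda$ and $\mathcal{S}_\Lambda\rtimes\Lambda_{tight}$ is the groupoid of germs of the action of $\mathcal{S}_\Lambda$ on $\Lambda_{tight}$.
   Context: Categories. A small category $\Lambda$ is identified with its set of morphisms, objects $\Lambda^0$ with identity morphisms; $s(\alpha)$ is the domain and $r(\alpha)$ the range of $\alpha$; $\alpha\beta$ is defined when $s(\alpha)=r(\beta)$; $\alpha\Lambda=\{\alpha\beta: r(\beta)=s(\alpha)\}$. $\Lambda$ is left cancellative if $\alpha\beta=\alpha\gamma$ implies $\beta=\gamma$; finitely aligned if for all $\alpha,\beta$ there is a finite $\Gamma\subset\Lambda$ with $\alpha\Lambda\cap\beta\Lambda=\bigcup_{\gamma\in\Gamma}\gamma\Lambda$. $\alpha\le\beta$ means $\beta\in\alpha\Lambda$; $[\beta]=\{\alpha:\alpha\le\beta\}$; $\alpha\Cap\beta$ means $\alpha\Lambda\cap\beta\Lambda\ne\emptyset$. Inverse semigroup. $\tau^\alpha:s(\alpha)\Lambda\to\alpha\Lambda$, $\beta\mapsto\alpha\beta$, $\sigma^\alpha:=(\tau^\alpha)^{-1}$; $\mathcal{S}_\Lambda$ is the inverse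 semigroup of partial bijections of $\Lambda$ generated by all of these. Every $s\in\mathcal{S}_\Lambda$ is a finite join (union of partial maps) $s=\bigvee_{i=1}^n\tau^{\alpha_i}\sigma^{\beta_i}$ with $s(\alpha_i)=s(\beta_i)$. Path space. $\Lambda^*$ is the set of nonempty $F\subseteq\Lambda$ that are hereditary ($\alpha\le\beta\in F\Rightarrow\alpha\in F$) and directed (any two elements have an upper bound in $F$), with the topology with basis $\{F\in\Lambda^*: X\subseteq F,\ Y\cap F=\emptyset\}$, $X,Y\subset\Lambda$ finite. $C\in\Lambda^*$ is tight if for every $\alpha\in C$, every finite $\{\beta_1,\dots,\beta_n\}\subset\Lambda$ disjoint from $C$, and every finite $Z\subseteq\alpha\Lambda\setminus\bigcup_i\beta_i\Lambda$ such that each $\gamma\in\alpha\Lambda\setminus\bigcup_i\beta_i\Lambda$ satisfies $\gamma\Cap z$ for some $z\in Z$, one has $C\cap Z\neq\emptyset$. $\Lambda_{tight}=\partial\Lambda$ is the set of tight elements, with the subspace topology. Action. If $\beta\in F\in\Lambda^*$ and $s(\alpha)=s(\beta)$, then $\tau^\alpha\sigma^\beta\cdot F=\bigcup_{\gamma\in F,\ \beta\le\gamma}[\alpha\sigma^\beta(\gamma)]$; for $s=\bigvee_i\tau^{\alpha_i}\sigma^{\beta_i}$ the domain is $E_{s^*s}=\{F:\beta_i\in F\text{ for some }i\}$ and $s\cdot F=\tau^{\alpha_i}\sigma^{\beta_i}\cdot F$ for any $i$ with $\beta_i\in F$. In particular $\tau^\beta\cdot F$ is defined if $s(\beta)\in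 F$, and $\sigma^\xi\cdot F$ if $\xi\in F$. The action restricts to $\Lambda_{tight}$. $\mathcal{S}_\Lambda\rtimes\Lambda_{tight}$ is the groupoid of germs $[s,F]$ ($F\in\Lambda_{tight}\cap E_{s^*s}$; $[s,F]=[t,F']$ iff $F=F'$ and $se=te$ for some idempotent $e$ with $F\in E_e$), $d[s,F]=F$, $r[s,F]=s\cdot F$, $[s,t\cdot F][t,F]=[st,F]$, with basic open sets $\{[s,F]:F\in U\}$, $U\subseteq E_{s^*s}\cap\Lambda_{tight}$ open. Spielberg's groupoid. Consider triples $(\alpha,\beta,F)\in\Lambda\times\Lambda\times\Lambda^*$ with $s(\alpha)=s(\beta)\in F$. Put $(\alpha,\beta,F)\sim(\alpha',\beta',F')$ if there are $G\in\Lambda^*$, $\gamma,\gamma'\in\Lambda$ with $F=\tau^\gamma\cdot G$, $F'=\tau^{\gamma'}\cdot G$, $\alpha\gamma=\alpha'\gamma'$, $\beta\gamma=\beta'\gamma'$; $\mathcal{G}$ is the set of classes $[\alpha,\beta,F]$. The pair $([\alpha,\beta,F],[\gamma,\delta,G])$ is composable iff $\tau^\beta\cdot F=\tau^\gamma\cdot G$; then there are $\xi\in F$, $\eta\in G$ with $\beta\xi=\gamma\eta$ and the product is $[\alpha\xi,\delta\eta,H]$ with $H=\sigma^\xi\cdot F=\sigma^\eta\cdot G$. The inverse is $[\alpha,\beta,F]^{-1}=[\beta,\alpha,F]$. Basic open sets are $\{[\alpha,\beta,F]:F\in U\}$ with $U\subseteq\Lambda^*$ open. $\mathcal{G}_{|\partial\Lambda}=\{[\alpha,\beta,F]\in\mathcal{G}: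 F\in\Lambda_{tight}\}$ with the subspace topology. *)

theory Defs
  imports "HOL-Analysis.Analysis"
begin

section \<open>Small categories\<close>

text \<open>A small category is its set \<open>Mor\<close> of morphisms; an object is the corresponding
  identity morphism, so \<open>src\<close> and \<open>rng\<close> take values in \<open>Mor\<close>.  The product
  \<open>\<alpha> \<cdot> \<beta>\<close> is meaningful when \<open>src \<alpha> = rng \<beta>\<close>.  Nothing is assumed about values of
  the operations off \<open>Mor\<close> or on non-composable pairs.\<close>

record 'a category =
  Mor :: "'a set"
  src :: "'a \<Rightarrow> 'a"
  rng :: "'a \<Rightarrow> 'a"
  cmp :: "'a \<Rightarrow> 'a \<Rightarrow> 'a" (infixl \<open>\<cdot>\<index>\<close> 70)

locale small_category =
  fixes \<Lambda> :: "'a category" (structure)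
  assumes src_in_Mor: "\<alpha> \<in> Mor \<Lambda> \<Longrightarrow> src \<Lambda> \<alpha> \<in> Mor \<Lambda>"
    and rng_in_Mor: "\<alpha> \<in> Mor \<Lambda> \<Longrightarrow> rng \<Lambda> \<alpha> \<in> Mor \<Lambda>"
    and src_src: "\<alpha> \<in> Mor \<Lambda> \<Longrightarrow> src \<Lambda> (src \<Lambda> \<alpha>) = src \<Lambda> \<alpha>"
    and rng_src: "\<alpha> \<in> Mor \<Lambda> \<Longrightarrow> rng \<Lambda> (src \<Lambda> \<alpha>) = src \<Lambda> \<alpha>"
    and src_rng: "\<alpha> \<in> Mor \<Lambda> \<Longrightarrow> src \<Lambda> (rng \<Lambda> \<alpha>) = rng \<Lambda> \<alpha>"
    and rng_rng: "\<alpha> \<in> Mor \<Lambda> \<Longrightarrow> rng \<Lambda> (rng \<Lambda> \<alpha>) = rng \<Lambda> \<alpha>"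
    and cmp_in_Mor: "\<lbrakk>\<alpha> \<in> Mor \<Lambda>; \<beta> \<in> Mor \<Lambda>; src \<Lambda> \<alpha> = rng \<Lambda> \<beta>\<rbrakk> \<Longrightarrow> \<alpha> \<cdot> \<beta> \<in> Mor \<Lambda>"
    and src_cmp: "\<lbrakk>\<alpha> \<in> Mor \<Lambda>; \<beta> \<in> Mor \<Lambda>; src \<Lambda> \<alpha> = rng \<Lambda> \<beta>\<rbrakk> \<Longrightarrow> src \<Lambda> (\<alpha> \<cdot> \<beta>) = src \<Lambda> \<beta>"
    and rng_cmp: "\<lbrakk>\<alpha> \<in> Mor \<Lambda>; \<beta> \<in> Mor \<Lambda>; src \<Lambda> \<alpha> = rng \<Lambda> \<beta>\<rbrakk> \<Longrightarrow> rng \<Lambda> (\<alpha> \<cdot> \<beta>) = rng \<Lambda> \<alpha>"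
    and rng_cmp_self: "\<alpha> \<in> Mor \<Lambda> \<Longrightarrow> rng \<Lambda> \<alpha> \<cdot> \<alpha> = \<alpha>"
    and cmp_src_self: "\<alpha> \<in> Mor \<Lambda> \<Longrightarrow> \<alpha> \<cdot> src \<Lambda> \<alpha> = \<alpha>"
    and cmp_assoc: "\<lbrakk>\<alpha> \<in> Mor \<Lambda>; \<beta> \<in> Mor \<Lambda>; \<gamma> \<in> Mor \<Lambda>; src \<Lambda> \<alpha> = rng \<Lambda> \<beta>; src \<Lambda> \<beta> = rng \<Lambda> \<gamma>\<rbrakk>
            \<Longrightarrow> (\<alpha> \<cdot> \<beta>) \<cdot> \<gamma> = \<alpha> \<cdot> (\<beta> \<cdot> \<gamma>)"

definition left_cancellative :: "'a category \<Rightarrow> bool" where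
  "left_cancellative \<Lambda> \<longleftrightarrow>
     (\<forall>\<alpha>\<in>Mor \<Lambda>. \<forall>\<beta>\<in>Mor \<Lambda>. \<forall>\<gamma>\<in>Mor \<Lambda>.
        src \<Lambda> \<alpha> = rng \<Lambda> \<beta> \<longrightarrow> src \<Lambda> \<alpha> = rng \<Lambda> \<gamma> \<longrightarrow>
        \<alpha> \<cdot>\<^bsub>\<Lambda>\<^esub> \<beta> = \<alpha> \<cdot>\<^bsub>\<Lambda>\<^esub> \<gamma> \<longrightarrow> \<beta> = \<gamma>)"

text \<open>\<open>exts \<Lambda> \<alpha>\<close> is the set $\alpha\Lambda$.\<close>

definition exts :: "'a category \<Rightarrow> 'a \<Rightarrow> 'a set" where
  "exts \<Lambda> \<alpha> = {\<alpha> \<cdot>\<^bsub>\<Lambda>\<^esub> \<beta> | \<beta>. \<beta> \<in> Mor \<Lambda> \<and> rng \<Lambda> \<beta> = src \<Lambda> \<alpha>}"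

definition finitely_aligned :: "'a category \<Rightarrow> bool" where
  "finitely_aligned \<Lambda> \<longleftrightarrow>
     (\<forall>\<alpha>\<in>Mor \<Lambda>. \<forall>\<beta>\<in>Mor \<Lambda>. \<exists>\<Gamma>. finite \<Gamma> \<and> \<Gamma> \<subseteq> Mor \<Lambda> \<and>
        exts \<Lambda> \<alpha> \<inter> exts \<Lambda> \<beta> = (\<Union>\<gamma>\<in>\<Gamma>. exts \<Lambda> \<gamma>))"

definition cat_le :: "'a category \<Rightarrow> 'a \<Rightarrow> 'a \<Rightarrow> bool" where
  "cat_le \<Lambda> \<alpha> \<beta> \<longleftrightarrow> \<alpha> \<in> Mor \<Lambda> \<and> \<beta> \<in> exts \<Lambda> \<alpha>"

text \<open>\<open>inits \<Lambda> \<beta>\<close> is the set $[\beta]$ of initial segments of $\beta$.\<close>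

definition inits :: "'a category \<Rightarrow> 'a \<Rightarrow> 'a set" where
  "inits \<Lambda> \<beta> = {\<alpha>. cat_le \<Lambda> \<alpha> \<beta>}"

definition meets :: "'a category \<Rightarrow> 'a \<Rightarrow> 'a \<Rightarrow> bool" where
  "meets \<Lambda> \<alpha> \<beta> \<longleftrightarrow> exts \<Lambda> \<alpha> \<inter> exts \<Lambda> \<beta> \<noteq> {}"


section \<open>The inverse semigroup\<close>

text \<open>A partial map of \<open>Mor \<Lambda>\<close> is represented by its graph: the join of compatible partial
  maps is the union of the graphs, the inverse of a partial bijection is its converse, and
  \<open>s \<circ>\<^sub>p t\<close> applies \<open>t\<close> first.\<close>

type_synonym 'a pmap = "('a \<times> 'a) set"

abbreviation pcomp :: "'a pmap \<Rightarrow> 'a pmap \<Rightarrow> 'a pmap" (infixr \<open>\<circ>\<^sub>p\<close> 75) where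
  "s \<circ>\<^sub>p t \<equiv> t O s"

definition tau :: "'a category \<Rightarrow> 'a \<Rightarrow> 'a pmap" where
  "tau \<Lambda> \<alpha> = {(\<beta>, \<alpha> \<cdot>\<^bsub>\<Lambda>\<^esub> \<beta>) | \<beta>. \<beta> \<in> Mor \<Lambda> \<and> rng \<Lambda> \<beta> = src \<Lambda> \<alpha>}"

definition sigma :: "'a category \<Rightarrow> 'a \<Rightarrow> 'a pmap" where
  "sigma \<Lambda> \<alpha> = (tau \<Lambda> \<alpha>)\<inverse>"

inductive_set inv_semigroup :: "'a category \<Rightarrow> 'a pmap set" for \<Lambda> :: "'a category" where
  tau: "\<alpha> \<in> Mor \<Lambda> \<Longrightarrow> tau \<Lambda> \<alpha> \<in> inv_semigroup \<Lambda>"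
| sigma: "\<alpha> \<in> Mor \<Lambda> \<Longrightarrow> sigma \<Lambda> \<alpha> \<in> inv_semigroup \<Lambda>"
| mult: "\<lbrakk>s \<in> inv_semigroup \<Lambda>; t \<in> inv_semigroup \<Lambda>\<rbrakk> \<Longrightarrow> s \<circ>\<^sub>p t \<in> inv_semigroup \<Lambda>"
| inverse: "s \<in> inv_semigroup \<Lambda> \<Longrightarrow> s\<inverse> \<in> inv_semigroup \<Lambda>"

text \<open>\<open>P\<close> lists the pairs $(\alpha_i,\beta_i)$ of a decomposition
  $s = \bigvee_i \tau^{\alpha_i}\sigma^{\beta_i}$; the empty join is the empty map.\<close>

definition join_decomp :: "'a category \<Rightarrow> 'a pmap \<Rightarrow> ('a \<times> 'a) set \<Rightarrow> bool" where
  "join_decomp \<Lambda> s P \<longleftrightarrow>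
     finite P \<and> (\<forall>(\<alpha>, \<beta>)\<in>P. \<alpha> \<in> Mor \<Lambda> \<and> \<beta> \<in> Mor \<Lambda> \<and> src \<Lambda> \<alpha> = src \<Lambda> \<beta>) \<and>
     s = (\<Union>(\<alpha>, \<beta>)\<in>P. tau \<Lambda> \<alpha> \<circ>\<^sub>p sigma \<Lambda> \<beta>)"


section \<open>The path space\<close>

definition path_space :: "'a category \<Rightarrow> 'a set set" where
  "path_space \<Lambda> = {F. F \<noteq> {} \<and> F \<subseteq> Mor \<Lambda> \<and>
     (\<forall>\<alpha> \<beta>. cat_le \<Lambda> \<alpha> \<beta> \<and> \<beta> \<in> F \<longrightarrow> \<alpha> \<in> F) \<and>
     (\<forall>\<alpha>\<in>F. \<forall>\<beta>\<in>F. \<exists>\<gamma>\<in>F. cat_le \<Lambda> \<alpha> \<gamma> \<and> cat_le \<Lambda> \<beta> \<gamma>)}"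

definition path_topology :: "'a category \<Rightarrow> 'a set topology" where
  "path_topology \<Lambda> = topology_generated_by
     {{F \<in> path_space \<Lambda>. X \<subseteq> F \<and> Y \<inter> F = {}} | X Y.
        finite X \<and> X \<subseteq> Mor \<Lambda> \<and> finite Y \<and> Y \<subseteq> Mor \<Lambda>}"

definition tight_paths :: "'a category \<Rightarrow> 'a set set" where
  "tight_paths \<Lambda> = {C \<in> path_space \<Lambda>.
     \<forall>\<alpha>\<in>C. \<forall>B. finite B \<and> B \<subseteq> Mor \<Lambda> \<and> B \<inter> C = {} \<longrightarrow>
       (\<forall>Z. finite Z \<and> Z \<subseteq> exts \<Lambda> \<alpha> - (\<Union>\<beta>\<in>B. exts \<Lambda> \<beta>) \<and>
            (\<forall>\<gamma>\<in>exts \<Lambda> \<alpha> - (\<Union>\<beta>\<in>B. exts \<Lambda> \<beta>). \<exists>z\<in>Z. meets \<Lambda> \<gamma> z)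
            \<longrightarrow> C \<inter> Z \<noteq> {})}"

definition tight_topology :: "'a category \<Rightarrow> 'a set topology" where
  "tight_topology \<Lambda> = subtopology (path_topology \<Lambda>) (tight_paths \<Lambda>)"


section \<open>The action\<close>

text \<open>The formula for $\tau^\alpha\sigma^\beta\cdot F$; below, \<open>\<delta>\<close> is $\sigma^\beta(\gamma)$.\<close>

definition tau_sigma_act :: "'a category \<Rightarrow> 'a \<Rightarrow> 'a \<Rightarrow> 'a set \<Rightarrow> 'a set" where
  "tau_sigma_act \<Lambda> \<alpha> \<beta> F =
     \<Union>{inits \<Lambda> (\<alpha> \<cdot>\<^bsub>\<Lambda>\<^esub> \<delta>) | \<gamma> \<delta>. \<gamma> \<in> F \<and> cat_le \<Lambda> \<beta> \<gamma> \<and> (\<gamma>, \<delta>) \<in> sigma \<Lambda> \<beta>}"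

text \<open>\<open>act_dom \<Lambda> s\<close> is the domain $E_{s^*s}$ of the action of \<open>s\<close>.  If \<open>e\<close> is idempotent then
  $e^*e = e$, so \<open>act_dom \<Lambda> e\<close> is $E_e$.\<close>

definition act_dom :: "'a category \<Rightarrow> 'a pmap \<Rightarrow> 'a set set" where
  "act_dom \<Lambda> s = {F \<in> path_space \<Lambda>. \<exists>P \<alpha> \<beta>. join_decomp \<Lambda> s P \<and> (\<alpha>, \<beta>) \<in> P \<and> \<beta> \<in> F}"

definition act :: "'a category \<Rightarrow> 'a pmap \<Rightarrow> 'a set \<Rightarrow> 'a set" where
  "act \<Lambda> s F = (THE K. \<exists>P \<alpha> \<beta>. join_decomp \<Lambda> s P \<and> (\<alpha>, \<beta>) \<in> P \<and> \<beta> \<in> F \<and>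
                             K = tau_sigma_act \<Lambda> \<alpha> \<beta> F)"


section \<open>Topological groupoids\<close>

record 'g top_groupoid =
  arrows :: "'g set"
  composable :: "('g \<times> 'g) set"
  gmult :: "'g \<Rightarrow> 'g \<Rightarrow> 'g"
  ginv :: "'g \<Rightarrow> 'g"
  gtop :: "'g topology"

definition is_groupoid :: "'g top_groupoid \<Rightarrow> bool" where
  "is_groupoid G \<longleftrightarrow>
     composable G \<subseteq> arrows G \<times> arrows G \<and>
     (\<forall>(x, y)\<in>composable G. gmult G x y \<in> arrows G) \<and>
     (\<forall>x\<in>arrows G. ginv G x \<in> arrows G \<and> ginv G (ginv G x) = x) \<and>
     (\<forall>x y z. (x, y) \<in> composable G \<and> (y, z) \<in> composable G \<longrightarrow>
        (gmult G x y, z) \<in> composable G \<and> (x, gmult G y z) \<in> composable G \<and>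
        gmult G (gmult G x y) z = gmult G x (gmult G y z)) \<and>
     (\<forall>x\<in>arrows G. (ginv G x, x) \<in> composable G \<and> (x, ginv G x) \<in> composable G) \<and>
     (\<forall>(x, y)\<in>composable G. gmult G (ginv G x) (gmult G x y) = y \<and>
                            gmult G (gmult G x y) (ginv G y) = x)"

definition is_top_groupoid :: "'g top_groupoid \<Rightarrow> bool" where
  "is_top_groupoid G \<longleftrightarrow>
     is_groupoid G \<and> topspace (gtop G) = arrows G \<and>
     continuous_map (subtopology (prod_topology (gtop G) (gtop G)) (composable G)) (gtop G)
       (\<lambda>(x, y). gmult G x y) \<and>
     continuous_map (gtop G) (gtop G) (ginv G)"

definition top_groupoid_iso :: "'g top_groupoid \<Rightarrow> 'h top_groupoid \<Rightarrow> ('g \<Rightarrow> 'h) \<Rightarrow> bool" where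
  "top_groupoid_iso G H \<Phi> \<longleftrightarrow>
     is_top_groupoid G \<and> is_top_groupoid H \<and>
     bij_betw \<Phi> (arrows G) (arrows H) \<and>
     (\<forall>x\<in>arrows G. \<forall>y\<in>arrows G. (x, y) \<in> composable G \<longleftrightarrow> (\<Phi> x, \<Phi> y) \<in> composable H) \<and>
     (\<forall>(x, y)\<in>composable G. \<Phi> (gmult G x y) = gmult H (\<Phi> x) (\<Phi> y)) \<and>
     homeomorphic_map (gtop G) (gtop H) \<Phi>"

definition restrict_groupoid :: "'g top_groupoid \<Rightarrow> 'g set \<Rightarrow> 'g top_groupoid" where
  "restrict_groupoid G A =
     \<lparr>arrows = arrows G \<inter> A, composable = composable G \<inter> A \<times> A,
      gmult = gmult G, ginv = ginv G, gtop = subtopology (gtop G) A\<rparr>"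


section \<open>The groupoid of germs\<close>

definition germ_pairs :: "'a category \<Rightarrow> ('a pmap \<times> 'a set) set" where
  "germ_pairs \<Lambda> = {(s, F). s \<in> inv_semigroup \<Lambda> \<and> F \<in> tight_paths \<Lambda> \<inter> act_dom \<Lambda> s}"

definition germ_rel :: "'a category \<Rightarrow> (('a pmap \<times> 'a set) \<times> ('a pmap \<times> 'a set)) set" where
  "germ_rel \<Lambda> = {((s, F), (t, F')). (s, F) \<in> germ_pairs \<Lambda> \<and> (t, F') \<in> germ_pairs \<Lambda> \<and> F = F' \<and>
     (\<exists>e\<in>inv_semigroup \<Lambda>. e \<circ>\<^sub>p e = e \<and> F \<in> act_dom \<Lambda> e \<and> s \<circ>\<^sub>p e = t \<circ>\<^sub>p e)}"

type_synonym 'a germ = "('a pmap \<times> 'a set) set"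

definition germ :: "'a category \<Rightarrow> 'a pmap \<Rightarrow> 'a set \<Rightarrow> 'a germ" where
  "germ \<Lambda> s F = germ_rel \<Lambda> `` {(s, F)}"

definition germ_d :: "'a category \<Rightarrow> 'a germ \<Rightarrow> 'a set" where
  "germ_d \<Lambda> x = (THE F. \<exists>s. (s, F) \<in> germ_pairs \<Lambda> \<and> x = germ \<Lambda> s F)"

definition germ_r :: "'a category \<Rightarrow> 'a germ \<Rightarrow> 'a set" where
  "germ_r \<Lambda> x = (THE K. \<exists>s F. (s, F) \<in> germ_pairs \<Lambda> \<and> x = germ \<Lambda> s F \<and> K = act \<Lambda> s F)"

definition germ_mult :: "'a category \<Rightarrow> 'a germ \<Rightarrow> 'a germ \<Rightarrow> 'a germ" where
  "germ_mult \<Lambda> x y = (THE z. \<exists>s t F.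
     (t, F) \<in> germ_pairs \<Lambda> \<and> (s, act \<Lambda> t F) \<in> germ_pairs \<Lambda> \<and>
     x = germ \<Lambda> s (act \<Lambda> t F) \<and> y = germ \<Lambda> t F \<and> z = germ \<Lambda> (s \<circ>\<^sub>p t) F)"

definition germ_inv :: "'a category \<Rightarrow> 'a germ \<Rightarrow> 'a germ" where
  "germ_inv \<Lambda> x = (THE z. \<exists>s F.
     (s, F) \<in> germ_pairs \<Lambda> \<and> x = germ \<Lambda> s F \<and> z = germ \<Lambda> (s\<inverse>) (act \<Lambda> s F))"

definition germ_groupoid :: "'a category \<Rightarrow> 'a germ top_groupoid" where
  "germ_groupoid \<Lambda> =
     \<lparr>arrows = germ_pairs \<Lambda> // germ_rel \<Lambda>,
      composable = {(x, y). x \<in> germ_pairs \<Lambda> // germ_rel \<Lambda> \<and> y \<in> germ_pairs \<Lambda> // germ_rel \<Lambda> \<and>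
                            germ_d \<Lambda> x = germ_r \<Lambda> y},
      gmult = germ_mult \<Lambda>,
      ginv = germ_inv \<Lambda>,
      gtop = topology_generated_by
        {germ \<Lambda> s ` U | s U. s \<in> inv_semigroup \<Lambda> \<and>
           U \<subseteq> act_dom \<Lambda> s \<inter> tight_paths \<Lambda> \<and> openin (tight_topology \<Lambda>) U}\<rparr>"


section \<open>Spielberg's groupoid\<close>

definition triples :: "'a category \<Rightarrow> ('a \<times> 'a \<times> 'a set) set" where
  "triples \<Lambda> = {(\<alpha>, \<beta>, F). \<alpha> \<in> Mor \<Lambda> \<and> \<beta> \<in> Mor \<Lambda> \<and> F \<in> path_space \<Lambda> \<and>
     src \<Lambda> \<alpha> = src \<Lambda> \<beta> \<and> src \<Lambda> \<beta> \<in> F}"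

text \<open>The conditions \<open>src \<Lambda> \<gamma> \<in> G\<close> and \<open>rng \<Lambda> \<gamma> = src \<Lambda> \<alpha>\<close>, and their primed versions, say
  that the expressions $\tau^\gamma\cdot G$, $\alpha\gamma$, $\beta\gamma$ are defined.\<close>

definition triple_rel :: "'a category \<Rightarrow> (('a \<times> 'a \<times> 'a set) \<times> ('a \<times> 'a \<times> 'a set)) set" where
  "triple_rel \<Lambda> = {((\<alpha>, \<beta>, F), (\<alpha>', \<beta>', F')).
     (\<alpha>, \<beta>, F) \<in> triples \<Lambda> \<and> (\<alpha>', \<beta>', F') \<in> triples \<Lambda> \<and>
     (\<exists>G\<in>path_space \<Lambda>. \<exists>\<gamma>\<in>Mor \<Lambda>. \<exists>\<gamma>'\<in>Mor \<Lambda>.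
        src \<Lambda> \<gamma> \<in> G \<and> src \<Lambda> \<gamma>' \<in> G \<and> rng \<Lambda> \<gamma> = src \<Lambda> \<alpha> \<and> rng \<Lambda> \<gamma>' = src \<Lambda> \<alpha>' \<and>
        F = act \<Lambda> (tau \<Lambda> \<gamma>) G \<and> F' = act \<Lambda> (tau \<Lambda> \<gamma>') G \<and>
        \<alpha> \<cdot>\<^bsub>\<Lambda>\<^esub> \<gamma> = \<alpha>' \<cdot>\<^bsub>\<Lambda>\<^esub> \<gamma>' \<and> \<beta> \<cdot>\<^bsub>\<Lambda>\<^esub> \<gamma> = \<beta>' \<cdot>\<^bsub>\<Lambda>\<^esub> \<gamma>')}"

type_synonym 'a spiel = "('a \<times> 'a \<times> 'a set) set"

definition spiel_class :: "'a category \<Rightarrow> 'a \<Rightarrow> 'a \<Rightarrow> 'a set \<Rightarrow> 'a spiel" where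
  "spiel_class \<Lambda> \<alpha> \<beta> F = triple_rel \<Lambda> `` {(\<alpha>, \<beta>, F)}"

definition spiel_mult :: "'a category \<Rightarrow> 'a spiel \<Rightarrow> 'a spiel \<Rightarrow> 'a spiel" where
  "spiel_mult \<Lambda> x y = (THE z. \<exists>\<alpha> \<beta> F \<gamma> \<delta> G \<xi> \<eta> H.
     (\<alpha>, \<beta>, F) \<in> triples \<Lambda> \<and> (\<gamma>, \<delta>, G) \<in> triples \<Lambda> \<and>
     x = spiel_class \<Lambda> \<alpha> \<beta> F \<and> y = spiel_class \<Lambda> \<gamma> \<delta> G \<and>
     act \<Lambda> (tau \<Lambda> \<beta>) F = act \<Lambda> (tau \<Lambda> \<gamma>) G \<and>
     \<xi> \<in> F \<and> \<eta> \<in> G \<and> \<beta> \<cdot>\<^bsub>\<Lambda>\<^esub> \<xi> = \<gamma> \<cdot>\<^bsub>\<Lambda>\<^esub> \<eta> \<and>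
     H = act \<Lambda> (sigma \<Lambda> \<xi>) F \<and> H = act \<Lambda> (sigma \<Lambda> \<eta>) G \<and>
     z = spiel_class \<Lambda> (\<alpha> \<cdot>\<^bsub>\<Lambda>\<^esub> \<xi>) (\<delta> \<cdot>\<^bsub>\<Lambda>\<^esub> \<eta>) H)"

definition spiel_inv :: "'a category \<Rightarrow> 'a spiel \<Rightarrow> 'a spiel" where
  "spiel_inv \<Lambda> x = (THE z. \<exists>\<alpha> \<beta> F.
     (\<alpha>, \<beta>, F) \<in> triples \<Lambda> \<and> x = spiel_class \<Lambda> \<alpha> \<beta> F \<and> z = spiel_class \<Lambda> \<beta> \<alpha> F)"

text \<open>In the basic open sets, only those \<open>F\<close> in \<open>U\<close> contribute for which \<open>(\<alpha>, \<beta>, F)\<close> is an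
  admissible triple.\<close>

definition spiel_groupoid :: "'a category \<Rightarrow> 'a spiel top_groupoid" where
  "spiel_groupoid \<Lambda> =
     \<lparr>arrows = triples \<Lambda> // triple_rel \<Lambda>,
      composable = {(x, y). \<exists>\<alpha> \<beta> F \<gamma> \<delta> G.
         (\<alpha>, \<beta>, F) \<in> triples \<Lambda> \<and> (\<gamma>, \<delta>, G) \<in> triples \<Lambda> \<and>
         x = spiel_class \<Lambda> \<alpha> \<beta> F \<and> y = spiel_class \<Lambda> \<gamma> \<delta> G \<and>
         act \<Lambda> (tau \<Lambda> \<beta>) F = act \<Lambda> (tau \<Lambda> \<gamma>) G},
      gmult = spiel_mult \<Lambda>,
      ginv = spiel_inv \<Lambda>,
      gtop = topology_generated_by
        {{spiel_class \<Lambda> \<alpha> \<beta> F | F. F \<in> U \<and> (\<alpha>, \<beta>, F) \<in> triples \<Lambda>} | \<alpha> \<beta> U.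
           \<alpha> \<in> Mor \<Lambda> \<and> \<beta> \<in> Mor \<Lambda> \<and> src \<Lambda> \<alpha> = src \<Lambda> \<beta> \<and> openin (path_topology \<Lambda>) U}\<rparr>"

definition spiel_boundary_groupoid :: "'a category \<Rightarrow> 'a spiel top_groupoid" where
  "spiel_boundary_groupoid \<Lambda> = restrict_groupoid (spiel_groupoid \<Lambda>)
     {spiel_class \<Lambda> \<alpha> \<beta> F | \<alpha> \<beta> F. (\<alpha>, \<beta>, F) \<in> triples \<Lambda> \<and> F \<in> tight_paths \<Lambda>}"

end

theory Submission
  imports Defs
begin

text \<open>Elements of \<open>\<S>\<^sub>\<Lambda>\<close> commute with right multiplication, so \<open>s\<close> acts on a path \<open>F\<close> by taking all
  initial segments of the values of \<open>s\<close> on \<open>F\<close>, and \<open>F\<close> is in the domain exactly when it meets the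
  domain of \<open>s\<close>.  Because paths are directed, \<open>[s, F] = [t, F]\<close> holds exactly when \<open>s\<close> and \<open>t\<close> take
  the same value at one point of \<open>F\<close>.  Spielberg's equivalence is the same condition for
  \<open>\<tau>\<^sup>\<alpha> \<sigma>\<^sup>\<beta>\<close> at the path \<open>\<tau>\<^sup>\<beta> \<cdot> F\<close>, which gives injectivity of \<open>\<Phi>\<close>; surjectivity holds since the
  restriction of \<open>s\<close> to \<open>\<beta>\<Lambda>\<close> is \<open>\<tau>\<^sup>\<alpha> \<sigma>\<^sup>\<beta>\<close>, where \<open>\<alpha>\<close> is the value of \<open>s\<close> at \<open>\<beta>\<close>.  The germ groupoid is a topological
  groupoid because the action is by partial homeomorphisms, and its structure is transported to
  Spielberg's groupoid along \<open>\<Phi>\<close>.\<close>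

subsection \<open>Groupoids\<close>

text \<open>The definitions choose representatives throughout: \<open>act\<close> ranges over all
  join decompositions, and products and inverses over all representatives of a class. The formula
  \<open>pact\<close> and the relation \<open>agree\<close> involve no such choice, so each definite
  description is evaluated by reducing it to them. For Spielberg's product and inverse even this is
  avoided: all admissible values have the same image under the injective map \<Phi>, hence coincide.
  Finite alignment replaces the set of all common extensions of two morphisms by finitely many of
  them. This is needed for three facts: a product of finite joins is again a finite join, the action
  preserves tightness, and not belonging to \<open>pact s F\<close> is an open condition on
  \<open>F\<close>. Tightness enters the comparison of the two groupoids as an invariant:
  \<open>\<tau>\<^sup>\<beta> \<cdot> F\<close> is tight exactly when \<open>F\<close> is, so the
  boundary consists of whole equivalence classes.\<close>

lemma is_groupoidI:
  assumes "\<And>x y. (x, y) \<in> composable G \<Longrightarrow> x \<in> arrows G"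
    and "\<And>x y. (x, y) \<in> composable G \<Longrightarrow> y \<in> arrows G"
    and "\<And>x y. (x, y) \<in> composable G \<Longrightarrow> gmult G x y \<in> arrows G"
    and "\<And>x y. (x, y) \<in> composable G \<Longrightarrow> gmult G (ginv G x) (gmult G x y) = y"
    and "\<And>x y. (x, y) \<in> composable G \<Longrightarrow> gmult G (gmult G x y) (ginv G y) = x"
    and "\<And>x. x \<in> arrows G \<Longrightarrow> ginv G x \<in> arrows G"
    and "\<And>x. x \<in> arrows G \<Longrightarrow> ginv G (ginv G x) = x"
    and "\<And>x. x \<in> arrows G \<Longrightarrow> (ginv G x, x) \<in> composable G"
    and "\<And>x. x \<in> arrows G \<Longrightarrow> (x, ginv G x) \<in> composable G"
    and "\<And>x y z. (x, y) \<in> composable G \<Longrightarrow> (y, z) \<in> composable G \<Longrightarrow> (gmult G x y, z) \<in> composable G"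
    and "\<And>x y z. (x, y) \<in> composable G \<Longrightarrow> (y, z) \<in> composable G \<Longrightarrow> (x, gmult G y z) \<in> composable G"
    and "\<And>x y z. (x, y) \<in> composable G \<Longrightarrow> (y, z) \<in> composable G \<Longrightarrow>
      gmult G (gmult G x y) z = gmult G x (gmult G y z)"
  shows "is_groupoid G"
  unfolding is_groupoid_def using assms by auto

text \<open>Each groupoid law is a composability condition or an equation between arrows, so it can
  be checked after applying the injective \<open>f\<close>, where it is a law of \<open>H\<close>.
  With \<open>g\<close> the inverse homeomorphism, the multiplication of \<open>G\<close> is that of
  \<open>H\<close> between \<open>f\<close> on both factors and \<open>g\<close>, and likewise for
  inversion; so both are continuous.\<close>

lemma top_groupoid_iso_transfer:
  assumes H: "is_top_groupoid H"
    and comp_sub: "composable G \<subseteq> arrows G \<times> arrows G"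
    and bij: "bij_betw f (arrows G) (arrows H)"
    and comp: "\<And>x y. x \<in> arrows G \<Longrightarrow> y \<in> arrows G \<Longrightarrow>
      (x, y) \<in> composable G \<longleftrightarrow> (f x, f y) \<in> composable H"
    and mult: "\<And>x y. (x, y) \<in> composable G \<Longrightarrow>
      gmult G x y \<in> arrows G \<and> f (gmult G x y) = gmult H (f x) (f y)"
    and inv: "\<And>x. x \<in> arrows G \<Longrightarrow> ginv G x \<in> arrows G \<and> f (ginv G x) = ginv H (f x)"
    and top: "topspace (gtop G) = arrows G"
    and homeo: "homeomorphic_map (gtop G) (gtop H) f"
  shows "top_groupoid_iso G H f"
proof -
  have grH: "is_groupoid H" and topH: "topspace (gtop H) = arrows H"
    and cmH: "continuous_map (subtopology (prod_topology (gtop H) (gtop H)) (composable H)) (gtop H)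
       (\<lambda>(x, y). gmult H x y)"
    and ciH: "continuous_map (gtop H) (gtop H) (ginv H)"
    using H by (auto simp: is_top_groupoid_def)
  have inj: "x = y" if "x \<in> arrows G" "y \<in> arrows G" "f x = f y" for x y
    using bij that by (auto simp: bij_betw_def inj_on_def)
  have fA: "f x \<in> arrows H" if "x \<in> arrows G" for x using bij that by (auto simp: bij_betw_def)
  have cA: "x \<in> arrows G" "y \<in> arrows G" "(f x, f y) \<in> composable H" if "(x, y) \<in> composable G" for x y
    using comp_sub comp that by auto
  have gH: "\<And>x y. (x, y) \<in> composable H \<Longrightarrow>
      gmult H (ginv H x) (gmult H x y) = y \<and> gmult H (gmult H x y) (ginv H y) = x"
    "\<And>x. x \<in> arrows H \<Longrightarrow> ginv H (ginv H x) = x \<and> (ginv H x, x) \<in> composable H \<and> (x, ginv H x) \<in> composable H"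
    "\<And>x y z. (x, y) \<in> composable H \<Longrightarrow> (y, z) \<in> composable H \<Longrightarrow>
      (gmult H x y, z) \<in> composable H \<and> (x, gmult H y z) \<in> composable H \<and>
      gmult H (gmult H x y) z = gmult H x (gmult H y z)"
    using grH unfolding is_groupoid_def by auto
  have invG: "(ginv G x, x) \<in> composable G" "(x, ginv G x) \<in> composable G" if "x \<in> arrows G" for x
    using that comp inv fA gH(2) by auto
  have assocG: "(gmult G x y, z) \<in> composable G" "(x, gmult G y z) \<in> composable G"
    if "(x, y) \<in> composable G" "(y, z) \<in> composable G" for x y z
    using comp[of "gmult G x y" z] comp[of x "gmult G y z"] mult[OF that(1)] mult[OF that(2)]
      cA[OF that(1)] cA[OF that(2)] gH(3) by auto
  have grG: "is_groupoid G"
  proof (rule is_groupoidI)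
    fix x y assume xy: "(x, y) \<in> composable G"
    note c = cA[OF xy] and m = mult[OF xy]
    show "x \<in> arrows G" "y \<in> arrows G" "gmult G x y \<in> arrows G" using c m by auto
    have 1: "(ginv G x, gmult G x y) \<in> composable G" using assocG(2)[OF invG(1)[OF c(1)] xy] .
    show "gmult G (ginv G x) (gmult G x y) = y"
      using mult[OF 1] c m inv[OF c(1)] gH(1)[OF c(3)] by (intro inj) auto
    have 2: "(gmult G x y, ginv G y) \<in> composable G" using assocG(1)[OF xy invG(2)[OF c(2)]] .
    show "gmult G (gmult G x y) (ginv G y) = x"
      using mult[OF 2] c m inv[OF c(2)] gH(1)[OF c(3)] by (intro inj) auto
  next
    fix x assume x: "x \<in> arrows G"
    show "ginv G x \<in> arrows G" "(ginv G x, x) \<in> composable G" "(x, ginv G x) \<in> composable G"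
      using inv[OF x] invG[OF x] by auto
    show "ginv G (ginv G x) = x"
      using inv[OF x] inv[of "ginv G x"] x gH(2)[OF fA[OF x]] by (intro inj) auto
  next
    fix x y z assume xyz: "(x, y) \<in> composable G" "(y, z) \<in> composable G"
    show "(gmult G x y, z) \<in> composable G" "(x, gmult G y z) \<in> composable G"
      by (fact assocG[OF xyz])+
    show "gmult G (gmult G x y) z = gmult G x (gmult G y z)"
      using mult[OF assocG(1)[OF xyz]] mult[OF assocG(2)[OF xyz]] mult[OF xyz(1)] mult[OF xyz(2)]
        gH(3)[OF cA(3)[OF xyz(1)] cA(3)[OF xyz(2)]] by (intro inj) auto
  qed
  obtain g where "homeomorphic_maps (gtop G) (gtop H) f g"
    using homeo unfolding homeomorphic_map_maps by blast
  then have cf: "continuous_map (gtop G) (gtop H) f" and cg: "continuous_map (gtop H) (gtop G) g"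
    and gf: "\<And>x. x \<in> arrows G \<Longrightarrow> g (f x) = x"
    using top by (auto simp: homeomorphic_maps_def)
  let ?PG = "subtopology (prod_topology (gtop G) (gtop G)) (composable G)"
  let ?PH = "subtopology (prod_topology (gtop H) (gtop H)) (composable H)"
  have tPG: "topspace ?PG = composable G" using comp_sub top by auto
  have "continuous_map ?PG (prod_topology (gtop H) (gtop H)) (\<lambda>p. (f (fst p), f (snd p)))"
    by (intro continuous_map_pairedI continuous_map_compose[OF _ cf, unfolded o_def]
        continuous_map_from_subtopology continuous_map_fst continuous_map_snd)
  then have "continuous_map ?PG ?PH (\<lambda>p. (f (fst p), f (snd p)))"
    unfolding continuous_map_in_subtopology tPG using cA(3) by auto
  then have "continuous_map ?PG (gtop G) (g \<circ> ((\<lambda>(x, y). gmult H x y) \<circ> (\<lambda>p. (f (fst p), f (snd p)))))"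
    by (intro continuous_map_compose[OF _ cg] continuous_map_compose[OF _ cmH])
  then have "continuous_map ?PG (gtop G) (\<lambda>(x, y). gmult G x y)"
  proof (rule continuous_map_eq)
    fix p assume "p \<in> topspace ?PG"
    then have p: "(fst p, snd p) \<in> composable G" unfolding tPG by simp
    show "(g \<circ> ((\<lambda>(x, y). gmult H x y) \<circ> (\<lambda>p. (f (fst p), f (snd p))))) p = (\<lambda>(x, y). gmult G x y) p"
      using mult[OF p] gf by (simp add: case_prod_beta flip: mult[OF p, THEN conjunct2])
  qed
  moreover have "continuous_map (gtop G) (gtop G) (g \<circ> (ginv H \<circ> f))"
    by (intro continuous_map_compose[OF _ cg] continuous_map_compose[OF cf ciH])
  then have "continuous_map (gtop G) (gtop G) (ginv G)"
  proof (rule continuous_map_eq)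
    fix x assume "x \<in> topspace (gtop G)"
    then have "x \<in> arrows G" using top by simp
    then show "(g \<circ> (ginv H \<circ> f)) x = ginv G x" using inv gf by (metis comp_apply)
  qed
  ultimately have "is_top_groupoid G" unfolding is_top_groupoid_def using grG top by blast
  then show ?thesis unfolding top_groupoid_iso_def using H bij comp mult homeo by blast
qed

locale finitely_aligned_lcsc = small_category \<Lambda> for \<Lambda> :: "'a category" (structure) +
  assumes fin_aligned: "finitely_aligned \<Lambda>"
    and left_canc: "left_cancellative \<Lambda>"
begin

subsection \<open>Divisibility\<close>

lemma cancel:
  assumes "a \<in> Mor \<Lambda>" "b \<in> Mor \<Lambda>" "c \<in> Mor \<Lambda>" "src \<Lambda> a = rng \<Lambda> b" "src \<Lambda> a = rng \<Lambda> c"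
    "a \<cdot> b = a \<cdot> c"
  shows "b = c"
  using left_canc assms unfolding left_cancellative_def by blast

lemma in_exts_iff: "x \<in> exts \<Lambda> a \<longleftrightarrow> (\<exists>b\<in>Mor \<Lambda>. rng \<Lambda> b = src \<Lambda> a \<and> x = a \<cdot> b)"
  by (auto simp: exts_def)

lemma cat_leI: "\<lbrakk>a \<in> Mor \<Lambda>; b \<in> Mor \<Lambda>; rng \<Lambda> b = src \<Lambda> a\<rbrakk> \<Longrightarrow> cat_le \<Lambda> a (a \<cdot> b)"
  by (auto simp: cat_le_def in_exts_iff)

lemma cat_leE:
  assumes "cat_le \<Lambda> a x"
  obtains b where "a \<in> Mor \<Lambda>" "b \<in> Mor \<Lambda>" "rng \<Lambda> b = src \<Lambda> a" "x = a \<cdot> b"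
  using assms by (auto simp: cat_le_def in_exts_iff)

lemma cat_le_refl: "a \<in> Mor \<Lambda> \<Longrightarrow> cat_le \<Lambda> a a"
  using cat_leI[of a "src \<Lambda> a"] by (simp add: src_in_Mor rng_src cmp_src_self)

lemma cat_le_Mor: "cat_le \<Lambda> a b \<Longrightarrow> a \<in> Mor \<Lambda> \<and> b \<in> Mor \<Lambda>"
  by (auto elim!: cat_leE intro: cmp_in_Mor)

lemma cat_le_trans:
  assumes "cat_le \<Lambda> a b" "cat_le \<Lambda> b c"
  shows "cat_le \<Lambda> a c"
proof -
  obtain x where x: "a \<in> Mor \<Lambda>" "x \<in> Mor \<Lambda>" "rng \<Lambda> x = src \<Lambda> a" "b = a \<cdot> x"
    using assms(1) by (rule cat_leE)
  obtain y where y: "y \<in> Mor \<Lambda>" "rng \<Lambda> y = src \<Lambda> b" "c = b \<cdot> y"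
    using assms(2) by (rule cat_leE)
  have "rng \<Lambda> y = src \<Lambda> x" using x y by (simp add: src_cmp)
  then have "c = a \<cdot> (x \<cdot> y)" "x \<cdot> y \<in> Mor \<Lambda>" "rng \<Lambda> (x \<cdot> y) = src \<Lambda> a"
    using x y by (auto simp: cmp_assoc cmp_in_Mor rng_cmp)
  then show ?thesis using x cat_leI by auto
qed

lemma exts_subset_Mor: "a \<in> Mor \<Lambda> \<Longrightarrow> exts \<Lambda> a \<subseteq> Mor \<Lambda>"
  by (auto simp: in_exts_iff cmp_in_Mor)

lemma meets_iff:
  "a \<in> Mor \<Lambda> \<Longrightarrow> b \<in> Mor \<Lambda> \<Longrightarrow> meets \<Lambda> a b \<longleftrightarrow> (\<exists>x. cat_le \<Lambda> a x \<and> cat_le \<Lambda> b x)"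
  by (auto simp: meets_def cat_le_def)

text \<open>Each member of the finite set provided by finite alignment extends itself, hence is
  itself a common extension. Every use of finite alignment goes through this form.\<close>

lemma common_extensions:
  assumes "a \<in> Mor \<Lambda>" "b \<in> Mor \<Lambda>"
  obtains \<Gamma> where "finite \<Gamma>" "\<And>g. g \<in> \<Gamma> \<Longrightarrow> cat_le \<Lambda> a g \<and> cat_le \<Lambda> b g"
    "\<And>x. cat_le \<Lambda> a x \<Longrightarrow> cat_le \<Lambda> b x \<Longrightarrow> \<exists>g\<in>\<Gamma>. cat_le \<Lambda> g x"
proof -
  obtain \<Gamma> where \<Gamma>: "finite \<Gamma>" "\<Gamma> \<subseteq> Mor \<Lambda>" "exts \<Lambda> a \<inter> exts \<Lambda> b = (\<Union>g\<in>\<Gamma>. exts \<Lambda> g)"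
    using fin_aligned assms unfolding finitely_aligned_def by meson
  have "cat_le \<Lambda> a g \<and> cat_le \<Lambda> b g" if "g \<in> \<Gamma>" for g
  proof -
    have "g \<in> exts \<Lambda> g" using that \<Gamma>(2) cat_le_refl by (auto simp: cat_le_def)
    then show ?thesis using \<Gamma>(3) that assms by (auto simp: cat_le_def)
  qed
  moreover have "\<exists>g\<in>\<Gamma>. cat_le \<Lambda> g x" if "cat_le \<Lambda> a x" "cat_le \<Lambda> b x" for x
    using that \<Gamma>(2,3) unfolding cat_le_def by blast
  ultimately show ?thesis using that \<Gamma>(1) by blast
qed

subsection \<open>Equivariant partial bijections\<close>

text \<open>The elements of the inverse semigroup commute with right multiplication; this, rather than a
  decomposition into maps \<open>\<tau>\<^sup>\<alpha> \<sigma>\<^sup>\<beta>\<close>, is what makes their action on paths well defined.\<close>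

definition equivariant :: "'a pmap \<Rightarrow> bool" where
  "equivariant s \<longleftrightarrow> s \<subseteq> Mor \<Lambda> \<times> Mor \<Lambda> \<and> single_valued s \<and> single_valued (s\<inverse>) \<and>
     (\<forall>x y. (x, y) \<in> s \<longrightarrow> src \<Lambda> x = src \<Lambda> y \<and>
        (\<forall>d\<in>Mor \<Lambda>. rng \<Lambda> d = src \<Lambda> x \<longrightarrow> (x \<cdot> d, y \<cdot> d) \<in> s))"

lemma equivariantD:
  assumes "equivariant s" "(x, y) \<in> s"
  shows "x \<in> Mor \<Lambda>" "y \<in> Mor \<Lambda>" "src \<Lambda> x = src \<Lambda> y"
    "\<And>d. d \<in> Mor \<Lambda> \<Longrightarrow> rng \<Lambda> d = src \<Lambda> x \<Longrightarrow> (x \<cdot> d, y \<cdot> d) \<in> s"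
    "\<And>z. (x, z) \<in> s \<Longrightarrow> z = y" "\<And>z. (z, y) \<in> s \<Longrightarrow> z = x"
  using assms unfolding equivariant_def single_valued_def by blast+

lemma equivariant_converse: "equivariant s \<Longrightarrow> equivariant (s\<inverse>)"
  unfolding equivariant_def by auto

lemma equivariant_comp:
  assumes "equivariant s" "equivariant t"
  shows "equivariant (s \<circ>\<^sub>p t)"
  unfolding equivariant_def
proof (intro conjI allI impI ballI)
  show "s \<circ>\<^sub>p t \<subseteq> Mor \<Lambda> \<times> Mor \<Lambda>" "single_valued (s \<circ>\<^sub>p t)"
    using assms unfolding equivariant_def by (blast, blast intro: single_valued_relcomp)
  show "single_valued ((s \<circ>\<^sub>p t)\<inverse>)"
    using assms unfolding equivariant_def converse_relcomp by (blast intro: single_valued_relcomp)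
next
  fix x y d assume "(x, y) \<in> s \<circ>\<^sub>p t"
  then obtain z where z: "(x, z) \<in> t" "(z, y) \<in> s" by auto
  show "src \<Lambda> x = src \<Lambda> y" using equivariantD(3) assms z by metis
  assume "d \<in> Mor \<Lambda>" "rng \<Lambda> d = src \<Lambda> x"
  then show "(x \<cdot> d, y \<cdot> d) \<in> s \<circ>\<^sub>p t"
    using equivariantD(3,4) assms z by (metis relcomp.relcompI)
qed

lemma in_tau_iff: "(x, y) \<in> tau \<Lambda> a \<longleftrightarrow> x \<in> Mor \<Lambda> \<and> rng \<Lambda> x = src \<Lambda> a \<and> y = a \<cdot> x"
  by (auto simp: tau_def)

lemma in_sigma_iff: "(y, x) \<in> sigma \<Lambda> a \<longleftrightarrow> x \<in> Mor \<Lambda> \<and> rng \<Lambda> x = src \<Lambda> a \<and> y = a \<cdot> x"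
  by (simp add: sigma_def in_tau_iff)

lemma equivariant_tau:
  assumes a: "a \<in> Mor \<Lambda>"
  shows "equivariant (tau \<Lambda> a)"
  unfolding equivariant_def
proof (intro conjI allI impI ballI)
  show "tau \<Lambda> a \<subseteq> Mor \<Lambda> \<times> Mor \<Lambda>" "single_valued (tau \<Lambda> a)"
    using a by (auto simp: in_tau_iff single_valued_def cmp_in_Mor)
  \<comment> \<open>Injectivity of left multiplication is exactly left cancellation.\<close>
  show "single_valued ((tau \<Lambda> a)\<inverse>)"
    unfolding single_valued_def converse_iff in_tau_iff using a cancel by metis
next
  fix x y d assume "(x, y) \<in> tau \<Lambda> a"
  then have x: "x \<in> Mor \<Lambda>" "rng \<Lambda> x = src \<Lambda> a" "y = a \<cdot> x" by (auto simp: in_tau_iff)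
  then show "src \<Lambda> x = src \<Lambda> y" using a by (simp add: src_cmp)
  assume "d \<in> Mor \<Lambda>" "rng \<Lambda> d = src \<Lambda> x"
  then show "(x \<cdot> d, y \<cdot> d) \<in> tau \<Lambda> a"
    using x a by (simp add: in_tau_iff cmp_in_Mor rng_cmp cmp_assoc)
qed

lemma equivariant_inv_semigroup: "s \<in> inv_semigroup \<Lambda> \<Longrightarrow> equivariant s"
  by (induction rule: inv_semigroup.induct)
    (auto simp: equivariant_tau sigma_def equivariant_converse equivariant_comp)

text \<open>If \<open>x' = x \<cdot> d\<close> then \<open>y' = y \<cdot> d\<close>. So the domain
  of \<open>s\<close> is closed under extension and \<open>s\<close> is monotone for divisibility;
  applied to the converse, the same holds for the range.\<close>

lemma equivariant_mono:
  assumes "equivariant s" "(x, y) \<in> s" "cat_le \<Lambda> x x'"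
  obtains y' where "(x', y') \<in> s" "cat_le \<Lambda> y y'"
proof -
  obtain d where d: "d \<in> Mor \<Lambda>" "rng \<Lambda> d = src \<Lambda> x" "x' = x \<cdot> d" using assms(3) by (rule cat_leE)
  then show ?thesis
    using that[of "y \<cdot> d"] cat_leI[of y d] equivariantD[OF assms(1,2)] by auto
qed

text \<open>If \<open>e\<close> sends \<open>x\<close> to \<open>z\<close> and \<open>z\<close> to
  \<open>y\<close>, idempotence also sends \<open>x\<close> to \<open>y\<close>. Single-valuedness
  gives \<open>z = y\<close>, and injectivity then gives \<open>x = z\<close>.\<close>

lemma idempotent_subset_Id:
  fixes e :: "'a pmap"
  assumes "equivariant e" "e \<circ>\<^sub>p e = e"
  shows "e \<subseteq> Id"
proof
  fix p assume p: "p \<in> e"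
  obtain x y where xy: "p = (x, y)" by force
  then obtain z where z: "(x, z) \<in> e" "(z, y) \<in> e" using p assms(2) by blast
  then have "z = y" using equivariantD(5)[OF assms(1)] p xy by blast
  then show "p \<in> Id" using equivariantD(6)[OF assms(1) z(2)] z(1) p xy by blast
qed

section \<open>Elementary maps \<open>\<tau>\<^sup>\<alpha> \<sigma>\<^sup>\<beta>\<close>\<close>

abbreviation ts :: "'a \<Rightarrow> 'a \<Rightarrow> 'a pmap" where
  "ts a b \<equiv> tau \<Lambda> a \<circ>\<^sub>p sigma \<Lambda> b"

text \<open>Both range conditions are kept, so the map is empty when the sources of \<open>a\<close>
  and \<open>b\<close> differ, and membership can be unfolded without a side condition.\<close>

lemma in_ts_iff:
  "(x, y) \<in> ts a b \<longleftrightarrow> (\<exists>d\<in>Mor \<Lambda>. rng \<Lambda> d = src \<Lambda> b \<and> rng \<Lambda> d = src \<Lambda> a \<and> x = b \<cdot> d \<and> y = a \<cdot> d)"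
  by (auto simp: in_tau_iff in_sigma_iff relcomp_unfold)

lemma ts_self: "\<lbrakk>a \<in> Mor \<Lambda>; b \<in> Mor \<Lambda>; src \<Lambda> a = src \<Lambda> b\<rbrakk> \<Longrightarrow> (b, a) \<in> ts a b"
  unfolding in_ts_iff
  using cmp_src_self[of a] cmp_src_self[of b] rng_src[of b] src_in_Mor[of b] by metis

lemma ts_inv_semigroup: "\<lbrakk>a \<in> Mor \<Lambda>; b \<in> Mor \<Lambda>\<rbrakk> \<Longrightarrow> ts a b \<in> inv_semigroup \<Lambda>"
  by (intro inv_semigroup.intros)

lemma ts_converse: "(ts a b)\<inverse> = ts b a"
  unfolding set_eq_iff split_paired_All converse_iff in_ts_iff by blast

lemma in_ts_self_iff: "a \<in> Mor \<Lambda> \<Longrightarrow> (x, y) \<in> ts a a \<longleftrightarrow> cat_le \<Lambda> a x \<and> y = x"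
  unfolding in_ts_iff cat_le_def in_exts_iff by blast

lemma ts_idempotent:
  assumes "a \<in> Mor \<Lambda>"
  shows "ts a a \<circ>\<^sub>p ts a a = ts a a"
proof -
  have "ts a a \<subseteq> Id"
    by (intro subrelI) (simp only: in_ts_self_iff[OF assms] pair_in_Id_conv)
  moreover have "e O e = e" if "e \<subseteq> Id" for e :: "'a pmap"
    using that by fastforce
  ultimately show ?thesis by blast
qed

text \<open>Composition with an identity morphism changes nothing, so \<open>sigma\<close> at an
  identity is a partial identity. This gives the generators decompositions with a single
  pair.\<close>

lemma tau_eq_ts:
  assumes "a \<in> Mor \<Lambda>"
  shows "tau \<Lambda> a = ts a (src \<Lambda> a)"
proof -
  have "src \<Lambda> a \<cdot> d = d" if "d \<in> Mor \<Lambda>" "rng \<Lambda> d = src \<Lambda> a" for d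
    using rng_cmp_self that by metis
  then show ?thesis
    unfolding set_eq_iff split_paired_All in_ts_iff in_tau_iff using src_src[OF assms] by auto
qed

lemma sigma_eq_ts: "a \<in> Mor \<Lambda> \<Longrightarrow> sigma \<Lambda> a = ts (src \<Lambda> a) a"
  by (metis sigma_def tau_eq_ts ts_converse)

lemma ts_subset:
  assumes "equivariant s" "(b, a) \<in> s"
  shows "ts a b \<subseteq> s"
  unfolding subset_iff split_paired_All in_ts_iff using equivariantD(3,4)[OF assms] by auto

section \<open>Finite join decompositions\<close>

lemma join_decomp_pairD:
  assumes "join_decomp \<Lambda> s P" "(a, b) \<in> P"
  shows "a \<in> Mor \<Lambda> \<and> b \<in> Mor \<Lambda> \<and> src \<Lambda> a = src \<Lambda> b \<and> (b, a) \<in> s"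
proof -
  have ab: "a \<in> Mor \<Lambda>" "b \<in> Mor \<Lambda>" "src \<Lambda> a = src \<Lambda> b" and "ts a b \<subseteq> s"
    using assms unfolding join_decomp_def by blast+
  with ts_self[OF ab] show ?thesis by blast
qed

text \<open>The value of an equivariant map at \<open>b\<close> forces its value at every
  \<open>b \<cdot> d\<close>. Hence finitely many points of the graph decompose \<open>s\<close> as
  soon as every point of the domain extends one of their first coordinates.\<close>

lemma join_decompI:
  assumes "equivariant s" "finite P" "\<And>a b. (a, b) \<in> P \<Longrightarrow> (b, a) \<in> s"
    "\<And>x y. (x, y) \<in> s \<Longrightarrow> \<exists>(a, b)\<in>P. cat_le \<Lambda> b x"
  shows "join_decomp \<Lambda> s P"
  unfolding join_decomp_def
proof (intro conjI)
  show "finite P" by fact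
  show "\<forall>(a, b)\<in>P. a \<in> Mor \<Lambda> \<and> b \<in> Mor \<Lambda> \<and> src \<Lambda> a = src \<Lambda> b"
    using equivariantD(1,2,3)[OF assms(1) assms(3)] by auto
  show "s = (\<Union>(a, b)\<in>P. ts a b)"
  proof
    show "(\<Union>(a, b)\<in>P. ts a b) \<subseteq> s"
      using ts_subset[OF assms(1) assms(3)] by blast
    show "s \<subseteq> (\<Union>(a, b)\<in>P. ts a b)"
    proof
      fix p assume p: "p \<in> s"
      obtain x y where xy: "p = (x, y)" by force
      obtain a b where ab: "(a, b) \<in> P" "cat_le \<Lambda> b x" using assms(4) p xy by blast
      obtain d where d: "d \<in> Mor \<Lambda>" "rng \<Lambda> d = src \<Lambda> b" "x = b \<cdot> d" using ab(2) by (rule cat_leE)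
      have "(x, a \<cdot> d) \<in> s" using equivariantD(4)[OF assms(1) assms(3)[OF ab(1)]] d by auto
      then have "y = a \<cdot> d" using equivariantD(5)[OF assms(1)] p xy by blast
      then have "p \<in> ts a b"
        using d xy equivariantD(3)[OF assms(1) assms(3)[OF ab(1)]] by (auto simp: in_ts_iff)
      then show "p \<in> (\<Union>(a, b)\<in>P. ts a b)" using ab by blast
    qed
  qed
qed

lemma join_decomp_cover:
  assumes "join_decomp \<Lambda> s P" "(x, y) \<in> s"
  obtains a b where "(a, b) \<in> P" "cat_le \<Lambda> b x" "cat_le \<Lambda> a y"
proof -
  from assms obtain a b where ab: "(a, b) \<in> P" "(x, y) \<in> ts a b"
    unfolding join_decomp_def by blast
  then show ?thesis
    using that[of a b] join_decomp_pairD[OF assms(1) ab(1)] cat_leI by (auto simp: in_ts_iff)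
qed

text \<open>The product is defined where a value \<open>z\<close> of \<open>t\<close> lies in the
  domain of \<open>s\<close>. Such a \<open>z\<close> extends a domain point of the decomposition of
  \<open>s\<close> and a range point of that of \<open>t\<close>, hence one of finitely many common
  extensions \<open>g\<close> of these two. The values \<open>s\<close> takes at these
  \<open>g\<close>, paired with the preimages of the \<open>g\<close> under \<open>t\<close>,
  decompose the product.\<close>

lemma join_decomp_comp:
  assumes "equivariant s" "equivariant t" "join_decomp \<Lambda> s P" "join_decomp \<Lambda> t Q"
  shows "\<exists>R. join_decomp \<Lambda> (s \<circ>\<^sub>p t) R"
proof -
  have "\<exists>\<Gamma>. finite \<Gamma> \<and> (\<forall>g\<in>\<Gamma>. cat_le \<Lambda> (snd p) g \<and> cat_le \<Lambda> (fst q) g) \<and>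
      (\<forall>x. cat_le \<Lambda> (snd p) x \<longrightarrow> cat_le \<Lambda> (fst q) x \<longrightarrow> (\<exists>g\<in>\<Gamma>. cat_le \<Lambda> g x))"
    if "p \<in> P" "q \<in> Q" for p q
  proof -
    have "snd p \<in> Mor \<Lambda>" "fst q \<in> Mor \<Lambda>"
      using join_decomp_pairD[OF assms(3), of "fst p" "snd p"]
        join_decomp_pairD[OF assms(4), of "fst q" "snd q"] that by auto
    then show ?thesis by (rule common_extensions) blast
  qed
  then obtain \<Gamma> where \<Gamma>: "\<And>p q. p \<in> P \<Longrightarrow> q \<in> Q \<Longrightarrow> finite (\<Gamma> p q) \<and>
      (\<forall>g\<in>\<Gamma> p q. cat_le \<Lambda> (snd p) g \<and> cat_le \<Lambda> (fst q) g) \<and>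
      (\<forall>x. cat_le \<Lambda> (snd p) x \<longrightarrow> cat_le \<Lambda> (fst q) x \<longrightarrow> (\<exists>g\<in>\<Gamma> p q. cat_le \<Lambda> g x))"
    by metis
  have fin: "finite P" "finite Q" using assms(3,4) by (auto simp: join_decomp_def)
  define A where "A = (\<Union>p\<in>P. \<Union>q\<in>Q. \<Gamma> p q)"
  have A: "finite A" using fin \<Gamma> by (auto simp: A_def)
  have st: "\<exists>a b. (g, a) \<in> s \<and> (b, g) \<in> t" if gA: "g \<in> A" for g
  proof -
    obtain p q where pq: "p \<in> P" "q \<in> Q" "g \<in> \<Gamma> p q" using gA unfolding A_def by blast
    have *: "(snd p, fst p) \<in> s" "(snd q, fst q) \<in> t"
      using join_decomp_pairD[OF assms(3), of "fst p" "snd p"]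
        join_decomp_pairD[OF assms(4), of "fst q" "snd q"] pq by auto
    have le: "cat_le \<Lambda> (snd p) g" "cat_le \<Lambda> (fst q) g" using \<Gamma>[OF pq(1,2)] pq(3) by auto
    obtain a where "(g, a) \<in> s" by (rule equivariant_mono[OF assms(1) *(1) le(1)])
    moreover have "(fst q, snd q) \<in> t\<inverse>" using *(2) by (rule converseI)
    then obtain b where "(g, b) \<in> t\<inverse>"
      by (rule equivariant_mono[OF equivariant_converse[OF assms(2)] _ le(2)])
    ultimately show ?thesis by blast
  qed
  \<comment> \<open>\<open>u g\<close> is the value of \<open>s\<close> at \<open>g\<close>, and
    \<open>v g\<close> is the preimage of \<open>g\<close> under \<open>t\<close>.\<close>
  then obtain u v where uv: "\<And>g. g \<in> A \<Longrightarrow> (g, u g) \<in> s \<and> (v g, g) \<in> t" by metis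
  have "join_decomp \<Lambda> (s \<circ>\<^sub>p t) ((\<lambda>g. (u g, v g)) ` A)"
  proof (rule join_decompI)
    show "equivariant (s \<circ>\<^sub>p t)" using assms equivariant_comp by blast
    show "finite ((\<lambda>g. (u g, v g)) ` A)" using A by blast
    show "(b, a) \<in> s \<circ>\<^sub>p t" if "(a, b) \<in> (\<lambda>g. (u g, v g)) ` A" for a b
      using that uv by blast
    fix x y assume "(x, y) \<in> s \<circ>\<^sub>p t"
    then obtain z where z: "(x, z) \<in> t" "(z, y) \<in> s" by auto
    obtain a b where ab: "(a, b) \<in> P" "cat_le \<Lambda> b z" by (rule join_decomp_cover[OF assms(3) z(2)])
    obtain a' b' where ab': "(a', b') \<in> Q" "cat_le \<Lambda> a' z"
      by (rule join_decomp_cover[OF assms(4) z(1)])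
    obtain g where g: "g \<in> \<Gamma> (a, b) (a', b')" "cat_le \<Lambda> g z" using \<Gamma>[OF ab(1) ab'(1)] ab ab' by auto
    have gA: "g \<in> A" using g ab ab' by (auto simp: A_def)
    have "(g, v g) \<in> t\<inverse>" using uv gA by blast
    then obtain x' where "(z, x') \<in> t\<inverse>" "cat_le \<Lambda> (v g) x'"
      by (rule equivariant_mono[OF equivariant_converse[OF assms(2)] _ g(2)])
    moreover have "x' = x" using equivariantD(6)[OF assms(2) z(1)] calculation by blast
    ultimately show "\<exists>(a, b)\<in>(\<lambda>g. (u g, v g)) ` A. cat_le \<Lambda> b x" using gA by blast
  qed
  then show ?thesis by blast
qed

lemma join_decomp_converse:
  assumes "equivariant s" "join_decomp \<Lambda> s P"
  shows "join_decomp \<Lambda> (s\<inverse>) (P\<inverse>)"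
proof (rule join_decompI)
  show "equivariant (s\<inverse>)" using assms equivariant_converse by blast
  show "finite (P\<inverse>)" using assms by (simp add: join_decomp_def)
  show "(b, a) \<in> s\<inverse>" if "(a, b) \<in> P\<inverse>" for a b
    using that join_decomp_pairD[OF assms(2)] by blast
  show "\<exists>(a, b)\<in>P\<inverse>. cat_le \<Lambda> b x" if "(x, y) \<in> s\<inverse>" for x y
    using join_decomp_cover[OF assms(2)] that by (metis case_prodI converse_iff)
qed

lemma join_decomp_ts:
  "\<lbrakk>a \<in> Mor \<Lambda>; b \<in> Mor \<Lambda>; src \<Lambda> a = src \<Lambda> b\<rbrakk> \<Longrightarrow> join_decomp \<Lambda> (ts a b) {(a, b)}"
  by (simp add: join_decomp_def)

text \<open>Both \<open>act_dom\<close> and \<open>act\<close> quantify over decompositions, so they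
  say nothing about \<open>s\<close> until one is known to exist.\<close>

lemma inv_semigroup_join_decomp: "s \<in> inv_semigroup \<Lambda> \<Longrightarrow> \<exists>P. join_decomp \<Lambda> s P"
proof (induction rule: inv_semigroup.induct)
  case (tau a)
  then show ?case using join_decomp_ts[of a "src \<Lambda> a"] by (metis tau_eq_ts src_in_Mor src_src)
next
  case (sigma a)
  then show ?case using join_decomp_ts[of "src \<Lambda> a" a] by (metis sigma_eq_ts src_in_Mor src_src)
next
  case (mult s t)
  then show ?case using join_decomp_comp equivariant_inv_semigroup by blast
next
  case (inverse s)
  then show ?case using join_decomp_converse equivariant_inv_semigroup by blast
qed

subsection \<open>The action on paths\<close>

lemma pathD:
  assumes "F \<in> path_space \<Lambda>"
  shows "F \<noteq> {}" "F \<subseteq> Mor \<Lambda>" "\<And>a b. cat_le \<Lambda> a b \<Longrightarrow> b \<in> F \<Longrightarrow> a \<in> F"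
    "\<And>a b. a \<in> F \<Longrightarrow> b \<in> F \<Longrightarrow> \<exists>c\<in>F. cat_le \<Lambda> a c \<and> cat_le \<Lambda> b c"
  using assms unfolding path_space_def by blast+

definition pact :: "'a pmap \<Rightarrow> 'a set \<Rightarrow> 'a set" where
  "pact s F = {x. \<exists>g\<in>F. \<exists>y. (g, y) \<in> s \<and> cat_le \<Lambda> x y}"

text \<open>The domain of \<open>s\<close> is closed under extension and \<open>F\<close> is
  directed. So once \<open>F\<close> meets the domain, the points of \<open>F\<close> in the domain
  are cofinal in \<open>F\<close>.\<close>

lemma path_upper_in:
  assumes "equivariant s" "F \<in> path_space \<Lambda>" "a \<in> F" "(b, y) \<in> s" "b \<in> F"
  obtains c z where "c \<in> F" "(c, z) \<in> s" "cat_le \<Lambda> a c" "cat_le \<Lambda> b c" "cat_le \<Lambda> y z"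
  using pathD(4)[OF assms(2) assms(3,5)] equivariant_mono[OF assms(1,4)] by metis

text \<open>The extensions of \<open>b\<close> are cofinal in \<open>F\<close>, and \<open>s\<close>
  sends \<open>b \<cdot> d\<close> to \<open>a \<cdot> d\<close>. The right-hand side does not
  mention \<open>a\<close> and \<open>b\<close>, so the action depends neither on the decomposition
  nor on the chosen pair.\<close>

lemma tau_sigma_act_eq_pact:
  assumes "equivariant s" "F \<in> path_space \<Lambda>" "(b, a) \<in> s" "b \<in> F"
  shows "tau_sigma_act \<Lambda> a b F = pact s F"
proof
  note ab = equivariantD[OF assms(1,3)]
  show "tau_sigma_act \<Lambda> a b F \<subseteq> pact s F"
    using ab by (fastforce simp: tau_sigma_act_def pact_def in_sigma_iff inits_def)
  show "pact s F \<subseteq> tau_sigma_act \<Lambda> a b F"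
  proof
    fix x assume "x \<in> pact s F"
    then obtain g y where g: "g \<in> F" "(g, y) \<in> s" "cat_le \<Lambda> x y" by (auto simp: pact_def)
    obtain c z where c: "c \<in> F" "(c, z) \<in> s" "cat_le \<Lambda> b c" "cat_le \<Lambda> g c" "cat_le \<Lambda> y z"
      by (rule path_upper_in[OF assms(1,2,4) g(2,1)])
    obtain d where d: "d \<in> Mor \<Lambda>" "rng \<Lambda> d = src \<Lambda> b" "c = b \<cdot> d" using c(3) by (rule cat_leE)
    have "z = a \<cdot> d" using equivariantD(5)[OF assms(1) c(2)] ab(4) d by blast
    then have "x \<in> inits \<Lambda> (a \<cdot> d)" using c g cat_le_trans by (auto simp: inits_def)
    then show "x \<in> tau_sigma_act \<Lambda> a b F"
      using c(1,3) d unfolding tau_sigma_act_def in_sigma_iff by blast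
  qed
qed

text \<open>A point of \<open>F\<close> in the domain of \<open>s\<close> extends some
  \<open>b\<close> occurring in any given decomposition, and heredity puts this \<open>b\<close>
  into \<open>F\<close>.\<close>

lemma act_dom_iff:
  assumes "s \<in> inv_semigroup \<Lambda>"
  shows "F \<in> act_dom \<Lambda> s \<longleftrightarrow> F \<in> path_space \<Lambda> \<and> F \<inter> Domain s \<noteq> {}"
proof
  assume "F \<in> act_dom \<Lambda> s"
  then show "F \<in> path_space \<Lambda> \<and> F \<inter> Domain s \<noteq> {}"
    unfolding act_dom_def using join_decomp_pairD by fast
next
  assume F: "F \<in> path_space \<Lambda> \<and> F \<inter> Domain s \<noteq> {}"
  then obtain x y where x: "x \<in> F" "(x, y) \<in> s" by blast
  obtain P where P: "join_decomp \<Lambda> s P" using inv_semigroup_join_decomp assms by blast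
  obtain a b where "(a, b) \<in> P" "cat_le \<Lambda> b x" by (rule join_decomp_cover[OF P x(2)])
  then show "F \<in> act_dom \<Lambda> s" unfolding act_dom_def using P F x pathD(3) by blast
qed

lemma act_eq_pact:
  assumes "s \<in> inv_semigroup \<Lambda>" "F \<in> path_space \<Lambda>" "F \<inter> Domain s \<noteq> {}"
  shows "act \<Lambda> s F = pact s F"
proof -
  have "F \<in> act_dom \<Lambda> s" using assms act_dom_iff by blast
  then obtain P a b where "join_decomp \<Lambda> s P" "(a, b) \<in> P" "b \<in> F" by (auto simp: act_dom_def)
  moreover have "tau_sigma_act \<Lambda> a b F = pact s F"
    if "join_decomp \<Lambda> s P" "(a, b) \<in> P" "b \<in> F" for P a b
    using tau_sigma_act_eq_pact equivariant_inv_semigroup join_decomp_pairD assms that by blast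
  ultimately show ?thesis unfolding act_def by (intro the_equality) blast+
qed

lemma pactI: "equivariant s \<Longrightarrow> (x, y) \<in> s \<Longrightarrow> x \<in> F \<Longrightarrow> y \<in> pact s F"
  using equivariantD(2) cat_le_refl unfolding pact_def by blast

lemma pact_path_space:
  assumes "equivariant s" "F \<in> path_space \<Lambda>" "F \<inter> Domain s \<noteq> {}"
  shows "pact s F \<in> path_space \<Lambda>"
  unfolding path_space_def
proof (intro CollectI conjI allI impI ballI)
  show "pact s F \<noteq> {}" using assms pactI by blast
  show "pact s F \<subseteq> Mor \<Lambda>" using cat_le_Mor by (auto simp: pact_def)
  show "a \<in> pact s F" if "cat_le \<Lambda> a b \<and> b \<in> pact s F" for a b
    using that cat_le_trans unfolding pact_def by blast
  fix a b assume "a \<in> pact s F" "b \<in> pact s F"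
  then obtain g y h z where g: "g \<in> F" "(g, y) \<in> s" "cat_le \<Lambda> a y"
    and h: "h \<in> F" "(h, z) \<in> s" "cat_le \<Lambda> b z" by (auto simp: pact_def)
  obtain c w where c: "c \<in> F" "(c, w) \<in> s" "cat_le \<Lambda> g c" "cat_le \<Lambda> h c" "cat_le \<Lambda> z w"
    by (rule path_upper_in[OF assms(1,2) g(1) h(2,1)])
  obtain w' where "(c, w') \<in> s" "cat_le \<Lambda> y w'" by (rule equivariant_mono[OF assms(1) g(2) c(3)])
  moreover have "w' = w" using equivariantD(5)[OF assms(1) c(2)] calculation by blast
  ultimately show "\<exists>c\<in>pact s F. cat_le \<Lambda> a c \<and> cat_le \<Lambda> b c"
    using pactI[OF assms(1) c(2,1)] g h c cat_le_trans by blast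
qed

text \<open>The subtle inclusion is from right to left: there \<open>s\<close> is applied to some
  \<open>e\<close> that is only an initial segment of a value \<open>z\<close> of \<open>t\<close>.
  Then \<open>z\<close> is in the domain of \<open>s\<close> too, and its value extends that of
  \<open>e\<close>.\<close>

lemma pact_comp:
  assumes "equivariant s" "equivariant t"
  shows "pact (s \<circ>\<^sub>p t) F = pact s (pact t F)"
proof
  show "pact (s \<circ>\<^sub>p t) F \<subseteq> pact s (pact t F)"
    using pactI[OF assms(2)] unfolding pact_def[of s] pact_def[of "s \<circ>\<^sub>p t"] by blast
  show "pact s (pact t F) \<subseteq> pact (s \<circ>\<^sub>p t) F"
  proof
    fix x assume "x \<in> pact s (pact t F)"
    then obtain e y g z where e: "(e, y) \<in> s" "cat_le \<Lambda> x y" "g \<in> F" "(g, z) \<in> t" "cat_le \<Lambda> e z"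
      by (auto simp: pact_def)
    obtain w where "(z, w) \<in> s" "cat_le \<Lambda> y w" by (rule equivariant_mono[OF assms(1) e(1,5)])
    then show "x \<in> pact (s \<circ>\<^sub>p t) F" using e cat_le_trans unfolding pact_def by blast
  qed
qed

lemma pact_Domain_comp:
  assumes "equivariant s" "equivariant t"
  shows "F \<inter> Domain (s \<circ>\<^sub>p t) \<noteq> {} \<longleftrightarrow> pact t F \<inter> Domain s \<noteq> {}"
proof
  show "F \<inter> Domain (s \<circ>\<^sub>p t) \<noteq> {} \<Longrightarrow> pact t F \<inter> Domain s \<noteq> {}"
    using pactI[OF assms(2)] by blast
  assume "pact t F \<inter> Domain s \<noteq> {}"
  then obtain e y g z where e: "(e, y) \<in> s" "g \<in> F" "(g, z) \<in> t" "cat_le \<Lambda> e z"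
    by (auto simp: pact_def)
  obtain w where "(z, w) \<in> s" by (rule equivariant_mono[OF assms(1) e(1,4)])
  then show "F \<inter> Domain (s \<circ>\<^sub>p t) \<noteq> {}" using e by blast
qed

text \<open>The fixed points of \<open>e\<close> in \<open>F\<close> are cofinal in
  \<open>F\<close>, and \<open>F\<close> consists of the initial segments of any cofinal
  subset.\<close>

lemma pact_subset_Id:
  assumes "equivariant e" "e \<subseteq> Id" "F \<in> path_space \<Lambda>" "F \<inter> Domain e \<noteq> {}"
  shows "pact e F = F"
proof
  show "pact e F \<subseteq> F" using assms(2) pathD(3)[OF assms(3)] by (auto simp: pact_def)
  show "F \<subseteq> pact e F"
  proof
    fix x assume x: "x \<in> F"
    obtain g h where g: "g \<in> F" "(g, h) \<in> e" using assms by blast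
    obtain c z where "c \<in> F" "(c, z) \<in> e" "cat_le \<Lambda> x c"
      by (rule path_upper_in[OF assms(1,3) x g(2,1)])
    then show "x \<in> pact e F" using assms(2) unfolding pact_def by blast
  qed
qed

lemma pact_converse:
  assumes "equivariant s" "F \<in> path_space \<Lambda>" "F \<inter> Domain s \<noteq> {}"
  shows "pact (s\<inverse>) (pact s F) = F"
proof -
  have "s\<inverse> \<circ>\<^sub>p s \<subseteq> Id" using equivariantD(6)[OF assms(1)] by blast
  moreover have "F \<inter> Domain (s\<inverse> \<circ>\<^sub>p s) \<noteq> {}" using assms(3) by blast
  ultimately show ?thesis
    using pact_subset_Id assms equivariant_comp equivariant_converse pact_comp by metis
qed

lemma pact_meets_Domain_converse:
  assumes "equivariant s" "F \<inter> Domain s \<noteq> {}"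
  shows "pact s F \<inter> Domain (s\<inverse>) \<noteq> {}"
  using assms pactI by blast

subsection \<open>Tight paths\<close>

text \<open>The excluded set \<open>B\<close> in the definition of tightness can be absorbed into the covering set.\<close>

lemma tight_iff:
  "C \<in> tight_paths \<Lambda> \<longleftrightarrow> C \<in> path_space \<Lambda> \<and>
     (\<forall>a\<in>C. \<forall>Y. finite Y \<and> Y \<subseteq> Mor \<Lambda> \<and>
        (\<forall>x. cat_le \<Lambda> a x \<longrightarrow> (\<exists>y\<in>Y. meets \<Lambda> x y)) \<longrightarrow> C \<inter> Y \<noteq> {})"
  (is "_ \<longleftrightarrow> _ \<and> ?T")
proof (intro iffI conjI)
  assume C: "C \<in> tight_paths \<Lambda>"
  then show P: "C \<in> path_space \<Lambda>" by (simp add: tight_paths_def)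
  show ?T
  proof (intro ballI allI impI, elim conjE)
    fix a Y
    assume a: "a \<in> C" and Y: "finite Y" "Y \<subseteq> Mor \<Lambda>"
      "\<forall>x. cat_le \<Lambda> a x \<longrightarrow> (\<exists>y\<in>Y. meets \<Lambda> x y)"
    have aM: "a \<in> Mor \<Lambda>" using a pathD(2)[OF P] by blast
    have "\<exists>\<Gamma>. finite \<Gamma> \<and> (\<forall>g\<in>\<Gamma>. cat_le \<Lambda> a g \<and> cat_le \<Lambda> y g) \<and>
      (\<forall>x. cat_le \<Lambda> a x \<longrightarrow> cat_le \<Lambda> y x \<longrightarrow> (\<exists>g\<in>\<Gamma>. cat_le \<Lambda> g x))" if "y \<in> Y" for y
      using common_extensions[OF aM] that Y(2) by (metis subsetD)
    then obtain \<Gamma> where \<Gamma>: "\<And>y. y \<in> Y \<Longrightarrow> finite (\<Gamma> y) \<and> (\<forall>g\<in>\<Gamma> y. cat_le \<Lambda> a g \<and> cat_le \<Lambda> y g) \<and>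
      (\<forall>x. cat_le \<Lambda> a x \<longrightarrow> cat_le \<Lambda> y x \<longrightarrow> (\<exists>g\<in>\<Gamma> y. cat_le \<Lambda> g x))" by metis
    \<comment> \<open>The definition of tightness wants the covering set inside
      \<open>exts \<Lambda> a\<close>. Replacing each \<open>y\<close> by finitely many common
      extensions of \<open>a\<close> and \<open>y\<close> achieves this, and heredity of
      \<open>C\<close> leads back from \<open>Z\<close> to \<open>Y\<close>.\<close>
    define Z where "Z = (\<Union>y\<in>Y. \<Gamma> y)"
    have "finite Z" using Y \<Gamma> by (auto simp: Z_def)
    moreover have "Z \<subseteq> exts \<Lambda> a" using \<Gamma> by (auto simp: Z_def cat_le_def)
    moreover have "\<exists>z\<in>Z. meets \<Lambda> x z" if "x \<in> exts \<Lambda> a" for x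
    proof -
      have ax: "cat_le \<Lambda> a x" using that aM by (simp add: cat_le_def)
      then obtain y where y: "y \<in> Y" "meets \<Lambda> x y" using Y by blast
      then obtain w where w: "cat_le \<Lambda> x w" "cat_le \<Lambda> y w"
        using meets_iff[of x y] Y(2) cat_le_Mor[OF ax] by blast
      then obtain g where g: "g \<in> \<Gamma> y" "cat_le \<Lambda> g w" using \<Gamma>[OF y(1)] ax cat_le_trans by blast
      then have "meets \<Lambda> x g" using w meets_iff cat_le_Mor by blast
      then show ?thesis using g y by (auto simp: Z_def)
    qed
    moreover have "\<forall>B. finite B \<and> B \<subseteq> Mor \<Lambda> \<and> B \<inter> C = {} \<longrightarrow>
       (\<forall>Z. finite Z \<and> Z \<subseteq> exts \<Lambda> a - (\<Union>\<beta>\<in>B. exts \<Lambda> \<beta>) \<and>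
            (\<forall>\<gamma>\<in>exts \<Lambda> a - (\<Union>\<beta>\<in>B. exts \<Lambda> \<beta>). \<exists>z\<in>Z. meets \<Lambda> \<gamma> z)
            \<longrightarrow> C \<inter> Z \<noteq> {})"
      using C a unfolding tight_paths_def by blast
    from this[rule_format, of "{}" Z] have "finite Z \<Longrightarrow> Z \<subseteq> exts \<Lambda> a \<Longrightarrow>
        \<forall>x\<in>exts \<Lambda> a. \<exists>z\<in>Z. meets \<Lambda> x z \<Longrightarrow> C \<inter> Z \<noteq> {}"
      by simp
    ultimately have "C \<inter> Z \<noteq> {}" by blast
    then obtain y g where "y \<in> Y" "g \<in> \<Gamma> y" "g \<in> C" unfolding Z_def by blast
    then show "C \<inter> Y \<noteq> {}" using \<Gamma> pathD(3)[OF P] by blast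
  qed
next
  assume "C \<in> path_space \<Lambda> \<and> ?T"
  then have P: "C \<in> path_space \<Lambda>" and T: ?T by (rule conjunct1, rule conjunct2)
  show "C \<in> tight_paths \<Lambda>" unfolding tight_paths_def
  proof (intro CollectI conjI ballI allI impI, goal_cases)
    case 1
    show ?case by (rule P)
  next
    case (2 a B Z)
    then have a: "a \<in> C" and B: "finite B" "B \<subseteq> Mor \<Lambda>" "B \<inter> C = {}" and Z: "finite Z"
      "Z \<subseteq> exts \<Lambda> a - (\<Union>b\<in>B. exts \<Lambda> b)"
      "\<And>x. x \<in> exts \<Lambda> a - (\<Union>b\<in>B. exts \<Lambda> b) \<Longrightarrow> \<exists>z\<in>Z. meets \<Lambda> x z" by auto
    have aM: "a \<in> Mor \<Lambda>" using a pathD(2)[OF P] by blast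
    have ZM: "Z \<subseteq> Mor \<Lambda>" using Z(2) exts_subset_Mor[OF aM] by blast
    have "\<exists>y\<in>B \<union> Z. meets \<Lambda> x y" if x: "cat_le \<Lambda> a x" for x
    proof (cases "x \<in> (\<Union>b\<in>B. exts \<Lambda> b)")
      case True
      then obtain b where b: "b \<in> B" "cat_le \<Lambda> b x" using B(2) by (auto simp: cat_le_def)
      then have "meets \<Lambda> x b" using meets_iff cat_le_refl cat_le_Mor by blast
      then show ?thesis using b by blast
    next
      case False
      then have "x \<in> exts \<Lambda> a - (\<Union>b\<in>B. exts \<Lambda> b)" using x by (auto simp: cat_le_def)
      from Z(3)[OF this] show ?thesis by blast
    qed
    then have "C \<inter> (B \<union> Z) \<noteq> {}"
      using T[rule_format, OF a, of "B \<union> Z"] B(1,2) Z(1) ZM by blast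
    then show ?case using B(3) by blast
  qed
qed

lemma tight_path: "C \<in> tight_paths \<Lambda> \<Longrightarrow> C \<in> path_space \<Lambda>"
  by (simp add: tight_paths_def)

text \<open>A cover \<open>Y\<close> for \<open>a\<close> also covers every extension of
  \<open>a\<close>, in particular a value \<open>e\<close> of \<open>s\<close> at some
  \<open>g\<close> in \<open>C\<close>. The common extensions of \<open>e\<close> with members of
  \<open>Y\<close> lie in the range of \<open>s\<close>; pulled back along \<open>s\<close> they
  cover \<open>g\<close>. Tightness of \<open>C\<close> puts one of them into \<open>C\<close>, its
  image is in \<open>pact s C\<close>, and heredity gives a member of \<open>Y\<close>.\<close>

lemma pact_tight:
  assumes "equivariant s" "C \<in> tight_paths \<Lambda>" "C \<inter> Domain s \<noteq> {}"
  shows "pact s C \<in> tight_paths \<Lambda>"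
  unfolding tight_iff
proof (intro conjI ballI allI impI; (elim conjE)?)
  have P: "C \<in> path_space \<Lambda>" using assms(2) tight_path by blast
  then show "pact s C \<in> path_space \<Lambda>" using pact_path_space assms by blast
  fix a Y
  assume "a \<in> pact s C" and Y: "finite Y" "Y \<subseteq> Mor \<Lambda>"
    "\<forall>x. cat_le \<Lambda> a x \<longrightarrow> (\<exists>y\<in>Y. meets \<Lambda> x y)"
  then obtain g e where g: "g \<in> C" "(g, e) \<in> s" "cat_le \<Lambda> a e" by (auto simp: pact_def)
  note ge = equivariantD[OF assms(1) g(2)]
  have "\<exists>\<Gamma>. finite \<Gamma> \<and> (\<forall>g\<in>\<Gamma>. cat_le \<Lambda> e g \<and> cat_le \<Lambda> y g) \<and>
      (\<forall>x. cat_le \<Lambda> e x \<longrightarrow> cat_le \<Lambda> y x \<longrightarrow> (\<exists>g\<in>\<Gamma>. cat_le \<Lambda> g x))" if "y \<in> Y" for y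
    using common_extensions[OF ge(2)] that Y(2) by (metis subsetD)
  then obtain \<Gamma> where \<Gamma>: "\<And>y. y \<in> Y \<Longrightarrow> finite (\<Gamma> y) \<and> (\<forall>g\<in>\<Gamma> y. cat_le \<Lambda> e g \<and> cat_le \<Lambda> y g) \<and>
      (\<forall>x. cat_le \<Lambda> e x \<longrightarrow> cat_le \<Lambda> y x \<longrightarrow> (\<exists>g\<in>\<Gamma> y. cat_le \<Lambda> g x))" by metis
  define A where "A = (\<Union>y\<in>Y. \<Gamma> y)"
  note sc = equivariant_converse[OF assms(1)]
  have eg: "(e, g) \<in> s\<inverse>" using g by blast
  have "\<exists>b. (h, b) \<in> s\<inverse>" if "h \<in> A" for h
  proof -
    have "cat_le \<Lambda> e h" using that \<Gamma> unfolding A_def by blast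
    from equivariant_mono[OF sc eg this] show ?thesis by blast
  qed
  then obtain v where v: "\<And>h. h \<in> A \<Longrightarrow> (h, v h) \<in> s\<inverse>" by metis
  have vA: "v ` A \<subseteq> Mor \<Lambda>" using equivariantD(2)[OF sc v] by blast
  have "\<exists>y\<in>v ` A. meets \<Lambda> x y" if x: "cat_le \<Lambda> g x" for x
  proof -
    \<comment> \<open>The image \<open>z\<close> of \<open>x\<close> has a common extension
      \<open>w\<close> with some \<open>y\<close>, and \<open>w\<close> extends some
      \<open>h\<close> in \<open>A\<close>. The preimage of \<open>w\<close> then extends both
      \<open>x\<close> and \<open>v h\<close>.\<close>
    obtain z where z: "(x, z) \<in> s" "cat_le \<Lambda> e z" by (rule equivariant_mono[OF assms(1) g(2) x])
    then obtain y where y: "y \<in> Y" "meets \<Lambda> z y" using Y(3) g(3) cat_le_trans by blast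
    then obtain w where w: "cat_le \<Lambda> z w" "cat_le \<Lambda> y w"
      using meets_iff[of z y] Y(2) cat_le_Mor[OF z(2)] by blast
    then obtain h where h: "h \<in> \<Gamma> y" "cat_le \<Lambda> h w" using \<Gamma>[OF y(1)] z cat_le_trans by blast
    then have hA: "h \<in> A" using y by (auto simp: A_def)
    obtain u where u: "(w, u) \<in> s\<inverse>" "cat_le \<Lambda> (v h) u" by (rule equivariant_mono[OF sc v[OF hA] h(2)])
    have "(z, x) \<in> s\<inverse>" using z(1) by blast
    then obtain u' where u': "(w, u') \<in> s\<inverse>" "cat_le \<Lambda> x u'"
      by (rule equivariant_mono[OF sc _ w(1)])
    have "u' = u" using equivariantD(5)[OF sc u(1) u'(1)] .
    then have "meets \<Lambda> x (v h)" using u u' meets_iff cat_le_Mor by blast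
    then show ?thesis using hA by blast
  qed
  moreover have "finite (v ` A)" using \<Gamma> Y(1) by (auto simp: A_def)
  ultimately have "C \<inter> v ` A \<noteq> {}" using assms(2) g(1) vA unfolding tight_iff by blast
  then obtain h where h: "h \<in> A" "v h \<in> C" by blast
  then have "h \<in> pact s C" using pactI[OF assms(1)] v by blast
  moreover obtain y where "y \<in> Y" "cat_le \<Lambda> y h" using h \<Gamma> by (auto simp: A_def)
  ultimately show "pact s C \<inter> Y \<noteq> {}" using cat_le_trans unfolding pact_def by blast
qed

subsection \<open>Germs\<close>

text \<open>Intersecting the graphs turns agreement at a point into the statement that
  \<open>F\<close> meets the domain of a single map, which is again equivariant. The facts about
  \<open>pact\<close> then apply to that map.\<close>

definition agree :: "'a set \<Rightarrow> 'a pmap \<Rightarrow> 'a pmap \<Rightarrow> bool" where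
  "agree F s t \<longleftrightarrow> F \<inter> Domain (s \<inter> t) \<noteq> {}"

lemma agreeI: "\<lbrakk>x \<in> F; (x, y) \<in> s; (x, y) \<in> t\<rbrakk> \<Longrightarrow> agree F s t"
  by (auto simp: agree_def)

lemma agreeE:
  assumes "agree F s t"
  obtains x y where "x \<in> F" "(x, y) \<in> s" "(x, y) \<in> t"
  using assms by (auto simp: agree_def)

lemma agree_sym: "agree F s t \<Longrightarrow> agree F t s"
  by (simp add: agree_def Int_commute)

lemma agree_subset: "s \<subseteq> t \<Longrightarrow> F \<inter> Domain s \<noteq> {} \<Longrightarrow> agree F s t"
  unfolding agree_def by blast

lemma equivariant_Int:
  assumes "equivariant s" "equivariant t"
  shows "equivariant (s \<inter> t)"
  unfolding equivariant_def
proof (intro conjI allI impI ballI)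
  show "s \<inter> t \<subseteq> Mor \<Lambda> \<times> Mor \<Lambda>" "single_valued (s \<inter> t)" "single_valued ((s \<inter> t)\<inverse>)"
    using assms(1) unfolding equivariant_def by (blast, auto intro: single_valued_subset)
  fix x y d assume xy: "(x, y) \<in> s \<inter> t"
  then show "src \<Lambda> x = src \<Lambda> y" using equivariantD(3)[OF assms(1)] by blast
  assume "d \<in> Mor \<Lambda>" "rng \<Lambda> d = src \<Lambda> x"
  then show "(x \<cdot> d, y \<cdot> d) \<in> s \<inter> t"
    using equivariantD(4)[OF assms(1)] equivariantD(4)[OF assms(2)] xy by blast
qed

text \<open>Two maps that agree at a point agree at all its extensions, and \<open>F\<close>
  contains a common extension of the two given points of agreement.\<close>

lemma agree_trans:
  assumes eq: "equivariant s" "equivariant t" "equivariant u" and F: "F \<in> path_space \<Lambda>"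
    and st: "agree F s t" and tu: "agree F t u"
  shows "agree F s u"
proof -
  obtain x y where x: "x \<in> F" "(x, y) \<in> s \<inter> t" using st by (auto elim: agreeE)
  obtain x' y' where x': "x' \<in> F" "(x', y') \<in> t \<inter> u" using tu by (auto elim: agreeE)
  obtain c z where c: "c \<in> F" "(c, z) \<in> t \<inter> u" "cat_le \<Lambda> x c"
    by (rule path_upper_in[OF equivariant_Int[OF eq(2,3)] F x(1) x'(2,1)])
  obtain w where w: "(c, w) \<in> s \<inter> t"
    by (rule equivariant_mono[OF equivariant_Int[OF eq(1,2)] x(2) c(3)])
  have "w = z" using equivariantD(5)[OF eq(2), of c z w] c w by blast
  then show ?thesis using c w by (auto intro: agreeI)
qed

text \<open>The domain of the smaller map is already cofinal in \<open>F\<close>, so its values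
  generate the same path.\<close>

lemma pact_subset:
  assumes "equivariant s" "equivariant t" "s \<subseteq> t" "F \<in> path_space \<Lambda>" "F \<inter> Domain s \<noteq> {}"
  shows "pact s F = pact t F"
proof
  show "pact s F \<subseteq> pact t F" using assms(3) by (auto simp: pact_def)
  show "pact t F \<subseteq> pact s F"
  proof
    fix x assume "x \<in> pact t F"
    then obtain g y where g: "g \<in> F" "(g, y) \<in> t" "cat_le \<Lambda> x y" by (auto simp: pact_def)
    obtain b w where b: "b \<in> F" "(b, w) \<in> s" using assms(5) by blast
    obtain c z where c: "c \<in> F" "(c, z) \<in> s" "cat_le \<Lambda> g c"
      by (rule path_upper_in[OF assms(1,4) g(1) b(2,1)])
    obtain z' where z': "(c, z') \<in> t" "cat_le \<Lambda> y z'" by (rule equivariant_mono[OF assms(2) g(2) c(3)])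
    have "z' = z" using equivariantD(5)[OF assms(2), of c z z'] c(2) z'(1) assms(3) by blast
    then have "cat_le \<Lambda> x z" using z'(2) g(3) cat_le_trans by blast
    then show "x \<in> pact s F" using c(1,2) unfolding pact_def by blast
  qed
qed

lemma agree_pact:
  assumes "equivariant s" "equivariant t" "F \<in> path_space \<Lambda>" "agree F s t"
  shows "pact s F = pact t F"
proof -
  have *: "F \<inter> Domain (s \<inter> t) \<noteq> {}" using assms(4) by (simp add: agree_def)
  note e = equivariant_Int[OF assms(1,2)]
  have "pact (s \<inter> t) F = pact s F" by (rule pact_subset[OF e assms(1) Int_lower1 assms(3) *])
  moreover have "pact (s \<inter> t) F = pact t F" by (rule pact_subset[OF e assms(2) Int_lower2 assms(3) *])
  ultimately show ?thesis by simp
qed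

text \<open>The path \<open>pact t F\<close> is also obtained from \<open>t \<inter> t'\<close>, and
  it meets the domain of \<open>s \<inter> s'\<close>. So \<open>F\<close> meets the domain of the
  product of the two intersections, and that product lies in both composites.\<close>

lemma agree_comp:
  assumes "equivariant s" "equivariant s'" "equivariant t" "equivariant t'" "F \<in> path_space \<Lambda>"
    "agree F t t'" "agree (pact t F) s s'"
  shows "agree F (s \<circ>\<^sub>p t) (s' \<circ>\<^sub>p t')"
proof -
  have ne: "F \<inter> Domain (t \<inter> t') \<noteq> {}" using assms(6) by (simp add: agree_def)
  have e: "equivariant (s \<inter> s')" "equivariant (t \<inter> t')" using assms equivariant_Int by auto
  have "pact (t \<inter> t') F = pact t F"
    by (rule pact_subset[OF e(2) assms(3) Int_lower1 assms(5) ne])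
  then have "F \<inter> Domain ((s \<inter> s') \<circ>\<^sub>p (t \<inter> t')) \<noteq> {}"
    unfolding pact_Domain_comp[OF e] using assms(7) by (simp add: agree_def)
  moreover have "(s \<inter> s') \<circ>\<^sub>p (t \<inter> t') \<subseteq> (s \<circ>\<^sub>p t) \<inter> (s' \<circ>\<^sub>p t')" by blast
  ultimately show ?thesis unfolding agree_def by blast
qed

lemma agree_converse:
  assumes "equivariant s" "agree F s t"
  shows "agree (pact s F) (s\<inverse>) (t\<inverse>)"
proof -
  obtain x y where "x \<in> F" "(x, y) \<in> s" "(x, y) \<in> t" using assms(2) by (rule agreeE)
  then show ?thesis using pactI[OF assms(1)] by (auto intro: agreeI)
qed

section \<open>Equality of germs\<close>

lemma germ_pairs_iff:
  "(s, F) \<in> germ_pairs \<Lambda> \<longleftrightarrow> s \<in> inv_semigroup \<Lambda> \<and> F \<in> tight_paths \<Lambda> \<and> F \<inter> Domain s \<noteq> {}"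
  using act_dom_iff[of s F] tight_path[of F] by (auto simp: germ_pairs_def)

lemma germ_pairsD:
  assumes "(s, F) \<in> germ_pairs \<Lambda>"
  shows "s \<in> inv_semigroup \<Lambda>" "equivariant s" "F \<in> tight_paths \<Lambda>" "F \<in> path_space \<Lambda>"
    "F \<inter> Domain s \<noteq> {}" "act \<Lambda> s F = pact s F"
  using assms equivariant_inv_semigroup tight_path act_eq_pact by (auto simp: germ_pairs_iff)

text \<open>An idempotent is a partial identity and fixes \<open>F\<close>, so
  \<open>s \<circ>\<^sub>p e\<close> is still defined at a point of \<open>F\<close>, where
  \<open>s\<close> and \<open>t\<close> then agree. Conversely, from a point of agreement
  \<open>x\<close> take for \<open>e\<close> the identity on
  \<open>exts \<Lambda> x\<close>.\<close>

lemma idempotent_iff_agree: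
  assumes s: "equivariant s" and t: "equivariant t" and F: "F \<in> path_space \<Lambda>"
    and ne: "F \<inter> Domain s \<noteq> {}"
  shows "(\<exists>e\<in>inv_semigroup \<Lambda>. e \<circ>\<^sub>p e = e \<and> F \<in> act_dom \<Lambda> e \<and> s \<circ>\<^sub>p e = t \<circ>\<^sub>p e) \<longleftrightarrow> agree F s t"
proof
  assume "\<exists>e\<in>inv_semigroup \<Lambda>. e \<circ>\<^sub>p e = e \<and> F \<in> act_dom \<Lambda> e \<and> s \<circ>\<^sub>p e = t \<circ>\<^sub>p e"
  then obtain e :: "'a pmap" where e: "e \<in> inv_semigroup \<Lambda>" "e \<circ>\<^sub>p e = e" "F \<in> act_dom \<Lambda> e" "s \<circ>\<^sub>p e = t \<circ>\<^sub>p e"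
    by blast
  note eq = equivariant_inv_semigroup[OF e(1)]
  have Id: "e \<subseteq> Id" by (rule idempotent_subset_Id[OF eq e(2)])
  have dom: "F \<inter> Domain e \<noteq> {}" using act_dom_iff[OF e(1)] e(3) by blast
  have "F \<inter> Domain (s \<circ>\<^sub>p e) \<noteq> {}"
    unfolding pact_Domain_comp[OF s eq] pact_subset_Id[OF eq Id F dom] by (rule ne)
  then obtain x y where xy: "x \<in> F" "(x, y) \<in> s \<circ>\<^sub>p e" by blast
  moreover have "(x, y) \<in> t \<circ>\<^sub>p e" using xy e(4) by simp
  ultimately show "agree F s t" using Id by (intro agreeI[of x F y]) blast+
next
  assume "agree F s t"
  then obtain x y where xy: "x \<in> F" "(x, y) \<in> s" "(x, y) \<in> t" by (rule agreeE)
  have x: "x \<in> Mor \<Lambda>" using xy(1) pathD(2)[OF F] by blast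
  \<comment> \<open>Stated for arbitrary maps because both inclusions are needed: on an extension
    \<open>x \<cdot> d\<close> either map has the value \<open>y \<cdot> d\<close>.\<close>
  have sub: "s \<circ>\<^sub>p ts x x \<subseteq> t \<circ>\<^sub>p ts x x"
    if s: "equivariant s" "(x, y) \<in> s" and t: "equivariant t" "(x, y) \<in> t" for s t
  proof (rule subrelI)
    fix a b assume "(a, b) \<in> s \<circ>\<^sub>p ts x x"
    then obtain c where c: "(a, c) \<in> ts x x" "(c, b) \<in> s" by (rule relcompEpair)
    then have ac: "cat_le \<Lambda> x a" "c = a" using in_ts_self_iff[OF x] by blast+
    obtain d where d: "d \<in> Mor \<Lambda>" "rng \<Lambda> d = src \<Lambda> x" "a = x \<cdot> d" using ac(1) by (rule cat_leE)
    have "(a, y \<cdot> d) \<in> s" "(a, y \<cdot> d) \<in> t"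
      using equivariantD(4)[OF s] equivariantD(4)[OF t] d by auto
    then have ab: "(a, b) \<in> t" using c(2) ac(2) equivariantD(5)[OF s(1), of a] by blast
    have aa: "(a, a) \<in> ts x x" using c(1) unfolding ac(2) .
    show "(a, b) \<in> t \<circ>\<^sub>p ts x x" by (rule relcompI[OF aa ab])
  qed
  have "s \<circ>\<^sub>p ts x x = t \<circ>\<^sub>p ts x x"
    by (rule equalityI[OF sub[OF s xy(2) t xy(3)] sub[OF t xy(3) s xy(2)]])
  moreover have "(x, x) \<in> ts x x" using ts_self[OF x x] by simp
  then have "F \<in> act_dom \<Lambda> (ts x x)"
    unfolding act_dom_iff[OF ts_inv_semigroup[OF x x]] using F xy(1) by blast
  ultimately show "\<exists>e\<in>inv_semigroup \<Lambda>. e \<circ>\<^sub>p e = e \<and> F \<in> act_dom \<Lambda> e \<and> s \<circ>\<^sub>p e = t \<circ>\<^sub>p e"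
    using ts_inv_semigroup[OF x x] ts_idempotent[OF x] by (intro bexI[of _ "ts x x"]) simp_all
qed

lemma germ_rel_iff:
  "((s, F), (t, F')) \<in> germ_rel \<Lambda> \<longleftrightarrow>
     (s, F) \<in> germ_pairs \<Lambda> \<and> (t, F') \<in> germ_pairs \<Lambda> \<and> F = F' \<and> agree F s t"
proof (cases "(s, F) \<in> germ_pairs \<Lambda> \<and> (t, F') \<in> germ_pairs \<Lambda>")
  case True
  then show ?thesis
    using idempotent_iff_agree[of s t F] germ_pairsD[of s F] germ_pairsD[of t F']
    unfolding germ_rel_def by simp
next
  case False
  then show ?thesis unfolding germ_rel_def by blast
qed

lemma equiv_germ_rel: "equiv (germ_pairs \<Lambda>) (germ_rel \<Lambda>)"
proof (rule equivI)
  show "germ_rel \<Lambda> \<subseteq> germ_pairs \<Lambda> \<times> germ_pairs \<Lambda>"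
    unfolding subset_iff split_paired_All germ_rel_iff by simp
  show "refl_on (germ_pairs \<Lambda>) (germ_rel \<Lambda>)"
  proof (rule refl_onI)
    fix p assume "p \<in> germ_pairs \<Lambda>"
    moreover obtain s F where p: "p = (s, F)" by force
    ultimately have sF: "(s, F) \<in> germ_pairs \<Lambda>" by simp
    show "(p, p) \<in> germ_rel \<Lambda>"
      unfolding p germ_rel_iff using sF agree_subset[OF subset_refl germ_pairsD(5)[OF sF]] by simp
  qed
  show "sym (germ_rel \<Lambda>)"
    unfolding sym_def split_paired_All germ_rel_iff by (auto intro: agree_sym)
  show "trans (germ_rel \<Lambda>)"
  proof (rule transI)
    fix p q r assume pqr: "(p, q) \<in> germ_rel \<Lambda>" "(q, r) \<in> germ_rel \<Lambda>"
    obtain s F t G u H where p: "p = (s, F)" "q = (t, G)" "r = (u, H)" by (metis surj_pair)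
    have *: "(s, F) \<in> germ_pairs \<Lambda>" "(t, F) \<in> germ_pairs \<Lambda>" "(u, F) \<in> germ_pairs \<Lambda>"
      and FGH: "F = G" "G = H" and ag: "agree F s t" "agree F t u"
      using pqr unfolding p germ_rel_iff by auto
    show "(p, r) \<in> germ_rel \<Lambda>"
      unfolding p germ_rel_iff
      using * FGH agree_trans[OF *[THEN germ_pairsD(2)] germ_pairsD(4)[OF *(1)] ag] by simp
  qed
qed

lemma germ_eq_iff:
  assumes "(s, F) \<in> germ_pairs \<Lambda>" "(t, F') \<in> germ_pairs \<Lambda>"
  shows "germ \<Lambda> s F = germ \<Lambda> t F' \<longleftrightarrow> F = F' \<and> agree F s t"
  unfolding germ_def eq_equiv_class_iff[OF equiv_germ_rel assms] germ_rel_iff using assms by simp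

lemma germ_eqI:
  assumes "(s, F) \<in> germ_pairs \<Lambda>" "(t, F) \<in> germ_pairs \<Lambda>" "agree F s t"
  shows "germ \<Lambda> s F = germ \<Lambda> t F"
  using germ_eq_iff assms by blast

lemma in_germs_iff:
  "x \<in> germ_pairs \<Lambda> // germ_rel \<Lambda> \<longleftrightarrow> (\<exists>s F. (s, F) \<in> germ_pairs \<Lambda> \<and> x = germ \<Lambda> s F)"
  unfolding quotient_def germ_def by auto

section \<open>Groupoid operations on germs\<close>

lemma germ_pairs_comp:
  assumes "(t, F) \<in> germ_pairs \<Lambda>" "(s, pact t F) \<in> germ_pairs \<Lambda>"
  shows "(s \<circ>\<^sub>p t, F) \<in> germ_pairs \<Lambda>"
proof -
  note t = germ_pairsD[OF assms(1)] and s = germ_pairsD[OF assms(2)]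
  have "F \<inter> Domain (s \<circ>\<^sub>p t) \<noteq> {}" unfolding pact_Domain_comp[OF s(2) t(2)] by (rule s(5))
  then show ?thesis using s(1) t(1,3) inv_semigroup.mult by (auto simp only: germ_pairs_iff)
qed

lemma germ_pairs_converse:
  assumes "(s, F) \<in> germ_pairs \<Lambda>"
  shows "(s\<inverse>, pact s F) \<in> germ_pairs \<Lambda>"
  using germ_pairsD[OF assms] pact_tight pact_meets_Domain_converse inv_semigroup.inverse
  by (simp only: germ_pairs_iff) blast

lemma germ_d_germ:
  assumes "(s, F) \<in> germ_pairs \<Lambda>"
  shows "germ_d \<Lambda> (germ \<Lambda> s F) = F"
  unfolding germ_d_def using assms germ_eq_iff by (intro the_equality) blast+

lemma germ_r_germ:
  assumes "(s, F) \<in> germ_pairs \<Lambda>"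
  shows "germ_r \<Lambda> (germ \<Lambda> s F) = pact s F"
  unfolding germ_r_def
proof (rule the_equality)
  show "\<exists>t G. (t, G) \<in> germ_pairs \<Lambda> \<and> germ \<Lambda> s F = germ \<Lambda> t G \<and> pact s F = act \<Lambda> t G"
    using assms germ_pairsD(6) by metis
  fix K assume "\<exists>t G. (t, G) \<in> germ_pairs \<Lambda> \<and> germ \<Lambda> s F = germ \<Lambda> t G \<and> K = act \<Lambda> t G"
  then obtain t G where t: "(t, G) \<in> germ_pairs \<Lambda>" "germ \<Lambda> s F = germ \<Lambda> t G" "K = act \<Lambda> t G"
    by blast
  then have "F = G" "agree F s t" using germ_eq_iff assms by auto
  then show "K = pact s F"
    using t agree_pact[of s t F] germ_pairsD[OF t(1)] germ_pairsD[OF assms] by simp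
qed

text \<open>Other representatives agree with \<open>t\<close> on \<open>F\<close> and with
  \<open>s\<close> on \<open>pact t F\<close>; by \<open>agree_comp\<close> their composite agrees
  with \<open>s \<circ>\<^sub>p t\<close> on \<open>F\<close>, so the definite description has one
  value.\<close>

lemma germ_mult_germ:
  assumes "(t, F) \<in> germ_pairs \<Lambda>" "(s, pact t F) \<in> germ_pairs \<Lambda>"
  shows "germ_mult \<Lambda> (germ \<Lambda> s (pact t F)) (germ \<Lambda> t F) = germ \<Lambda> (s \<circ>\<^sub>p t) F"
  unfolding germ_mult_def
proof (rule the_equality)
  show "\<exists>s' t' G. (t', G) \<in> germ_pairs \<Lambda> \<and> (s', act \<Lambda> t' G) \<in> germ_pairs \<Lambda> \<and>
     germ \<Lambda> s (pact t F) = germ \<Lambda> s' (act \<Lambda> t' G) \<and> germ \<Lambda> t F = germ \<Lambda> t' G \<and>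
     germ \<Lambda> (s \<circ>\<^sub>p t) F = germ \<Lambda> (s' \<circ>\<^sub>p t') G"
    using assms germ_pairsD(6)[OF assms(1)] by metis
  fix z assume "\<exists>s' t' G. (t', G) \<in> germ_pairs \<Lambda> \<and> (s', act \<Lambda> t' G) \<in> germ_pairs \<Lambda> \<and>
     germ \<Lambda> s (pact t F) = germ \<Lambda> s' (act \<Lambda> t' G) \<and> germ \<Lambda> t F = germ \<Lambda> t' G \<and>
     z = germ \<Lambda> (s' \<circ>\<^sub>p t') G"
  then obtain s' t' G where *: "(t', G) \<in> germ_pairs \<Lambda>" "(s', act \<Lambda> t' G) \<in> germ_pairs \<Lambda>"
     "germ \<Lambda> s (pact t F) = germ \<Lambda> s' (act \<Lambda> t' G)" "germ \<Lambda> t F = germ \<Lambda> t' G"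
     "z = germ \<Lambda> (s' \<circ>\<^sub>p t') G" by blast
  have act: "act \<Lambda> t' G = pact t' G" using germ_pairsD(6)[OF *(1)] .
  have F: "F = G" "agree F t t'" using germ_eq_iff[OF assms(1) *(1)] *(4) by auto
  have "agree (pact t F) s s'" using germ_eq_iff[OF assms(2) *(2)] *(3) by auto
  then have "agree F (s \<circ>\<^sub>p t) (s' \<circ>\<^sub>p t')"
    using agree_comp[of s s' t t' F] germ_pairsD(2)[OF assms(1)] germ_pairsD(2)[OF assms(2)]
      germ_pairsD(2)[OF *(1)] germ_pairsD(2)[OF *(2)] germ_pairsD(4)[OF assms(1)] F(2) by blast
  moreover have "(s' \<circ>\<^sub>p t', F) \<in> germ_pairs \<Lambda>" using germ_pairs_comp *(1,2) act F(1) by simp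
  ultimately show "z = germ \<Lambda> (s \<circ>\<^sub>p t) F"
    using germ_eq_iff[OF germ_pairs_comp[OF assms]] *(5) F(1) by blast
qed

lemma germ_inv_germ:
  assumes "(s, F) \<in> germ_pairs \<Lambda>"
  shows "germ_inv \<Lambda> (germ \<Lambda> s F) = germ \<Lambda> (s\<inverse>) (pact s F)"
  unfolding germ_inv_def
proof (rule the_equality)
  show "\<exists>t G. (t, G) \<in> germ_pairs \<Lambda> \<and> germ \<Lambda> s F = germ \<Lambda> t G \<and>
      germ \<Lambda> (s\<inverse>) (pact s F) = germ \<Lambda> (t\<inverse>) (act \<Lambda> t G)"
    using assms germ_pairsD(6)[OF assms] by metis
  fix z assume "\<exists>t G. (t, G) \<in> germ_pairs \<Lambda> \<and> germ \<Lambda> s F = germ \<Lambda> t G \<and>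
      z = germ \<Lambda> (t\<inverse>) (act \<Lambda> t G)"
  then obtain t G where t: "(t, G) \<in> germ_pairs \<Lambda>" "germ \<Lambda> s F = germ \<Lambda> t G"
      "z = germ \<Lambda> (t\<inverse>) (act \<Lambda> t G)" by blast
  then have F: "F = G" "agree F s t" using germ_eq_iff assms by auto
  note s' = germ_pairsD[OF assms] and t' = germ_pairsD[OF t(1)]
  have eq: "pact s F = pact t G" using agree_pact[OF s'(2) t'(2) s'(4)] F by simp
  have "agree (pact s F) (s\<inverse>) (t\<inverse>)" by (rule agree_converse[OF s'(2) F(2)])
  then show "z = germ \<Lambda> (s\<inverse>) (pact s F)"
    using germ_eq_iff[OF germ_pairs_converse[OF assms] germ_pairs_converse[OF t(1)]] eq t(3) t'(6)
    by simp
qed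

lemma germ_composable_iff:
  assumes "(s, F) \<in> germ_pairs \<Lambda>" "(t, G) \<in> germ_pairs \<Lambda>"
  shows "(germ \<Lambda> s F, germ \<Lambda> t G) \<in> composable (germ_groupoid \<Lambda>) \<longleftrightarrow> F = pact t G"
proof -
  have "germ \<Lambda> s F \<in> germ_pairs \<Lambda> // germ_rel \<Lambda>" "germ \<Lambda> t G \<in> germ_pairs \<Lambda> // germ_rel \<Lambda>"
    using assms in_germs_iff by blast+
  then show ?thesis using germ_d_germ[OF assms(1)] germ_r_germ[OF assms(2)]
    by (simp add: germ_groupoid_def)
qed

lemma germ_composableE:
  assumes "(x, y) \<in> composable (germ_groupoid \<Lambda>)"
  obtains s t F where "(t, F) \<in> germ_pairs \<Lambda>" "(s, pact t F) \<in> germ_pairs \<Lambda>"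
    "x = germ \<Lambda> s (pact t F)" "y = germ \<Lambda> t F"
proof -
  have xy: "x \<in> germ_pairs \<Lambda> // germ_rel \<Lambda>" "y \<in> germ_pairs \<Lambda> // germ_rel \<Lambda>"
    using assms by (auto simp: germ_groupoid_def)
  obtain s K t F where st: "(s, K) \<in> germ_pairs \<Lambda>" "x = germ \<Lambda> s K" "(t, F) \<in> germ_pairs \<Lambda>" "y = germ \<Lambda> t F"
    using xy in_germs_iff by metis
  then have "K = pact t F" using assms germ_composable_iff by blast
  then show ?thesis using that st by blast
qed

lemma arrows_germ_groupoid: "arrows (germ_groupoid \<Lambda>) = germ_pairs \<Lambda> // germ_rel \<Lambda>"
  and gmult_germ_groupoid: "gmult (germ_groupoid \<Lambda>) = germ_mult \<Lambda>"
  and ginv_germ_groupoid: "ginv (germ_groupoid \<Lambda>) = germ_inv \<Lambda>"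
  by (simp_all add: germ_groupoid_def)

lemma is_groupoid_germ: "is_groupoid (germ_groupoid \<Lambda>)"
proof (rule is_groupoidI; unfold arrows_germ_groupoid gmult_germ_groupoid ginv_germ_groupoid)
  let ?C = "composable (germ_groupoid \<Lambda>)"
  let ?A = "germ_pairs \<Lambda> // germ_rel \<Lambda>"
  fix x y assume "(x, y) \<in> ?C"
  then show "x \<in> ?A" "y \<in> ?A" by (simp_all add: germ_groupoid_def)
next
  let ?C = "composable (germ_groupoid \<Lambda>)"
  let ?A = "germ_pairs \<Lambda> // germ_rel \<Lambda>"
  fix x y assume "(x, y) \<in> ?C"
  then obtain s t F where st: "(t, F) \<in> germ_pairs \<Lambda>" "(s, pact t F) \<in> germ_pairs \<Lambda>"
    and xy: "x = germ \<Lambda> s (pact t F)" "y = germ \<Lambda> t F" by (rule germ_composableE)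
  note s' = germ_pairsD[OF st(2)] and t' = germ_pairsD[OF st(1)]
  note c = germ_pairs_comp[OF st] and ti = germ_pairs_converse[OF st(1)]
    and si = germ_pairs_converse[OF st(2)]
  have m: "germ_mult \<Lambda> x y = germ \<Lambda> (s \<circ>\<^sub>p t) F" using germ_mult_germ[OF st] xy by simp
  show "germ_mult \<Lambda> x y \<in> ?A" using m c in_germs_iff by blast
  have pc: "pact (s \<circ>\<^sub>p t) F = pact s (pact t F)" by (rule pact_comp[OF s'(2) t'(2)])
  have si': "(s\<inverse>, pact (s \<circ>\<^sub>p t) F) \<in> germ_pairs \<Lambda>" using si pc by simp
  have "germ_mult \<Lambda> (germ_inv \<Lambda> x) (germ_mult \<Lambda> x y) = germ \<Lambda> (s\<inverse> \<circ>\<^sub>p (s \<circ>\<^sub>p t)) F"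
    using germ_mult_germ[OF c si'] m germ_inv_germ[OF st(2)] xy pc by simp
  \<comment> \<open>As \<open>s\<close> is injective, the triple product is a restriction of
    \<open>t\<close>; a restriction whose domain still meets \<open>F\<close> has the same germ at
    \<open>F\<close>. The second cancellation law below works alike, with single-valuedness of
    \<open>t\<close>.\<close>
  also have "\<dots> = germ \<Lambda> t F"
  proof (rule germ_eqI[OF germ_pairs_comp[OF c si'] st(1)], rule agree_subset)
    show "s\<inverse> \<circ>\<^sub>p (s \<circ>\<^sub>p t) \<subseteq> t"
    proof (rule subrelI)
      fix a b assume "(a, b) \<in> s\<inverse> \<circ>\<^sub>p (s \<circ>\<^sub>p t)"
      then obtain u v where "(a, u) \<in> t" "(u, v) \<in> s" "(b, v) \<in> s" by blast
      then show "(a, b) \<in> t" using equivariantD(6)[OF s'(2)] by blast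
    qed
    show "F \<inter> Domain (s\<inverse> \<circ>\<^sub>p (s \<circ>\<^sub>p t)) \<noteq> {}" by (rule germ_pairsD(5)[OF germ_pairs_comp[OF c si']])
  qed
  finally show "germ_mult \<Lambda> (germ_inv \<Lambda> x) (germ_mult \<Lambda> x y) = y" using xy by simp
  have F: "pact (t\<inverse>) (pact t F) = F" by (rule pact_converse[OF t'(2,4,5)])
  have c': "(s \<circ>\<^sub>p t, pact (t\<inverse>) (pact t F)) \<in> germ_pairs \<Lambda>" using c F by simp
  have "germ_mult \<Lambda> (germ_mult \<Lambda> x y) (germ_inv \<Lambda> y) = germ \<Lambda> ((s \<circ>\<^sub>p t) \<circ>\<^sub>p t\<inverse>) (pact t F)"
    using germ_mult_germ[OF ti c'] m germ_inv_germ[OF st(1)] xy F by simp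
  also have "\<dots> = germ \<Lambda> s (pact t F)"
  proof (rule germ_eqI[OF germ_pairs_comp[OF ti c'] st(2)], rule agree_subset)
    show "(s \<circ>\<^sub>p t) \<circ>\<^sub>p t\<inverse> \<subseteq> s"
    proof (rule subrelI)
      fix a b assume "(a, b) \<in> (s \<circ>\<^sub>p t) \<circ>\<^sub>p t\<inverse>"
      then obtain u v where "(u, a) \<in> t" "(u, v) \<in> t" "(v, b) \<in> s" by blast
      then show "(a, b) \<in> s" using equivariantD(5)[OF t'(2)] by blast
    qed
    show "pact t F \<inter> Domain ((s \<circ>\<^sub>p t) \<circ>\<^sub>p t\<inverse>) \<noteq> {}"
      by (rule germ_pairsD(5)[OF germ_pairs_comp[OF ti c']])
  qed
  finally show "germ_mult \<Lambda> (germ_mult \<Lambda> x y) (germ_inv \<Lambda> y) = x" using xy by simp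
next
  let ?C = "composable (germ_groupoid \<Lambda>)"
  let ?A = "germ_pairs \<Lambda> // germ_rel \<Lambda>"
  fix x assume "x \<in> ?A"
  then obtain s F where s: "(s, F) \<in> germ_pairs \<Lambda>" and x: "x = germ \<Lambda> s F" using in_germs_iff by blast
  note s' = germ_pairsD[OF s] and si = germ_pairs_converse[OF s]
  have i: "germ_inv \<Lambda> x = germ \<Lambda> (s\<inverse>) (pact s F)" using germ_inv_germ[OF s] x by simp
  have F: "pact (s\<inverse>) (pact s F) = F" by (rule pact_converse[OF s'(2,4,5)])
  show "germ_inv \<Lambda> x \<in> ?A" using i si in_germs_iff by blast
  show "germ_inv \<Lambda> (germ_inv \<Lambda> x) = x" using germ_inv_germ[OF si] i F x by simp
  show "(germ_inv \<Lambda> x, x) \<in> ?C" using germ_composable_iff[OF si s] i x by simp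
  show "(x, germ_inv \<Lambda> x) \<in> ?C" using germ_composable_iff[OF s si] i x F by simp
next
  let ?C = "composable (germ_groupoid \<Lambda>)"
  fix x y z assume xy: "(x, y) \<in> ?C" and yz: "(y, z) \<in> ?C"
  obtain t u F where tu: "(u, F) \<in> germ_pairs \<Lambda>" "(t, pact u F) \<in> germ_pairs \<Lambda>"
    and y: "y = germ \<Lambda> t (pact u F)" and z: "z = germ \<Lambda> u F" using yz by (rule germ_composableE)
  have "x \<in> germ_pairs \<Lambda> // germ_rel \<Lambda>" using xy by (simp add: germ_groupoid_def)
  then obtain s K where s: "(s, K) \<in> germ_pairs \<Lambda>" and x: "x = germ \<Lambda> s K" using in_germs_iff by blast
  have K: "K = pact t (pact u F)" using xy germ_composable_iff[OF s tu(2)] x y by simp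
  note t' = germ_pairsD[OF tu(2)] and u' = germ_pairsD[OF tu(1)]
  have s': "(s, pact t (pact u F)) \<in> germ_pairs \<Lambda>" using s K by simp
  note st = germ_pairs_comp[OF tu(2) s'] and tu' = germ_pairs_comp[OF tu]
  have pc: "pact (t \<circ>\<^sub>p u) F = pact t (pact u F)" by (rule pact_comp[OF t'(2) u'(2)])
  have s'': "(s, pact (t \<circ>\<^sub>p u) F) \<in> germ_pairs \<Lambda>" using s' pc by simp
  have xy': "germ_mult \<Lambda> x y = germ \<Lambda> (s \<circ>\<^sub>p t) (pact u F)" using germ_mult_germ[OF tu(2) s'] x y K by simp
  have yz': "germ_mult \<Lambda> y z = germ \<Lambda> (t \<circ>\<^sub>p u) F" using germ_mult_germ[OF tu] y z by simp
  show "(germ_mult \<Lambda> x y, z) \<in> ?C" using germ_composable_iff[OF st tu(1)] xy' z by simp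
  show "(x, germ_mult \<Lambda> y z) \<in> ?C" using germ_composable_iff[OF s tu'] x yz' K pc by simp
  have "germ_mult \<Lambda> (germ_mult \<Lambda> x y) z = germ \<Lambda> ((s \<circ>\<^sub>p t) \<circ>\<^sub>p u) F"
    using germ_mult_germ[OF tu(1) st] xy' z by simp
  moreover have "germ_mult \<Lambda> x (germ_mult \<Lambda> y z) = germ \<Lambda> (s \<circ>\<^sub>p (t \<circ>\<^sub>p u)) F"
    using germ_mult_germ[OF tu' s''] x yz' K pc by simp
  ultimately show "germ_mult \<Lambda> (germ_mult \<Lambda> x y) z = germ_mult \<Lambda> x (germ_mult \<Lambda> y z)"
    by (simp add: O_assoc)
qed

subsection \<open>Topology\<close>

lemma openin_path_basic:
  assumes "finite X" "X \<subseteq> Mor \<Lambda>" "finite Y" "Y \<subseteq> Mor \<Lambda>"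
  shows "openin (path_topology \<Lambda>) {F \<in> path_space \<Lambda>. X \<subseteq> F \<and> Y \<inter> F = {}}"
  unfolding path_topology_def using assms by (intro topology_generated_by_Basis) blast

lemma topspace_path_topology: "topspace (path_topology \<Lambda>) = path_space \<Lambda>"
proof -
  have "path_space \<Lambda> = {F \<in> path_space \<Lambda>. {} \<subseteq> F \<and> {} \<inter> F = {}}" by simp
  then have "openin (path_topology \<Lambda>) (path_space \<Lambda>)" using openin_path_basic[of "{}" "{}"] by simp
  then show ?thesis
    using openin_subset[of "path_topology \<Lambda>" "path_space \<Lambda>"]
    unfolding path_topology_def topology_generated_by_topspace by blast
qed

lemma openin_path_mem:
  assumes "x \<in> Mor \<Lambda>"
  shows "openin (path_topology \<Lambda>) {F \<in> path_space \<Lambda>. x \<in> F}"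
  using openin_path_basic[of "{x}" "{}"] assms by simp

lemma openin_path_meets_Domain:
  assumes "equivariant s"
  shows "openin (path_topology \<Lambda>) {F \<in> path_space \<Lambda>. F \<inter> Domain s \<noteq> {}}"
proof -
  have "{F \<in> path_space \<Lambda>. F \<inter> Domain s \<noteq> {}} = (\<Union>x\<in>Domain s. {F \<in> path_space \<Lambda>. x \<in> F})" by blast
  moreover have "x \<in> Mor \<Lambda>" if "x \<in> Domain s" for x using that equivariantD(1)[OF assms] by blast
  ultimately show ?thesis using openin_path_mem by (auto intro!: openin_Union)
qed

text \<open>Membership of \<open>x\<close> is witnessed by a single point \<open>g\<close> of
  \<open>F\<close>, so the set is a union of basic open sets.\<close>

lemma openin_pact_mem:
  assumes "equivariant s"
  shows "openin (path_topology \<Lambda>) {F \<in> path_space \<Lambda>. x \<in> pact s F}"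
proof -
  have "{F \<in> path_space \<Lambda>. x \<in> pact s F} =
      (\<Union>g\<in>{g. \<exists>y. (g, y) \<in> s \<and> cat_le \<Lambda> x y}. {F \<in> path_space \<Lambda>. g \<in> F})"
    by (auto simp: pact_def)
  moreover have "g \<in> Mor \<Lambda>" if "g \<in> {g. \<exists>y. (g, y) \<in> s \<and> cat_le \<Lambda> x y}" for g
    using that equivariantD(1)[OF assms] by blast
  ultimately show ?thesis using openin_path_mem by (auto intro!: openin_Union)
qed

text \<open>This is where finite alignment enters the topology: \<open>y\<close> and a point of the path \<open>s \<cdot> F\<close>
  have finitely many minimal common extensions, so \<open>y \<notin> s \<cdot> F\<close> is decided by finitely many
  conditions on \<open>F\<close>.\<close>

lemma openin_pact_not_mem:
  assumes s: "equivariant s" and y: "y \<in> Mor \<Lambda>"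
  shows "openin (path_topology \<Lambda>) {F \<in> path_space \<Lambda>. F \<inter> Domain s \<noteq> {} \<and> y \<notin> pact s F}"
    (is "openin _ ?U")
proof (subst openin_subopen, intro ballI)
  fix F assume "F \<in> ?U"
  then have F: "F \<in> path_space \<Lambda>" "y \<notin> pact s F" and "F \<inter> Domain s \<noteq> {}" by auto
  then obtain g e where g: "g \<in> F" "(g, e) \<in> s" by blast
  note ge = equivariantD[OF s g(2)]
  obtain \<Gamma> where \<Gamma>: "finite \<Gamma>" "\<And>h. h \<in> \<Gamma> \<Longrightarrow> cat_le \<Lambda> e h \<and> cat_le \<Lambda> y h"
    "\<And>x. cat_le \<Lambda> e x \<Longrightarrow> cat_le \<Lambda> y x \<Longrightarrow> \<exists>h\<in>\<Gamma>. cat_le \<Lambda> h x"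
    using common_extensions[OF ge(2) y] by blast
  define Y where "Y = s\<inverse> `` \<Gamma>"
  note sc = equivariant_converse[OF s]
  \<comment> \<open>As \<open>s\<close> is injective, each point of \<Gamma> has at most one
    preimage; this form shows that \<open>Y\<close> is finite.\<close>
  have "Y = (\<lambda>h. THE x. (x, h) \<in> s) ` (\<Gamma> \<inter> Range s)"
  proof (rule set_eqI)
    have *: "(THE x. (x, h) \<in> s) = x" if "(x, h) \<in> s" for x h
      using that equivariantD(6)[OF s that] by (rule the_equality)
    show "x \<in> Y \<longleftrightarrow> x \<in> (\<lambda>h. THE x. (x, h) \<in> s) ` (\<Gamma> \<inter> Range s)" for x
    proof
      assume "x \<in> Y"
      then obtain h where "h \<in> \<Gamma>" "(x, h) \<in> s" by (auto simp: Y_def)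
      then show "x \<in> (\<lambda>h. THE x. (x, h) \<in> s) ` (\<Gamma> \<inter> Range s)" using * by (auto intro!: image_eqI[of _ _ h])
    next
      assume "x \<in> (\<lambda>h. THE x. (x, h) \<in> s) ` (\<Gamma> \<inter> Range s)"
      then obtain h x' where "h \<in> \<Gamma>" "(x', h) \<in> s" "x = (THE x. (x, h) \<in> s)" by blast
      then show "x \<in> Y" using * by (auto simp: Y_def)
    qed
  qed
  then have finY: "finite Y" using \<Gamma>(1) by simp
  have YM: "Y \<subseteq> Mor \<Lambda>" using equivariantD(1)[OF s] by (auto simp: Y_def)
  let ?V = "{K \<in> path_space \<Lambda>. {g} \<subseteq> K \<and> Y \<inter> K = {}}"
  have "openin (path_topology \<Lambda>) ?V"
    using openin_path_basic[of "{g}" Y] finY YM ge(1) by simp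
  moreover have "F \<in> ?V"
  proof -
    have "k \<notin> F" if k: "k \<in> Y" for k
    proof
      assume kF: "k \<in> F"
      obtain h where h: "h \<in> \<Gamma>" "(k, h) \<in> s" using k by (auto simp: Y_def)
      then have "y \<in> pact s F" using \<Gamma>(2) kF unfolding pact_def by blast
      then show False using F(2) by blast
    qed
    then show ?thesis using F(1) g(1) by blast
  qed
  moreover have "?V \<subseteq> ?U"
  proof
    fix K assume K: "K \<in> ?V"
    then have KP: "K \<in> path_space \<Lambda>" and gK: "g \<in> K" by auto
    have ne: "K \<inter> Domain s \<noteq> {}" using gK g(2) by blast
    \<comment> \<open>Otherwise \<open>pact s K\<close> contains a common extension of
      \<open>e\<close> and \<open>y\<close>, hence by heredity some \<open>h\<close> in \<Gamma>. As
      \<open>h\<close> extends \<open>e\<close>, it has a preimage under \<open>s\<close>; this lies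
      in \<open>K\<close>, because the converse of \<open>s\<close> carries \<open>pact s K\<close>
      back to \<open>K\<close>, but it also lies in \<open>Y\<close>.\<close>
    have "y \<notin> pact s K"
    proof
      assume yK: "y \<in> pact s K"
      have "e \<in> pact s K" by (rule pactI[OF s g(2) gK])
      then obtain c where c: "c \<in> pact s K" "cat_le \<Lambda> e c" "cat_le \<Lambda> y c"
        using pathD(4)[OF pact_path_space[OF s KP ne] _ yK] by blast
      then obtain h where h: "h \<in> \<Gamma>" "cat_le \<Lambda> h c" using \<Gamma>(3) by blast
      have "h \<in> pact s K" by (rule pathD(3)[OF pact_path_space[OF s KP ne] h(2) c(1)])
      have "(e, g) \<in> s\<inverse>" using g(2) by blast
      then obtain k where k: "(h, k) \<in> s\<inverse>"
        by (rule equivariant_mono[OF sc _ conjunct1[OF \<Gamma>(2)[OF h(1)]]])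
      have "k \<in> pact (s\<inverse>) (pact s K)" by (rule pactI[OF sc k \<open>h \<in> pact s K\<close>])
      then have "k \<in> K" unfolding pact_converse[OF s KP ne] .
      moreover have "k \<in> Y" using k h(1) by (auto simp: Y_def)
      ultimately show False using K by blast
    qed
    then show "K \<in> ?U" using KP ne by blast
  qed
  ultimately show "\<exists>T. openin (path_topology \<Lambda>) T \<and> F \<in> T \<and> T \<subseteq> ?U" by blast
qed

text \<open>This is continuity of the action of \<open>s\<close>. A basic open set imposes finitely
  many conditions of membership and non-membership, and the two preceding lemmas show that each of
  them is open in \<open>F\<close>.\<close>

lemma openin_pact_vimage:
  assumes s: "equivariant s" and U: "openin (path_topology \<Lambda>) U"
  shows "openin (path_topology \<Lambda>) {F \<in> path_space \<Lambda>. F \<inter> Domain s \<noteq> {} \<and> pact s F \<in> U}"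
proof -
  let ?T = "path_topology \<Lambda>" and ?D = "{F \<in> path_space \<Lambda>. F \<inter> Domain s \<noteq> {}}"
  have D: "openin ?T ?D" by (rule openin_path_meets_Domain[OF s])
  have top: "topspace (subtopology ?T ?D) = ?D"
    using openin_subset[OF D] by (simp add: inf.absorb2)
  have gen: "path_topology \<Lambda> = topology_generated_by
     {{F \<in> path_space \<Lambda>. X \<subseteq> F \<and> Y \<inter> F = {}} | X Y.
        finite X \<and> X \<subseteq> Mor \<Lambda> \<and> finite Y \<and> Y \<subseteq> Mor \<Lambda>}" (is "_ = topology_generated_by ?B")
    by (simp add: path_topology_def)
  have UB: "\<Union>?B = path_space \<Lambda>"
    using topspace_path_topology unfolding gen topology_generated_by_topspace .
  have "continuous_map (subtopology ?T ?D) (topology_generated_by ?B) (pact s)"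
  proof (rule continuous_on_generated_topo)
    show "pact s ` topspace (subtopology ?T ?D) \<subseteq> \<Union>?B"
      unfolding top UB using pact_path_space[OF s] by blast
    fix W assume "W \<in> ?B"
    then obtain X Y where W: "W = {F \<in> path_space \<Lambda>. X \<subseteq> F \<and> Y \<inter> F = {}}"
      and X: "finite X" "X \<subseteq> Mor \<Lambda>" and Y: "finite Y" "Y \<subseteq> Mor \<Lambda>" by blast
    \<comment> \<open>Intersecting with the whole space takes care of empty \<open>X\<close> or
      \<open>Y\<close>, where the bare intersection would be the universal set.\<close>
    have "pact s -` W \<inter> ?D =
        ((\<Inter>x\<in>X. {F \<in> path_space \<Lambda>. x \<in> pact s F}) \<inter> topspace ?T) \<inter>
        ((\<Inter>y\<in>Y. {F \<in> path_space \<Lambda>. F \<inter> Domain s \<noteq> {} \<and> y \<notin> pact s F}) \<inter> topspace ?T) \<inter> ?D"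
      unfolding W topspace_path_topology using pact_path_space[OF s] by auto
    moreover have "openin ?T ((\<Inter>x\<in>X. {F \<in> path_space \<Lambda>. x \<in> pact s F}) \<inter> topspace ?T)"
      by (rule openin_INT[OF X(1) openin_pact_mem[OF s]])
    moreover have "openin ?T ((\<Inter>y\<in>Y. {F \<in> path_space \<Lambda>. F \<inter> Domain s \<noteq> {} \<and> y \<notin> pact s F}) \<inter> topspace ?T)"
      using Y by (intro openin_INT openin_pact_not_mem[OF s]) auto
    ultimately have "openin ?T (pact s -` W \<inter> ?D)" using D by (simp only: openin_Int)
    then show "openin (subtopology ?T ?D) (pact s -` W \<inter> topspace (subtopology ?T ?D))"
      unfolding top openin_subtopology by (intro exI[of _ "pact s -` W \<inter> ?D"]) blast
  qed
  then have "continuous_map (subtopology ?T ?D) ?T (pact s)" unfolding gen .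
  then have "openin (subtopology ?T ?D) {F \<in> topspace (subtopology ?T ?D). pact s F \<in> U}"
    by (rule openin_continuous_map_preimage[OF _ U])
  then have "openin ?T {F \<in> ?D. pact s F \<in> U}"
    unfolding top using openin_trans_full D by blast
  moreover have "{F \<in> ?D. pact s F \<in> U} = {F \<in> path_space \<Lambda>. F \<inter> Domain s \<noteq> {} \<and> pact s F \<in> U}" by blast
  ultimately show ?thesis by simp
qed

section \<open>Topology of the germ groupoid\<close>

lemma openin_tight_iff:
  "openin (tight_topology \<Lambda>) U \<longleftrightarrow> (\<exists>V. openin (path_topology \<Lambda>) V \<and> U = V \<inter> tight_paths \<Lambda>)"
  by (simp add: tight_topology_def openin_subtopology)

text \<open>The given generators rewritten with \<open>V\<close> open in the full path space, so
  that the openness results about the action apply directly and tightness is a mere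
  intersection.\<close>

definition germ_basis :: "'a germ set set" where
  "germ_basis = {germ \<Lambda> s ` (V \<inter> tight_paths \<Lambda>) | s V. s \<in> inv_semigroup \<Lambda> \<and>
     openin (path_topology \<Lambda>) V \<and> (\<forall>F\<in>V. F \<inter> Domain s \<noteq> {})}"

lemma gtop_germ_groupoid: "gtop (germ_groupoid \<Lambda>) = topology_generated_by germ_basis"
proof -
  have "{germ \<Lambda> s ` U | s U. s \<in> inv_semigroup \<Lambda> \<and>
           U \<subseteq> act_dom \<Lambda> s \<inter> tight_paths \<Lambda> \<and> openin (tight_topology \<Lambda>) U} = germ_basis"
    (is "?L = _")
  proof
    show "?L \<subseteq> germ_basis"
    proof
      fix W assume "W \<in> ?L"
      then obtain s U where s: "W = germ \<Lambda> s ` U" "s \<in> inv_semigroup \<Lambda>"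
        "U \<subseteq> act_dom \<Lambda> s \<inter> tight_paths \<Lambda>" "openin (tight_topology \<Lambda>) U" by blast
      obtain V where V: "openin (path_topology \<Lambda>) V" "U = V \<inter> tight_paths \<Lambda>"
        using s(4) openin_tight_iff by blast
      \<comment> \<open>An open set that cuts out \<open>U\<close> may contain non-tight paths
        outside the domain of \<open>s\<close>. Removing them keeps the set open and leaves its
        tight part unchanged.\<close>
      let ?V = "V \<inter> {F \<in> path_space \<Lambda>. F \<inter> Domain s \<noteq> {}}"
      have "openin (path_topology \<Lambda>) ?V"
        using V(1) openin_path_meets_Domain[OF equivariant_inv_semigroup[OF s(2)]] by blast
      moreover have "U = ?V \<inter> tight_paths \<Lambda>"
        using s(3) V(2) act_dom_iff[OF s(2)] by blast
      ultimately show "W \<in> germ_basis" unfolding germ_basis_def using s(1,2) by blast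
    qed
    show "germ_basis \<subseteq> ?L"
    proof
      fix W assume "W \<in> germ_basis"
      then obtain s V where s: "W = germ \<Lambda> s ` (V \<inter> tight_paths \<Lambda>)" "s \<in> inv_semigroup \<Lambda>"
        "openin (path_topology \<Lambda>) V" "\<forall>F\<in>V. F \<inter> Domain s \<noteq> {}" unfolding germ_basis_def by blast
      have "V \<inter> tight_paths \<Lambda> \<subseteq> act_dom \<Lambda> s \<inter> tight_paths \<Lambda>"
        using s(4) act_dom_iff[OF s(2)] tight_path by blast
      moreover have "openin (tight_topology \<Lambda>) (V \<inter> tight_paths \<Lambda>)"
        using s(3) openin_tight_iff by blast
      ultimately show "W \<in> ?L" using s(1,2) by blast
    qed
  qed
  then show ?thesis by (simp add: germ_groupoid_def)
qed

lemma openin_germ_image: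
  assumes "s \<in> inv_semigroup \<Lambda>" "openin (path_topology \<Lambda>) V" "\<forall>F\<in>V. F \<inter> Domain s \<noteq> {}"
  shows "openin (gtop (germ_groupoid \<Lambda>)) (germ \<Lambda> s ` (V \<inter> tight_paths \<Lambda>))"
proof -
  have "germ \<Lambda> s ` (V \<inter> tight_paths \<Lambda>) \<in> germ_basis"
    unfolding germ_basis_def using assms by blast
  then show ?thesis unfolding gtop_germ_groupoid by (rule topology_generated_by_Basis)
qed

lemma germ_basisE:
  assumes "W \<in> germ_basis"
  obtains s V where "W = germ \<Lambda> s ` (V \<inter> tight_paths \<Lambda>)" "s \<in> inv_semigroup \<Lambda>"
    "openin (path_topology \<Lambda>) V" "\<forall>F\<in>V. F \<inter> Domain s \<noteq> {}"
  using assms unfolding germ_basis_def by blast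

text \<open>Membership in a basic set splits into an open condition on the path and agreement, which
  a single point witnesses. The continuity proofs keep that witness fixed while the path
  varies.\<close>

lemma germ_in_image_iff:
  assumes "(s, F) \<in> germ_pairs \<Lambda>" "t \<in> inv_semigroup \<Lambda>" "\<forall>F\<in>V. F \<inter> Domain t \<noteq> {}"
  shows "germ \<Lambda> s F \<in> germ \<Lambda> t ` (V \<inter> tight_paths \<Lambda>) \<longleftrightarrow> F \<in> V \<and> agree F s t"
proof -
  have *: "(t, K) \<in> germ_pairs \<Lambda>" if "K \<in> V \<inter> tight_paths \<Lambda>" for K
    using that assms(2,3) by (auto simp: germ_pairs_iff)
  show ?thesis
  proof
    assume "germ \<Lambda> s F \<in> germ \<Lambda> t ` (V \<inter> tight_paths \<Lambda>)"
    then obtain K where K: "K \<in> V \<inter> tight_paths \<Lambda>" "germ \<Lambda> s F = germ \<Lambda> t K" by blast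
    then show "F \<in> V \<and> agree F s t" using germ_eq_iff[OF assms(1) *[OF K(1)]] by blast
  next
    assume F: "F \<in> V \<and> agree F s t"
    then have FV: "F \<in> V \<inter> tight_paths \<Lambda>" using germ_pairsD(3)[OF assms(1)] by blast
    have "germ \<Lambda> s F = germ \<Lambda> t F" using germ_eqI[OF assms(1) *[OF FV]] F by blast
    then show "germ \<Lambda> s F \<in> germ \<Lambda> t ` (V \<inter> tight_paths \<Lambda>)" using FV by blast
  qed
qed

lemma Union_germ_basis: "\<Union>germ_basis = germ_pairs \<Lambda> // germ_rel \<Lambda>"
proof
  show "\<Union>germ_basis \<subseteq> germ_pairs \<Lambda> // germ_rel \<Lambda>"
  proof
    fix x assume "x \<in> \<Union>germ_basis"
    then obtain W where W: "x \<in> W" "W \<in> germ_basis" by blast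
    obtain s V where s: "W = germ \<Lambda> s ` (V \<inter> tight_paths \<Lambda>)" "s \<in> inv_semigroup \<Lambda>"
      "openin (path_topology \<Lambda>) V" "\<forall>F\<in>V. F \<inter> Domain s \<noteq> {}" using W(2) by (rule germ_basisE)
    obtain F where F: "F \<in> V" "F \<in> tight_paths \<Lambda>" "x = germ \<Lambda> s F" using W(1) s(1) by blast
    then have "(s, F) \<in> germ_pairs \<Lambda>" using s(2,4) by (simp add: germ_pairs_iff)
    then show "x \<in> germ_pairs \<Lambda> // germ_rel \<Lambda>" using F(3) in_germs_iff by blast
  qed
  show "germ_pairs \<Lambda> // germ_rel \<Lambda> \<subseteq> \<Union>germ_basis"
  proof
    fix x assume "x \<in> germ_pairs \<Lambda> // germ_rel \<Lambda>"
    then obtain s F where s: "(s, F) \<in> germ_pairs \<Lambda>" "x = germ \<Lambda> s F" using in_germs_iff by blast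
    note s' = germ_pairsD[OF s(1)]
    let ?V = "{F \<in> path_space \<Lambda>. F \<inter> Domain s \<noteq> {}}"
    have "germ \<Lambda> s ` (?V \<inter> tight_paths \<Lambda>) \<in> germ_basis"
      unfolding germ_basis_def using s'(1) openin_path_meets_Domain[OF s'(2)] by blast
    then show "x \<in> \<Union>germ_basis" using s s'(3,4,5) by blast
  qed
qed

lemma topspace_germ: "topspace (gtop (germ_groupoid \<Lambda>)) = germ_pairs \<Lambda> // germ_rel \<Lambda>"
  unfolding gtop_germ_groupoid topology_generated_by_topspace Union_germ_basis ..

text \<open>If the product germ lies in a basic set of \<open>u\<close>, then
  \<open>s \<circ>\<^sub>p t\<close> and \<open>u\<close> agree at some \<open>a\<close> in
  \<open>F\<close>. Requiring nearby paths to contain \<open>a\<close> makes the same point witness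
  agreement for all nearby composable pairs.\<close>

lemma continuous_map_germ_mult:
  "continuous_map (subtopology (prod_topology (gtop (germ_groupoid \<Lambda>)) (gtop (germ_groupoid \<Lambda>)))
      (composable (germ_groupoid \<Lambda>))) (gtop (germ_groupoid \<Lambda>)) (\<lambda>(x, y). germ_mult \<Lambda> x y)"
    (is "continuous_map ?P _ ?m")
proof -
  let ?T = "gtop (germ_groupoid \<Lambda>)" and ?C = "composable (germ_groupoid \<Lambda>)"
  have "?C \<subseteq> topspace ?T \<times> topspace ?T"
    unfolding topspace_germ by (auto simp: germ_groupoid_def)
  then have top: "topspace ?P = ?C" by (simp add: inf.absorb2)
  have "continuous_map ?P (topology_generated_by germ_basis) ?m"
  proof (rule continuous_on_generated_topo)
    show "?m ` topspace ?P \<subseteq> \<Union>germ_basis"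
      unfolding top Union_germ_basis
      using is_groupoid_germ
      unfolding is_groupoid_def arrows_germ_groupoid gmult_germ_groupoid by auto
    fix W assume "W \<in> germ_basis"
    then obtain u V where W: "W = germ \<Lambda> u ` (V \<inter> tight_paths \<Lambda>)" and u: "u \<in> inv_semigroup \<Lambda>"
      and V: "openin (path_topology \<Lambda>) V" "\<forall>F\<in>V. F \<inter> Domain u \<noteq> {}" by (rule germ_basisE)
    show "openin ?P (?m -` W \<inter> topspace ?P)"
      unfolding top
    proof (subst openin_subopen, intro ballI)
      fix p assume p: "p \<in> ?m -` W \<inter> ?C"
      then obtain x y where xy: "p = (x, y)" "(x, y) \<in> ?C" "germ_mult \<Lambda> x y \<in> W"
        by (cases p) auto
      obtain s t F where st: "(t, F) \<in> germ_pairs \<Lambda>" "(s, pact t F) \<in> germ_pairs \<Lambda>"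
        and x: "x = germ \<Lambda> s (pact t F)" and y: "y = germ \<Lambda> t F"
        using xy(2) by (rule germ_composableE)
      note s' = germ_pairsD[OF st(2)] and t' = germ_pairsD[OF st(1)]
      have "germ \<Lambda> (s \<circ>\<^sub>p t) F \<in> W" using xy(3) germ_mult_germ[OF st] x y by simp
      then have F: "F \<in> V" "agree F (s \<circ>\<^sub>p t) u"
        unfolding W germ_in_image_iff[OF germ_pairs_comp[OF st] u V(2)] by auto
      obtain a b where ab: "a \<in> F" "(a, b) \<in> s \<circ>\<^sub>p t" "(a, b) \<in> u" using F(2) by (rule agreeE)
      have aM: "a \<in> Mor \<Lambda>" using ab(1) pathD(2)[OF t'(4)] by blast
      define V1 where "V1 = V \<inter> {K \<in> path_space \<Lambda>. a \<in> K}"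
      define V2 where "V2 = {K \<in> path_space \<Lambda>. K \<inter> Domain s \<noteq> {}}"
      have "a \<in> Domain t" using ab(2) by blast
      then have V1: "openin (path_topology \<Lambda>) V1" "\<forall>F\<in>V1. F \<inter> Domain t \<noteq> {}"
        using V(1) openin_path_mem[OF aM] by (auto simp: V1_def)
      have V2: "openin (path_topology \<Lambda>) V2" "\<forall>F\<in>V2. F \<inter> Domain s \<noteq> {}"
        using openin_path_meets_Domain[OF s'(2)] by (auto simp: V2_def)
      let ?X = "germ \<Lambda> s ` (V2 \<inter> tight_paths \<Lambda>)" and ?Y = "germ \<Lambda> t ` (V1 \<inter> tight_paths \<Lambda>)"
      have "openin (prod_topology ?T ?T) (?X \<times> ?Y)"
        unfolding openin_prod_Times_iff
        using openin_germ_image[OF s'(1) V2] openin_germ_image[OF t'(1) V1] by blast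
      then have "openin ?P ((?X \<times> ?Y) \<inter> ?C)" unfolding openin_subtopology by blast
      moreover have "p \<in> (?X \<times> ?Y) \<inter> ?C"
        using xy(1,2) x y F(1) ab(1) s'(3,4,5) t'(3,4) unfolding V1_def V2_def by blast
      moreover have "(?X \<times> ?Y) \<inter> ?C \<subseteq> ?m -` W \<inter> ?C"
      proof
        fix q assume q: "q \<in> (?X \<times> ?Y) \<inter> ?C"
        then obtain K L where q': "q = (germ \<Lambda> s K, germ \<Lambda> t L)" "K \<in> V2" "K \<in> tight_paths \<Lambda>"
          "L \<in> V1" "L \<in> tight_paths \<Lambda>" by blast
        have K: "(s, K) \<in> germ_pairs \<Lambda>" and L: "(t, L) \<in> germ_pairs \<Lambda>"
          using q' V1(2) V2(2) s'(1) t'(1) unfolding germ_pairs_iff by auto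
        have KL: "K = pact t L" using q unfolding q'(1) by (simp add: germ_composable_iff[OF K L])
        have K': "(s, pact t L) \<in> germ_pairs \<Lambda>" using K KL by simp
        have "a \<in> L" "L \<in> V" using q'(4) unfolding V1_def by auto
        then have "germ \<Lambda> (s \<circ>\<^sub>p t) L \<in> W"
          unfolding W germ_in_image_iff[OF germ_pairs_comp[OF L K'] u V(2)]
          using agreeI[OF _ ab(2,3)] by blast
        then have "?m q \<in> W" using q'(1) KL germ_mult_germ[OF L K'] by simp
        then show "q \<in> ?m -` W \<inter> ?C" using q by blast
      qed
      ultimately show "\<exists>S. openin ?P S \<and> p \<in> S \<and> S \<subseteq> ?m -` W \<inter> ?C" by blast
    qed
  qed
  then show ?thesis unfolding gtop_germ_groupoid .
qed

text \<open>Here the point of agreement lies in the moved path \<open>pact s F\<close>, and the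
  basic set constrains that path. Continuity of the action turns both into open conditions on the
  original path.\<close>

lemma continuous_map_germ_inv:
  "continuous_map (gtop (germ_groupoid \<Lambda>)) (gtop (germ_groupoid \<Lambda>)) (germ_inv \<Lambda>)"
proof -
  let ?T = "gtop (germ_groupoid \<Lambda>)" and ?A = "germ_pairs \<Lambda> // germ_rel \<Lambda>"
  have "continuous_map ?T (topology_generated_by germ_basis) (germ_inv \<Lambda>)"
  proof (rule continuous_on_generated_topo)
    show "germ_inv \<Lambda> ` topspace ?T \<subseteq> \<Union>germ_basis"
      unfolding topspace_germ Union_germ_basis
      using is_groupoid_germ
      unfolding is_groupoid_def arrows_germ_groupoid ginv_germ_groupoid by auto
    fix W assume "W \<in> germ_basis"
    then obtain u V where W: "W = germ \<Lambda> u ` (V \<inter> tight_paths \<Lambda>)" and u: "u \<in> inv_semigroup \<Lambda>"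
      and V: "openin (path_topology \<Lambda>) V" "\<forall>F\<in>V. F \<inter> Domain u \<noteq> {}" by (rule germ_basisE)
    show "openin ?T (germ_inv \<Lambda> -` W \<inter> topspace ?T)"
      unfolding topspace_germ
    proof (subst openin_subopen, intro ballI)
      fix x assume x: "x \<in> germ_inv \<Lambda> -` W \<inter> ?A"
      then obtain s F where s: "(s, F) \<in> germ_pairs \<Lambda>" and xs: "x = germ \<Lambda> s F"
        using in_germs_iff by blast
      note s' = germ_pairsD[OF s] and si = germ_pairs_converse[OF s]
      have "germ \<Lambda> (s\<inverse>) (pact s F) \<in> W" using x xs germ_inv_germ[OF s] by simp
      then have F: "pact s F \<in> V" "agree (pact s F) (s\<inverse>) u"
        unfolding W germ_in_image_iff[OF si u V(2)] by auto
      obtain a b where ab: "a \<in> pact s F" "(a, b) \<in> s\<inverse>" "(a, b) \<in> u" using F(2) by (rule agreeE)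
      define V1 where "V1 = {K \<in> path_space \<Lambda>. K \<inter> Domain s \<noteq> {} \<and> pact s K \<in> V} \<inter>
        {K \<in> path_space \<Lambda>. a \<in> pact s K}"
      have V1: "openin (path_topology \<Lambda>) V1" "\<forall>F\<in>V1. F \<inter> Domain s \<noteq> {}"
        using openin_pact_vimage[OF s'(2) V(1)] openin_pact_mem[OF s'(2)] by (auto simp: V1_def)
      let ?X = "germ \<Lambda> s ` (V1 \<inter> tight_paths \<Lambda>)"
      have "openin ?T ?X" by (rule openin_germ_image[OF s'(1) V1])
      moreover have "x \<in> ?X" using xs F(1) ab(1) s'(3,4,5) unfolding V1_def by blast
      moreover have "?X \<subseteq> germ_inv \<Lambda> -` W \<inter> ?A"
      proof
        fix z assume "z \<in> ?X"
        then obtain K where K: "z = germ \<Lambda> s K" "K \<in> V1" "K \<in> tight_paths \<Lambda>" by blast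
        have sK: "(s, K) \<in> germ_pairs \<Lambda>" using K V1(2) s'(1) unfolding germ_pairs_iff by auto
        have "a \<in> pact s K" "pact s K \<in> V" using K(2) unfolding V1_def by auto
        then have "germ \<Lambda> (s\<inverse>) (pact s K) \<in> W"
          unfolding W germ_in_image_iff[OF germ_pairs_converse[OF sK] u V(2)]
          using agreeI[OF _ ab(2,3)] by blast
        then show "z \<in> germ_inv \<Lambda> -` W \<inter> ?A" using K(1) germ_inv_germ[OF sK] sK in_germs_iff by auto
      qed
      ultimately show "\<exists>S. openin ?T S \<and> x \<in> S \<and> S \<subseteq> germ_inv \<Lambda> -` W \<inter> ?A" by blast
    qed
  qed
  then show ?thesis unfolding gtop_germ_groupoid .
qed

lemma is_top_groupoid_germ: "is_top_groupoid (germ_groupoid \<Lambda>)"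
  unfolding is_top_groupoid_def
  using is_groupoid_germ topspace_germ continuous_map_germ_mult continuous_map_germ_inv
  by (simp add: arrows_germ_groupoid gmult_germ_groupoid ginv_germ_groupoid)

subsection \<open>Spielberg's groupoid\<close>

lemma triplesD:
  assumes "(a, b, F) \<in> triples \<Lambda>"
  shows "a \<in> Mor \<Lambda>" "b \<in> Mor \<Lambda>" "F \<in> path_space \<Lambda>" "src \<Lambda> a = src \<Lambda> b" "src \<Lambda> b \<in> F" "src \<Lambda> a \<in> F"
  using assms by (auto simp: triples_def)

lemma triples_swap: "(a, b, F) \<in> triples \<Lambda> \<Longrightarrow> (b, a, F) \<in> triples \<Lambda>"
  by (auto simp: triples_def)

lemma src_in_Domain_tau: "a \<in> Mor \<Lambda> \<Longrightarrow> (src \<Lambda> a, a) \<in> tau \<Lambda> a"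
  by (simp add: in_tau_iff src_in_Mor rng_src cmp_src_self)

lemma tau_meets: "a \<in> Mor \<Lambda> \<Longrightarrow> src \<Lambda> a \<in> F \<Longrightarrow> F \<inter> Domain (tau \<Lambda> a) \<noteq> {}"
  using src_in_Domain_tau by blast

lemma sigma_meets: "a \<in> Mor \<Lambda> \<Longrightarrow> a \<in> F \<Longrightarrow> F \<inter> Domain (sigma \<Lambda> a) \<noteq> {}"
  using src_in_Domain_tau unfolding sigma_def by blast

lemma equivariant_sigma: "a \<in> Mor \<Lambda> \<Longrightarrow> equivariant (sigma \<Lambda> a)"
  by (simp add: sigma_def equivariant_tau equivariant_converse)

lemma equivariant_ts: "a \<in> Mor \<Lambda> \<Longrightarrow> b \<in> Mor \<Lambda> \<Longrightarrow> equivariant (ts a b)"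
  by (rule equivariant_comp[OF equivariant_tau equivariant_sigma])

lemma act_tau:
  "\<lbrakk>a \<in> Mor \<Lambda>; F \<in> path_space \<Lambda>; src \<Lambda> a \<in> F\<rbrakk> \<Longrightarrow> act \<Lambda> (tau \<Lambda> a) F = pact (tau \<Lambda> a) F"
  by (intro act_eq_pact inv_semigroup.tau tau_meets)

lemma act_sigma:
  "\<lbrakk>a \<in> Mor \<Lambda>; F \<in> path_space \<Lambda>; a \<in> F\<rbrakk> \<Longrightarrow> act \<Lambda> (sigma \<Lambda> a) F = pact (sigma \<Lambda> a) F"
  by (intro act_eq_pact inv_semigroup.sigma sigma_meets)

lemma pact_sigma_tau:
  "\<lbrakk>a \<in> Mor \<Lambda>; F \<in> path_space \<Lambda>; src \<Lambda> a \<in> F\<rbrakk> \<Longrightarrow> pact (sigma \<Lambda> a) (pact (tau \<Lambda> a) F) = F"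
  unfolding sigma_def by (intro pact_converse equivariant_tau tau_meets)

lemma pact_tau_sigma:
  "\<lbrakk>a \<in> Mor \<Lambda>; F \<in> path_space \<Lambda>; a \<in> F\<rbrakk> \<Longrightarrow> pact (tau \<Lambda> a) (pact (sigma \<Lambda> a) F) = F"
  using pact_converse[OF equivariant_sigma _ sigma_meets, of a F] by (simp add: sigma_def)

lemma mem_pact_tau: "a \<in> Mor \<Lambda> \<Longrightarrow> src \<Lambda> a \<in> F \<Longrightarrow> a \<in> pact (tau \<Lambda> a) F"
  by (rule pactI[OF equivariant_tau src_in_Domain_tau])

lemma src_mem_pact_sigma:
  assumes "a \<in> Mor \<Lambda>" "a \<in> F"
  shows "src \<Lambda> a \<in> pact (sigma \<Lambda> a) F"
  by (rule pactI[OF equivariant_sigma[OF assms(1)] _ assms(2)])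
    (simp add: sigma_def src_in_Domain_tau assms(1))

lemma path_tau: "\<lbrakk>a \<in> Mor \<Lambda>; F \<in> path_space \<Lambda>; src \<Lambda> a \<in> F\<rbrakk> \<Longrightarrow> pact (tau \<Lambda> a) F \<in> path_space \<Lambda>"
  by (intro pact_path_space equivariant_tau tau_meets)

lemma path_sigma: "\<lbrakk>a \<in> Mor \<Lambda>; F \<in> path_space \<Lambda>; a \<in> F\<rbrakk> \<Longrightarrow> pact (sigma \<Lambda> a) F \<in> path_space \<Lambda>"
  by (intro pact_path_space equivariant_sigma sigma_meets)

text \<open>Both \<open>tau\<close> and its converse preserve tightness. As
  \<open>pact (tau \<Lambda> b) F\<close> depends only on the class of \<open>(a, b, F)\<close>,
  tightness becomes a property of the class.\<close>

lemma tight_tau_iff: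
  assumes "a \<in> Mor \<Lambda>" "F \<in> path_space \<Lambda>" "src \<Lambda> a \<in> F"
  shows "pact (tau \<Lambda> a) F \<in> tight_paths \<Lambda> \<longleftrightarrow> F \<in> tight_paths \<Lambda>"
proof
  assume "pact (tau \<Lambda> a) F \<in> tight_paths \<Lambda>"
  then have "pact (sigma \<Lambda> a) (pact (tau \<Lambda> a) F) \<in> tight_paths \<Lambda>"
    by (rule pact_tight[OF equivariant_sigma[OF assms(1)] _
          sigma_meets[OF assms(1) mem_pact_tau[OF assms(1,3)]]])
  then show "F \<in> tight_paths \<Lambda>" using pact_sigma_tau[OF assms] by simp
next
  show "F \<in> tight_paths \<Lambda> \<Longrightarrow> pact (tau \<Lambda> a) F \<in> tight_paths \<Lambda>"
    by (rule pact_tight[OF equivariant_tau[OF assms(1)] _ tau_meets[OF assms(1,3)]])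
qed

lemma tau_comp:
  assumes "a \<in> Mor \<Lambda>" "c \<in> Mor \<Lambda>" "rng \<Lambda> c = src \<Lambda> a"
  shows "tau \<Lambda> a \<circ>\<^sub>p tau \<Lambda> c = tau \<Lambda> (a \<cdot> c)"
proof (intro equalityI subrelI)
  fix x y assume "(x, y) \<in> tau \<Lambda> a \<circ>\<^sub>p tau \<Lambda> c"
  then obtain z where "(x, z) \<in> tau \<Lambda> c" "(z, y) \<in> tau \<Lambda> a" by blast
  then show "(x, y) \<in> tau \<Lambda> (a \<cdot> c)"
    using assms by (simp add: in_tau_iff src_cmp cmp_assoc)
next
  fix x y assume "(x, y) \<in> tau \<Lambda> (a \<cdot> c)"
  then have "(x, c \<cdot> x) \<in> tau \<Lambda> c" "(c \<cdot> x, y) \<in> tau \<Lambda> a"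
    using assms by (simp_all add: in_tau_iff src_cmp rng_cmp cmp_in_Mor cmp_assoc)
  then show "(x, y) \<in> tau \<Lambda> a \<circ>\<^sub>p tau \<Lambda> c" by (rule relcompI)
qed

lemma pact_tau_cmp:
  assumes "a \<in> Mor \<Lambda>" "c \<in> Mor \<Lambda>" "rng \<Lambda> c = src \<Lambda> a"
  shows "pact (tau \<Lambda> (a \<cdot> c)) F = pact (tau \<Lambda> a) (pact (tau \<Lambda> c) F)"
  using pact_comp[OF equivariant_tau[OF assms(1)] equivariant_tau[OF assms(2)]] tau_comp[OF assms] by simp

text \<open>A morphism has the same range as each of its initial segments, and two members of a path
  have a common extension. Thus the single condition \<open>src \<Lambda> a \<in> F\<close> makes
  \<open>a \<cdot> x\<close> composable for every \<open>x\<close> in \<open>F\<close>.\<close>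

lemma path_rng_eq:
  assumes "F \<in> path_space \<Lambda>" "x \<in> F" "y \<in> F"
  shows "rng \<Lambda> x = rng \<Lambda> y"
proof -
  obtain c where "cat_le \<Lambda> x c" "cat_le \<Lambda> y c" using pathD(4)[OF assms] by blast
  then show ?thesis by (elim cat_leE) (metis rng_cmp)
qed

lemma path_mem_rng:
  assumes "F \<in> path_space \<Lambda>" "a \<in> Mor \<Lambda>" "src \<Lambda> a \<in> F" "x \<in> F"
  shows "rng \<Lambda> x = src \<Lambda> a"
  using path_rng_eq[OF assms(1,4,3)] rng_src[OF assms(2)] by simp

lemma cmp_mem_pact_tau:
  assumes "F \<in> path_space \<Lambda>" "a \<in> Mor \<Lambda>" "src \<Lambda> a \<in> F" "x \<in> F"
  shows "a \<cdot> x \<in> pact (tau \<Lambda> a) F"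
  by (rule pactI[OF equivariant_tau[OF assms(2)] _ assms(4)])
    (use assms pathD(2)[OF assms(1)] path_mem_rng[OF assms] in \<open>auto simp: in_tau_iff\<close>)

lemma mem_of_cmp_mem_pact_tau:
  assumes "F \<in> path_space \<Lambda>" "a \<in> Mor \<Lambda>" "src \<Lambda> a \<in> F" "x \<in> Mor \<Lambda>" "rng \<Lambda> x = src \<Lambda> a"
    "a \<cdot> x \<in> pact (tau \<Lambda> a) F"
  shows "x \<in> F"
proof -
  have "x \<in> pact (sigma \<Lambda> a) (pact (tau \<Lambda> a) F)"
    by (rule pactI[OF equivariant_sigma[OF assms(2)] _ assms(6)]) (simp add: in_sigma_iff assms)
  then show ?thesis using pact_sigma_tau[OF assms(2,1,3)] by simp
qed

text \<open>The right-hand side depends only on the product \<open>a \<cdot> x\<close> and the path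
  \<open>pact (tau \<Lambda> a) F\<close>. So triples that share this path and a factored point of
  it have the same refinement.\<close>

lemma pact_sigma_cmp:
  assumes F: "F \<in> path_space \<Lambda>" and a: "a \<in> Mor \<Lambda>" "src \<Lambda> a \<in> F" and x: "x \<in> F"
  shows "pact (sigma \<Lambda> x) F = pact (sigma \<Lambda> (a \<cdot> x)) (pact (tau \<Lambda> a) F)"
proof -
  have xM: "x \<in> Mor \<Lambda>" and r: "rng \<Lambda> x = src \<Lambda> a"
    using x pathD(2)[OF F] path_mem_rng[OF F a x] by auto
  have "sigma \<Lambda> (a \<cdot> x) = sigma \<Lambda> x \<circ>\<^sub>p sigma \<Lambda> a"
    unfolding sigma_def tau_comp[OF a(1) xM r, symmetric] converse_relcomp ..
  then have "pact (sigma \<Lambda> (a \<cdot> x)) (pact (tau \<Lambda> a) F) =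
      pact (sigma \<Lambda> x) (pact (sigma \<Lambda> a) (pact (tau \<Lambda> a) F))"
    using pact_comp[OF equivariant_sigma[OF xM] equivariant_sigma[OF a(1)]] by simp
  then show ?thesis using pact_sigma_tau[OF a(1) F a(2)] by simp
qed

text \<open>Spielberg's equivalence is germ equality in disguise: the common refinement \<open>G\<close> is
  \<open>\<sigma>\<^sup>\<epsilon> \<cdot> T\<close>, where \<open>T = \<tau>\<^sup>\<beta> \<cdot> F\<close> and \<open>\<epsilon> \<in> T\<close> is a point at which the two partial maps
  agree.\<close>

lemma triple_rel_iff:
  "((a, b, F), (a', b', F')) \<in> triple_rel \<Lambda> \<longleftrightarrow>
     (a, b, F) \<in> triples \<Lambda> \<and> (a', b', F') \<in> triples \<Lambda> \<and>
     pact (tau \<Lambda> b) F = pact (tau \<Lambda> b') F' \<and> agree (pact (tau \<Lambda> b) F) (ts a b) (ts a' b')"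
  (is "?L \<longleftrightarrow> _ \<and> _ \<and> ?R")
proof -
  have "?L \<longleftrightarrow> ?R" if t: "(a, b, F) \<in> triples \<Lambda>" and t': "(a', b', F') \<in> triples \<Lambda>"
  proof
    note d = triplesD[OF t] and d' = triplesD[OF t']
    assume ?L
    then obtain G c c' where G: "G \<in> path_space \<Lambda>" and c: "c \<in> Mor \<Lambda>" "src \<Lambda> c \<in> G" "rng \<Lambda> c = src \<Lambda> a"
      "F = act \<Lambda> (tau \<Lambda> c) G"
      and c': "c' \<in> Mor \<Lambda>" "src \<Lambda> c' \<in> G" "rng \<Lambda> c' = src \<Lambda> a'" "F' = act \<Lambda> (tau \<Lambda> c') G"
      and eq: "a \<cdot> c = a' \<cdot> c'" "b \<cdot> c = b' \<cdot> c'"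
      unfolding triple_rel_def by blast
    have F: "F = pact (tau \<Lambda> c) G" using c(4) act_tau[OF c(1) G c(2)] by simp
    have F': "F' = pact (tau \<Lambda> c') G" using c'(4) act_tau[OF c'(1) G c'(2)] by simp
    have T: "pact (tau \<Lambda> b) F = pact (tau \<Lambda> (b \<cdot> c)) G"
      unfolding F using pact_tau_cmp[OF d(2) c(1)] c(3) d(4) by simp
    have T': "pact (tau \<Lambda> b') F' = pact (tau \<Lambda> (b' \<cdot> c')) G"
      unfolding F' using pact_tau_cmp[OF d'(2) c'(1)] c'(3) d'(4) by simp
    have bc: "b \<cdot> c \<in> Mor \<Lambda>" "src \<Lambda> (b \<cdot> c) = src \<Lambda> c"
      using cmp_in_Mor[OF d(2) c(1)] src_cmp[OF d(2) c(1)] c(3) d(4) by auto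
    have "b \<cdot> c \<in> pact (tau \<Lambda> b) F" unfolding T by (rule mem_pact_tau) (use bc c in auto)
    moreover have "(b \<cdot> c, a \<cdot> c) \<in> ts a b" using in_ts_iff c(1,3) d(4) by auto
    moreover have "(b \<cdot> c, a \<cdot> c) \<in> ts a' b'" unfolding eq using in_ts_iff c'(1,3) d'(4) by auto
    ultimately show ?R using T T' eq agreeI by simp
  next
    note d = triplesD[OF t] and d' = triplesD[OF t']
    assume R: ?R
    obtain e y where e: "e \<in> pact (tau \<Lambda> b) F" "(e, y) \<in> ts a b" "(e, y) \<in> ts a' b'"
      using agreeE[OF conjunct2[OF R]] by blast
    obtain c where c: "c \<in> Mor \<Lambda>" "rng \<Lambda> c = src \<Lambda> b" "e = b \<cdot> c" "y = a \<cdot> c"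
      using e(2) unfolding in_ts_iff by blast
    obtain c' where c': "c' \<in> Mor \<Lambda>" "rng \<Lambda> c' = src \<Lambda> b'" "e = b' \<cdot> c'" "y = a' \<cdot> c'"
      using e(3) unfolding in_ts_iff by blast
    have cF: "c \<in> F" using mem_of_cmp_mem_pact_tau[OF d(3,2,5) c(1,2)] e(1) c(3) by simp
    have cF': "c' \<in> F'" using mem_of_cmp_mem_pact_tau[OF d'(3,2,5) c'(1,2)] e(1) c'(3) R by simp
    define G where "G = pact (sigma \<Lambda> c) F"
    have G': "G = pact (sigma \<Lambda> c') F'"
      unfolding G_def pact_sigma_cmp[OF d(3,2,5) cF] pact_sigma_cmp[OF d'(3,2,5) cF']
      using c(3) c'(3) R by simp
    have GP: "G \<in> path_space \<Lambda>" unfolding G_def by (rule path_sigma[OF c(1) d(3) cF])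
    have s: "src \<Lambda> c \<in> G" unfolding G_def by (rule src_mem_pact_sigma[OF c(1) cF])
    have s': "src \<Lambda> c' \<in> G" unfolding G' by (rule src_mem_pact_sigma[OF c'(1) cF'])
    have F: "F = act \<Lambda> (tau \<Lambda> c) G"
      unfolding act_tau[OF c(1) GP s] unfolding G_def by (rule pact_tau_sigma[OF c(1) d(3) cF, symmetric])
    have F': "F' = act \<Lambda> (tau \<Lambda> c') G"
      unfolding act_tau[OF c'(1) GP s'] unfolding G' by (rule pact_tau_sigma[OF c'(1) d'(3) cF', symmetric])
    have "a \<cdot> c = a' \<cdot> c'" "b \<cdot> c = b' \<cdot> c'" "rng \<Lambda> c = src \<Lambda> a" "rng \<Lambda> c' = src \<Lambda> a'"
      using c c' d(4) d'(4) by auto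
    then show ?L
      unfolding triple_rel_def using t t' GP c(1) c'(1) s s' F F' by blast
  qed
  moreover have "?L \<Longrightarrow> (a, b, F) \<in> triples \<Lambda> \<and> (a', b', F') \<in> triples \<Lambda>"
    unfolding triple_rel_def by blast
  ultimately show ?thesis by blast
qed

lemma agree_ts_self:
  assumes "(a, b, F) \<in> triples \<Lambda>"
  shows "agree (pact (tau \<Lambda> b) F) (ts a b) (ts a b)"
  using agreeI[OF mem_pact_tau ts_self ts_self] triplesD[OF assms] by blast

lemma equiv_triple_rel: "equiv (triples \<Lambda>) (triple_rel \<Lambda>)"
proof (rule equivI)
  show "triple_rel \<Lambda> \<subseteq> triples \<Lambda> \<times> triples \<Lambda>"
    unfolding triple_rel_def by blast
  show "refl_on (triples \<Lambda>) (triple_rel \<Lambda>)"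
  proof (rule refl_onI)
    fix p assume p: "p \<in> triples \<Lambda>"
    obtain a b F where "p = (a, b, F)" by (metis surj_pair)
    then show "(p, p) \<in> triple_rel \<Lambda>" using p agree_ts_self by (simp add: triple_rel_iff)
  qed
  show "sym (triple_rel \<Lambda>)"
    unfolding sym_def split_paired_All triple_rel_iff by (auto intro: agree_sym)
  show "trans (triple_rel \<Lambda>)"
  proof (rule transI)
    fix p q r assume pqr: "(p, q) \<in> triple_rel \<Lambda>" "(q, r) \<in> triple_rel \<Lambda>"
    obtain a b F a' b' F' a'' b'' F'' where p: "p = (a, b, F)" "q = (a', b', F')" "r = (a'', b'', F'')"
      by (metis surj_pair)
    have t: "(a, b, F) \<in> triples \<Lambda>" "(a', b', F') \<in> triples \<Lambda>" "(a'', b'', F'') \<in> triples \<Lambda>"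
      and T: "pact (tau \<Lambda> b) F = pact (tau \<Lambda> b') F'" "pact (tau \<Lambda> b') F' = pact (tau \<Lambda> b'') F''"
      and ag: "agree (pact (tau \<Lambda> b) F) (ts a b) (ts a' b')"
        "agree (pact (tau \<Lambda> b) F) (ts a' b') (ts a'' b'')"
      using pqr unfolding p triple_rel_iff by auto
    note d = triplesD[OF t(1)] and d' = triplesD[OF t(2)] and d'' = triplesD[OF t(3)]
    have "agree (pact (tau \<Lambda> b) F) (ts a b) (ts a'' b'')"
      by (rule agree_trans[OF equivariant_ts[OF d(1,2)] equivariant_ts[OF d'(1,2)]
            equivariant_ts[OF d''(1,2)] path_tau[OF d(2,3,5)] ag])
    then show "(p, r) \<in> triple_rel \<Lambda>" unfolding p triple_rel_iff using t T by simp
  qed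
qed

lemma spiel_class_eq_iff:
  assumes "(a, b, F) \<in> triples \<Lambda>" "(a', b', F') \<in> triples \<Lambda>"
  shows "spiel_class \<Lambda> a b F = spiel_class \<Lambda> a' b' F' \<longleftrightarrow>
    pact (tau \<Lambda> b) F = pact (tau \<Lambda> b') F' \<and> agree (pact (tau \<Lambda> b) F) (ts a b) (ts a' b')"
  unfolding spiel_class_def eq_equiv_class_iff[OF equiv_triple_rel assms] triple_rel_iff
  using assms by simp

section \<open>Boundary arrows and the map \<Phi>\<close>

definition btriples :: "('a \<times> 'a \<times> 'a set) set" where
  "btriples = {(a, b, F) \<in> triples \<Lambda>. F \<in> tight_paths \<Lambda>}"

definition barrows :: "'a spiel set" where
  "barrows = {spiel_class \<Lambda> \<alpha> \<beta> F | \<alpha> \<beta> F. (\<alpha>, \<beta>, F) \<in> triples \<Lambda> \<and> F \<in> tight_paths \<Lambda>}"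

lemma btriples_iff: "(a, b, F) \<in> btriples \<longleftrightarrow> (a, b, F) \<in> triples \<Lambda> \<and> F \<in> tight_paths \<Lambda>"
  by (simp add: btriples_def)

lemma in_barrows_iff: "x \<in> barrows \<longleftrightarrow> (\<exists>a b F. (a, b, F) \<in> btriples \<and> x = spiel_class \<Lambda> a b F)"
  by (auto simp: barrows_def btriples_iff)

lemma btriples_swap: "(a, b, F) \<in> btriples \<Longrightarrow> (b, a, F) \<in> btriples"
  using triples_swap by (simp add: btriples_iff)

text \<open>A boundary class is given by one tight representative; by \<open>tight_tau_iff\<close>
  all its representatives are tight. This matters because product and inverse range over arbitrary
  triples.\<close>

lemma btriple_rep:
  assumes "(a, b, F) \<in> triples \<Lambda>" "spiel_class \<Lambda> a b F \<in> barrows"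
  shows "(a, b, F) \<in> btriples"
proof -
  obtain a' b' F' where t': "(a', b', F') \<in> triples \<Lambda>" "F' \<in> tight_paths \<Lambda>"
    "spiel_class \<Lambda> a b F = spiel_class \<Lambda> a' b' F'"
    using assms(2) unfolding in_barrows_iff btriples_iff by blast
  have "pact (tau \<Lambda> b) F = pact (tau \<Lambda> b') F'" using spiel_class_eq_iff[OF assms(1) t'(1)] t'(3) by blast
  then show ?thesis
    using tight_tau_iff triplesD[OF assms(1)] triplesD[OF t'(1)] t'(2) assms(1)
    by (metis btriples_iff)
qed

lemma btriple_germ_pairs:
  assumes "(a, b, F) \<in> btriples"
  shows "(ts a b, pact (tau \<Lambda> b) F) \<in> germ_pairs \<Lambda>"
proof -
  have t: "(a, b, F) \<in> triples \<Lambda>" "F \<in> tight_paths \<Lambda>" using assms by (auto simp: btriples_iff)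
  note d = triplesD[OF t(1)]
  have "b \<in> pact (tau \<Lambda> b) F" by (rule mem_pact_tau[OF d(2,5)])
  moreover have "(b, a) \<in> ts a b" by (rule ts_self[OF d(1,2,4)])
  ultimately have "pact (tau \<Lambda> b) F \<inter> Domain (ts a b) \<noteq> {}" by blast
  moreover have "pact (tau \<Lambda> b) F \<in> tight_paths \<Lambda>" using tight_tau_iff[OF d(2,3,5)] t(2) by blast
  ultimately show ?thesis unfolding germ_pairs_iff using ts_inv_semigroup[OF d(1,2)] by (intro conjI)
qed

definition phi :: "'a spiel \<Rightarrow> 'a germ" where
  "phi x = (THE z. \<exists>a b F. (a, b, F) \<in> btriples \<and> x = spiel_class \<Lambda> a b F \<and>
     z = germ \<Lambda> (ts a b) (pact (tau \<Lambda> b) F))"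

text \<open>Both equalities have been reduced to the same condition: the paths
  \<open>pact (tau \<Lambda> b) F\<close> and \<open>pact (tau \<Lambda> b') F'\<close> coincide and
  the two elementary maps agree there. One direction makes \<open>phi\<close> well defined, the
  other makes it injective.\<close>

lemma class_eq_iff_germ_eq:
  assumes "(a, b, F) \<in> btriples" "(a', b', F') \<in> btriples"
  shows "spiel_class \<Lambda> a b F = spiel_class \<Lambda> a' b' F' \<longleftrightarrow>
    germ \<Lambda> (ts a b) (pact (tau \<Lambda> b) F) = germ \<Lambda> (ts a' b') (pact (tau \<Lambda> b') F')"
  using spiel_class_eq_iff germ_eq_iff[OF assms[THEN btriple_germ_pairs]] assms
  unfolding btriples_iff by blast

lemma phi_class:
  assumes "(a, b, F) \<in> btriples"
  shows "phi (spiel_class \<Lambda> a b F) = germ \<Lambda> (ts a b) (pact (tau \<Lambda> b) F)"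
  unfolding phi_def using class_eq_iff_germ_eq assms by (intro the_equality) blast+

lemma phi_inj:
  assumes "x \<in> barrows" "y \<in> barrows" "phi x = phi y"
  shows "x = y"
proof -
  obtain a b F where x: "(a, b, F) \<in> btriples" "x = spiel_class \<Lambda> a b F"
    using assms(1) in_barrows_iff by blast
  obtain a' b' F' where y: "(a', b', F') \<in> btriples" "y = spiel_class \<Lambda> a' b' F'"
    using assms(2) in_barrows_iff by blast
  show ?thesis using class_eq_iff_germ_eq[OF x(1) y(1)] assms(3) x y phi_class by simp
qed

text \<open>This is the inverse of \<Phi> on representatives: every point \<open>x\<close> of the
  path \<open>T\<close> with value \<open>y\<close> under \<open>s\<close> yields a triple, and
  \<open>tau\<close> at \<open>x\<close> carries the third component back to
  \<open>T\<close>.\<close>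

lemma germ_eq_ts:
  assumes "(s, T) \<in> germ_pairs \<Lambda>" "x \<in> T" "(x, y) \<in> s"
  shows "(y, x, pact (sigma \<Lambda> x) T) \<in> btriples"
    "germ \<Lambda> s T = germ \<Lambda> (ts y x) (pact (tau \<Lambda> x) (pact (sigma \<Lambda> x) T))"
proof -
  note s' = germ_pairsD[OF assms(1)]
  note xy = equivariantD[OF s'(2) assms(3)]
  show bt: "(y, x, pact (sigma \<Lambda> x) T) \<in> btriples"
    unfolding btriples_iff triples_def
    using xy(1,2,3) path_sigma[OF xy(1) s'(4) assms(2)] src_mem_pact_sigma[OF xy(1) assms(2)]
      pact_tight[OF equivariant_sigma[OF xy(1)] s'(3) sigma_meets[OF xy(1) assms(2)]] by simp
  have T: "pact (tau \<Lambda> x) (pact (sigma \<Lambda> x) T) = T" by (rule pact_tau_sigma[OF xy(1) s'(4) assms(2)])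
  have p: "(ts y x, T) \<in> germ_pairs \<Lambda>" using btriple_germ_pairs[OF bt] T by simp
  show "germ \<Lambda> s T = germ \<Lambda> (ts y x) (pact (tau \<Lambda> x) (pact (sigma \<Lambda> x) T))"
    unfolding T
    by (rule germ_eqI[OF assms(1) p agreeI[OF assms(2,3) ts_self[OF xy(2,1) xy(3)[symmetric]]]])
qed

lemma phi_bij: "bij_betw phi barrows (germ_pairs \<Lambda> // germ_rel \<Lambda>)"
  unfolding bij_betw_def
proof
  show "inj_on phi barrows" using phi_inj by (rule inj_onI)
  show "phi ` barrows = germ_pairs \<Lambda> // germ_rel \<Lambda>"
  proof
    show "phi ` barrows \<subseteq> germ_pairs \<Lambda> // germ_rel \<Lambda>"
    proof
      fix z assume "z \<in> phi ` barrows"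
      then obtain x where x: "x \<in> barrows" "z = phi x" by (rule imageE)
      obtain a b F where t: "(a, b, F) \<in> btriples" "x = spiel_class \<Lambda> a b F"
        using x(1) unfolding in_barrows_iff by blast
      show "z \<in> germ_pairs \<Lambda> // germ_rel \<Lambda>"
        unfolding in_germs_iff x(2) t(2) phi_class[OF t(1)] using btriple_germ_pairs[OF t(1)] by blast
    qed
    show "germ_pairs \<Lambda> // germ_rel \<Lambda> \<subseteq> phi ` barrows"
    proof
      fix z assume "z \<in> germ_pairs \<Lambda> // germ_rel \<Lambda>"
      then obtain s T where s: "(s, T) \<in> germ_pairs \<Lambda>" "z = germ \<Lambda> s T" using in_germs_iff by blast
      obtain x y where xy: "x \<in> T" "(x, y) \<in> s" using germ_pairsD(5)[OF s(1)] by blast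
      have "z = phi (spiel_class \<Lambda> y x (pact (sigma \<Lambda> x) T))"
        using germ_eq_ts[OF s(1) xy] phi_class s(2) by simp
      then show "z \<in> phi ` barrows" using germ_eq_ts(1)[OF s(1) xy] in_barrows_iff by blast
    qed
  qed
qed

section \<open>Compatibility of \<Phi> with the operations\<close>

lemma pact_ts:
  assumes "(a, b, F) \<in> triples \<Lambda>"
  shows "pact (ts a b) (pact (tau \<Lambda> b) F) = pact (tau \<Lambda> a) F"
  using pact_comp[OF equivariant_tau equivariant_sigma] pact_sigma_tau triplesD[OF assms] by simp

text \<open>By \<open>pact_ts\<close> the second germ has range
  \<open>pact (tau \<Lambda> c) G\<close>, so composability of germs is literally Spielberg's
  condition.\<close>

lemma phi_composable:
  assumes "(a, b, F) \<in> btriples" "(c, d, G) \<in> btriples"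
  shows "(phi (spiel_class \<Lambda> a b F), phi (spiel_class \<Lambda> c d G)) \<in> composable (germ_groupoid \<Lambda>) \<longleftrightarrow>
    pact (tau \<Lambda> b) F = pact (tau \<Lambda> c) G"
  unfolding phi_class[OF assms(1)] phi_class[OF assms(2)]
    germ_composable_iff[OF assms[THEN btriple_germ_pairs]]
  using pact_ts[of c d G] assms(2) by (simp add: btriples_iff)

lemma spiel_composable_iff:
  assumes "(a, b, F) \<in> triples \<Lambda>" "(c, d, G) \<in> triples \<Lambda>"
  shows "act \<Lambda> (tau \<Lambda> b) F = act \<Lambda> (tau \<Lambda> c) G \<longleftrightarrow> pact (tau \<Lambda> b) F = pact (tau \<Lambda> c) G"
  using act_tau triplesD[OF assms(1)] triplesD[OF assms(2)] by simp

text \<open>Follow one point: \<open>ts c d\<close> sends \<open>d \<cdot> l\<close> to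
  \<open>c \<cdot> l = b \<cdot> k\<close>, and \<open>ts a b\<close> sends this to
  \<open>a \<cdot> k\<close>. The elementary map of the product triple also sends
  \<open>d \<cdot> l\<close> to \<open>a \<cdot> k\<close>, and \<open>d \<cdot> l\<close> lies on
  the path of the product germ, so the germs are equal.\<close>

lemma spiel_product:
  assumes x: "(a, b, F) \<in> btriples" and y: "(c, d, G) \<in> btriples"
    and T: "pact (tau \<Lambda> b) F = pact (tau \<Lambda> c) G"
    and k: "k \<in> F" and l: "l \<in> G" and eq: "b \<cdot> k = c \<cdot> l"
  shows "(a \<cdot> k, d \<cdot> l, pact (sigma \<Lambda> k) F) \<in> btriples" (is ?tr)
    and "pact (sigma \<Lambda> k) F = pact (sigma \<Lambda> l) G" (is ?H)
    and "phi (spiel_class \<Lambda> (a \<cdot> k) (d \<cdot> l) (pact (sigma \<Lambda> k) F)) =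
      germ_mult \<Lambda> (phi (spiel_class \<Lambda> a b F)) (phi (spiel_class \<Lambda> c d G))"
proof -
  have tx: "(a, b, F) \<in> triples \<Lambda>" "F \<in> tight_paths \<Lambda>" and ty: "(c, d, G) \<in> triples \<Lambda>" "G \<in> tight_paths \<Lambda>"
    using x y by (auto simp: btriples_iff)
  note dx = triplesD[OF tx(1)] and dy = triplesD[OF ty(1)]
  have kM: "k \<in> Mor \<Lambda>" and lM: "l \<in> Mor \<Lambda>" using k l pathD(2) dx(3) dy(3) by auto
  have rk: "rng \<Lambda> k = src \<Lambda> b" "src \<Lambda> b = rng \<Lambda> k" "src \<Lambda> a = rng \<Lambda> k"
    and rl: "rng \<Lambda> l = src \<Lambda> d" "src \<Lambda> c = rng \<Lambda> l" "src \<Lambda> d = rng \<Lambda> l"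
    using path_mem_rng[OF dx(3,2,5) k] path_mem_rng[OF dy(3,2,5) l] dx(4) dy(4) by auto
  have "src \<Lambda> (b \<cdot> k) = src \<Lambda> (c \<cdot> l)" using eq by simp
  then have src: "src \<Lambda> k = src \<Lambda> l"
    using src_cmp[OF dx(2) kM rk(2)] src_cmp[OF dy(1) lM rl(2)] by simp
  show H: ?H
    unfolding pact_sigma_cmp[OF dx(3,2,5) k] pact_sigma_cmp[OF dy(3,1,6) l] T eq ..
  have "pact (sigma \<Lambda> k) F \<in> tight_paths \<Lambda>"
    by (rule pact_tight[OF equivariant_sigma[OF kM] tx(2) sigma_meets[OF kM k]])
  then show bt: ?tr
    unfolding btriples_iff triples_def
    using path_sigma[OF kM dx(3) k] src_mem_pact_sigma[OF kM k] src
      cmp_in_Mor[OF dx(1) kM rk(3)] cmp_in_Mor[OF dy(2) lM rl(3)]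
      src_cmp[OF dx(1) kM rk(3)] src_cmp[OF dy(2) lM rl(3)] by simp
  let ?K = "pact (tau \<Lambda> d) G"
  have K: "pact (tau \<Lambda> (d \<cdot> l)) (pact (sigma \<Lambda> k) F) = ?K"
    unfolding H pact_tau_cmp[OF dy(2) lM rl(1)] pact_tau_sigma[OF lM dy(3) l] ..
  note gx = btriple_germ_pairs[OF x] and gy = btriple_germ_pairs[OF y] and gz = btriple_germ_pairs[OF bt]
  have TK: "pact (tau \<Lambda> b) F = pact (ts c d) ?K" using T pact_ts[OF ty(1)] by simp
  have gx': "(ts a b, pact (ts c d) ?K) \<in> germ_pairs \<Lambda>" using gx TK by simp
  have "germ_mult \<Lambda> (phi (spiel_class \<Lambda> a b F)) (phi (spiel_class \<Lambda> c d G)) =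
      germ \<Lambda> (ts a b \<circ>\<^sub>p ts c d) ?K"
    unfolding phi_class[OF x] phi_class[OF y] TK by (rule germ_mult_germ[OF gy gx'])
  moreover have "germ \<Lambda> (ts (a \<cdot> k) (d \<cdot> l)) ?K = germ \<Lambda> (ts a b \<circ>\<^sub>p ts c d) ?K"
  proof (rule germ_eqI)
    show "(ts (a \<cdot> k) (d \<cdot> l), ?K) \<in> germ_pairs \<Lambda>" using gz K by simp
    show "(ts a b \<circ>\<^sub>p ts c d, ?K) \<in> germ_pairs \<Lambda>" by (rule germ_pairs_comp[OF gy gx'])
    have 1: "d \<cdot> l \<in> ?K" by (rule cmp_mem_pact_tau[OF dy(3,2,5) l])
    have 2: "(d \<cdot> l, a \<cdot> k) \<in> ts (a \<cdot> k) (d \<cdot> l)"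
      using ts_self triplesD[of "a \<cdot> k" "d \<cdot> l"] bt unfolding btriples_iff by blast
    have 3: "(d \<cdot> l, c \<cdot> l) \<in> ts c d" unfolding in_ts_iff using lM rl by auto
    have 4: "(c \<cdot> l, a \<cdot> k) \<in> ts a b" unfolding in_ts_iff eq[symmetric] using kM rk by auto
    show "agree ?K (ts (a \<cdot> k) (d \<cdot> l)) (ts a b \<circ>\<^sub>p ts c d)"
      by (rule agreeI[OF 1 2 relcompI[OF 3 4]])
  qed
  ultimately show "phi (spiel_class \<Lambda> (a \<cdot> k) (d \<cdot> l) (pact (sigma \<Lambda> k) F)) =
      germ_mult \<Lambda> (phi (spiel_class \<Lambda> a b F)) (phi (spiel_class \<Lambda> c d G))"
    unfolding phi_class[OF bt] K by simp
qed

text \<open>Uniqueness in the definite description is not proved on triples: every candidate has the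
  product of the two germs as its image, and \<open>phi\<close> is injective on the
  boundary.\<close>

lemma phi_mult:
  assumes x: "(a, b, F) \<in> btriples" and y: "(c, d, G) \<in> btriples"
    and T: "pact (tau \<Lambda> b) F = pact (tau \<Lambda> c) G"
  defines "m \<equiv> spiel_mult \<Lambda> (spiel_class \<Lambda> a b F) (spiel_class \<Lambda> c d G)"
  shows "m \<in> barrows"
    and "phi m = germ_mult \<Lambda> (phi (spiel_class \<Lambda> a b F)) (phi (spiel_class \<Lambda> c d G))"
proof -
  let ?x = "spiel_class \<Lambda> a b F" and ?y = "spiel_class \<Lambda> c d G"
  let ?Q = "\<lambda>z. \<exists>\<alpha> \<beta> F \<gamma> \<delta> G \<xi> \<eta> H.
     (\<alpha>, \<beta>, F) \<in> triples \<Lambda> \<and> (\<gamma>, \<delta>, G) \<in> triples \<Lambda> \<and>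
     ?x = spiel_class \<Lambda> \<alpha> \<beta> F \<and> ?y = spiel_class \<Lambda> \<gamma> \<delta> G \<and>
     act \<Lambda> (tau \<Lambda> \<beta>) F = act \<Lambda> (tau \<Lambda> \<gamma>) G \<and>
     \<xi> \<in> F \<and> \<eta> \<in> G \<and> \<beta> \<cdot> \<xi> = \<gamma> \<cdot> \<eta> \<and>
     H = act \<Lambda> (sigma \<Lambda> \<xi>) F \<and> H = act \<Lambda> (sigma \<Lambda> \<eta>) G \<and>
     z = spiel_class \<Lambda> (\<alpha> \<cdot> \<xi>) (\<delta> \<cdot> \<eta>) H"
  have xb: "?x \<in> barrows" and yb: "?y \<in> barrows" using x y in_barrows_iff by blast+
  have Q: "z \<in> barrows \<and> phi z = germ_mult \<Lambda> (phi ?x) (phi ?y)" if Qz: "?Q z" for z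
  proof -
    obtain \<alpha> \<beta> F' \<gamma> \<delta> G' \<xi> \<eta> H where
      t: "(\<alpha>, \<beta>, F') \<in> triples \<Lambda>" "(\<gamma>, \<delta>, G') \<in> triples \<Lambda>" and
      xy: "?x = spiel_class \<Lambda> \<alpha> \<beta> F'" "?y = spiel_class \<Lambda> \<gamma> \<delta> G'" and
      act: "act \<Lambda> (tau \<Lambda> \<beta>) F' = act \<Lambda> (tau \<Lambda> \<gamma>) G'" and
      k: "\<xi> \<in> F'" "\<eta> \<in> G'" "\<beta> \<cdot> \<xi> = \<gamma> \<cdot> \<eta>" and
      z: "H = act \<Lambda> (sigma \<Lambda> \<xi>) F'" "z = spiel_class \<Lambda> (\<alpha> \<cdot> \<xi>) (\<delta> \<cdot> \<eta>) H"
      using Qz by blast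
    have b: "(\<alpha>, \<beta>, F') \<in> btriples" "(\<gamma>, \<delta>, G') \<in> btriples"
      using btriple_rep t xy xb yb by auto
    have T': "pact (tau \<Lambda> \<beta>) F' = pact (tau \<Lambda> \<gamma>) G'" using act spiel_composable_iff[OF t] by simp
    have F': "F' \<in> path_space \<Lambda>" "\<xi> \<in> Mor \<Lambda>" using triplesD(3)[OF t(1)] pathD(2) k(1) by auto
    have H: "H = pact (sigma \<Lambda> \<xi>) F'" using z(1) act_sigma[OF F'(2,1) k(1)] by simp
    note p = spiel_product[OF b T' k]
    show ?thesis using p(1,3) in_barrows_iff unfolding z(2) H xy by blast
  qed
  have "\<exists>z. ?Q z"
  proof -
    have t: "(a, b, F) \<in> triples \<Lambda>" "(c, d, G) \<in> triples \<Lambda>" using x y by (auto simp: btriples_iff)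
    note dx = triplesD[OF t(1)] and dy = triplesD[OF t(2)]
    \<comment> \<open>For existence, \<open>b\<close> and \<open>c\<close> both lie in the common
      path, so they have a common extension there. Its two factorizations supply the required pair,
      and cancelling \<open>b\<close> and \<open>c\<close> puts the factors into \<open>F\<close>
      and \<open>G\<close>.\<close>
    have bT: "b \<in> pact (tau \<Lambda> b) F" by (rule mem_pact_tau[OF dx(2,5)])
    have cT: "c \<in> pact (tau \<Lambda> b) F" unfolding T by (rule mem_pact_tau[OF dy(1,6)])
    obtain e where e: "e \<in> pact (tau \<Lambda> b) F" "cat_le \<Lambda> b e" "cat_le \<Lambda> c e"
      using pathD(4)[OF path_tau[OF dx(2,3,5)] bT cT] by blast
    obtain k where k: "k \<in> Mor \<Lambda>" "rng \<Lambda> k = src \<Lambda> b" "e = b \<cdot> k" using e(2) by (rule cat_leE)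
    obtain l where l: "l \<in> Mor \<Lambda>" "rng \<Lambda> l = src \<Lambda> c" "e = c \<cdot> l" using e(3) by (rule cat_leE)
    have kF: "k \<in> F" using mem_of_cmp_mem_pact_tau[OF dx(3,2,5) k(1,2)] e(1) k(3) by simp
    have lG: "l \<in> G" using mem_of_cmp_mem_pact_tau[OF dy(3,1,6) l(1,2)] e(1) l(3) T by simp
    have eq: "b \<cdot> k = c \<cdot> l" using k(3) l(3) by simp
    have "pact (sigma \<Lambda> k) F = pact (sigma \<Lambda> l) G" by (rule spiel_product(2)[OF x y T kF lG eq])
    then have "act \<Lambda> (sigma \<Lambda> k) F = act \<Lambda> (sigma \<Lambda> l) G"
      using act_sigma[OF k(1) dx(3) kF] act_sigma[OF l(1) dy(3) lG] by simp
    moreover have "act \<Lambda> (tau \<Lambda> b) F = act \<Lambda> (tau \<Lambda> c) G" using spiel_composable_iff[OF t] T by simp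
    ultimately show ?thesis using t kF lG eq by blast
  qed
  then obtain z where z: "?Q z" by blast
  have "m = z"
    unfolding m_def spiel_mult_def
  proof (rule the_equality)
    show "?Q z" by (rule z)
    show "w = z" if "?Q w" for w using Q[OF that] Q[OF z] phi_inj by metis
  qed
  then show "m \<in> barrows" "phi m = germ_mult \<Lambda> (phi ?x) (phi ?y)" using Q[OF z] by auto
qed

text \<open>The converse of \<open>ts a b\<close> is \<open>ts b a\<close>, and
  \<open>ts a b\<close> carries \<open>pact (tau \<Lambda> b) F\<close> to
  \<open>pact (tau \<Lambda> a) F\<close>; so exchanging the first two entries inverts the germ.
  Injectivity of \<open>phi\<close> again removes the choice of representative.\<close>

lemma phi_inv:
  assumes x: "(a, b, F) \<in> btriples"
  defines "i \<equiv> spiel_inv \<Lambda> (spiel_class \<Lambda> a b F)"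
  shows "i \<in> barrows" and "phi i = germ_inv \<Lambda> (phi (spiel_class \<Lambda> a b F))"
proof -
  have *: "spiel_class \<Lambda> b' a' F' \<in> barrows \<and>
      phi (spiel_class \<Lambda> b' a' F') = germ_inv \<Lambda> (phi (spiel_class \<Lambda> a' b' F'))"
    if t: "(a', b', F') \<in> btriples" for a' b' F'
  proof -
    have "germ_inv \<Lambda> (phi (spiel_class \<Lambda> a' b' F')) =
        germ \<Lambda> ((ts a' b')\<inverse>) (pact (ts a' b') (pact (tau \<Lambda> b') F'))"
      unfolding phi_class[OF t] by (rule germ_inv_germ[OF btriple_germ_pairs[OF t]])
    also have "\<dots> = germ \<Lambda> (ts b' a') (pact (tau \<Lambda> a') F')"
      using pact_ts[of a' b' F'] t unfolding ts_converse by (simp add: btriples_iff)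
    also have "\<dots> = phi (spiel_class \<Lambda> b' a' F')" using phi_class[OF btriples_swap[OF t]] by simp
    finally show ?thesis using btriples_swap[OF t] in_barrows_iff by auto
  qed
  have xb: "spiel_class \<Lambda> a b F \<in> barrows" using x in_barrows_iff by blast
  have "i = spiel_class \<Lambda> b a F"
    unfolding i_def spiel_inv_def
  proof (rule the_equality)
    show "\<exists>\<alpha> \<beta> F'. (\<alpha>, \<beta>, F') \<in> triples \<Lambda> \<and> spiel_class \<Lambda> a b F = spiel_class \<Lambda> \<alpha> \<beta> F' \<and>
        spiel_class \<Lambda> b a F = spiel_class \<Lambda> \<beta> \<alpha> F'"
      using x by (auto simp: btriples_iff)
    fix z assume "\<exists>\<alpha> \<beta> F'. (\<alpha>, \<beta>, F') \<in> triples \<Lambda> \<and> spiel_class \<Lambda> a b F = spiel_class \<Lambda> \<alpha> \<beta> F' \<and>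
        z = spiel_class \<Lambda> \<beta> \<alpha> F'"
    then obtain \<alpha> \<beta> F' where t: "(\<alpha>, \<beta>, F') \<in> triples \<Lambda>"
      "spiel_class \<Lambda> a b F = spiel_class \<Lambda> \<alpha> \<beta> F'" "z = spiel_class \<Lambda> \<beta> \<alpha> F'" by blast
    have "(\<alpha>, \<beta>, F') \<in> btriples" using btriple_rep t xb by simp
    from *[OF this] *[OF x] t(2,3) show "z = spiel_class \<Lambda> b a F"
      using phi_inj by metis
  qed
  then show "i \<in> barrows" "phi i = germ_inv \<Lambda> (phi (spiel_class \<Lambda> a b F))" using *[OF x] by auto
qed

section \<open>Topology of the boundary groupoid\<close>

definition spiel_basis :: "'a spiel set set" where
  "spiel_basis = {{spiel_class \<Lambda> \<alpha> \<beta> F | F. F \<in> U \<and> (\<alpha>, \<beta>, F) \<in> triples \<Lambda>} | \<alpha> \<beta> U.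
     \<alpha> \<in> Mor \<Lambda> \<and> \<beta> \<in> Mor \<Lambda> \<and> src \<Lambda> \<alpha> = src \<Lambda> \<beta> \<and> openin (path_topology \<Lambda>) U}"

abbreviation "spiel_top \<equiv> topology_generated_by spiel_basis"

lemma spiel_boundary_simps:
  "arrows (spiel_boundary_groupoid \<Lambda>) = barrows"
  "gmult (spiel_boundary_groupoid \<Lambda>) = spiel_mult \<Lambda>"
  "ginv (spiel_boundary_groupoid \<Lambda>) = spiel_inv \<Lambda>"
  "gtop (spiel_boundary_groupoid \<Lambda>) = subtopology spiel_top barrows"
proof -
  have "barrows \<subseteq> triples \<Lambda> // triple_rel \<Lambda>"
    unfolding barrows_def spiel_class_def quotient_def by blast
  then show "arrows (spiel_boundary_groupoid \<Lambda>) = barrows"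
    unfolding spiel_boundary_groupoid_def restrict_groupoid_def spiel_groupoid_def
      barrows_def[symmetric] by (simp add: inf.absorb2)
qed (simp_all add: spiel_boundary_groupoid_def restrict_groupoid_def spiel_groupoid_def
    barrows_def spiel_basis_def)

lemma spiel_boundary_composable:
  assumes "x \<in> barrows" "y \<in> barrows"
  shows "(x, y) \<in> composable (spiel_boundary_groupoid \<Lambda>) \<longleftrightarrow>
    (\<exists>a b F c d G. (a, b, F) \<in> btriples \<and> (c, d, G) \<in> btriples \<and>
      x = spiel_class \<Lambda> a b F \<and> y = spiel_class \<Lambda> c d G \<and> pact (tau \<Lambda> b) F = pact (tau \<Lambda> c) G)"
proof -
  have "(x, y) \<in> composable (spiel_boundary_groupoid \<Lambda>) \<longleftrightarrow>
    (\<exists>a b F c d G. (a, b, F) \<in> triples \<Lambda> \<and> (c, d, G) \<in> triples \<Lambda> \<and>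
      x = spiel_class \<Lambda> a b F \<and> y = spiel_class \<Lambda> c d G \<and> act \<Lambda> (tau \<Lambda> b) F = act \<Lambda> (tau \<Lambda> c) G)"
    unfolding spiel_boundary_groupoid_def restrict_groupoid_def spiel_groupoid_def
      barrows_def[symmetric] using assms by simp
  also have "\<dots> \<longleftrightarrow> (\<exists>a b F c d G. (a, b, F) \<in> btriples \<and> (c, d, G) \<in> btriples \<and>
      x = spiel_class \<Lambda> a b F \<and> y = spiel_class \<Lambda> c d G \<and> pact (tau \<Lambda> b) F = pact (tau \<Lambda> c) G)"
    using spiel_composable_iff btriple_rep assms btriples_iff by metis
  finally show ?thesis .
qed

lemma barrows_subset_spiel_top: "barrows \<subseteq> topspace spiel_top"
  unfolding topology_generated_by_topspace
proof
  fix x assume "x \<in> barrows"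
  then obtain a b F where x: "(a, b, F) \<in> triples \<Lambda>" "x = spiel_class \<Lambda> a b F"
    unfolding in_barrows_iff btriples_iff by blast
  note d = triplesD[OF x(1)]
  have "{spiel_class \<Lambda> a b F | F. F \<in> path_space \<Lambda> \<and> (a, b, F) \<in> triples \<Lambda>} \<in> spiel_basis"
    unfolding spiel_basis_def using d openin_topspace[of "path_topology \<Lambda>"] topspace_path_topology by auto
  then show "x \<in> \<Union>spiel_basis" using x d(3) by blast
qed

lemma topspace_spiel_boundary: "topspace (subtopology spiel_top barrows) = barrows"
  using barrows_subset_spiel_top by (simp add: inf.absorb2)

text \<open>Fix the point \<open>e\<close> at which \<open>ts a b\<close> agrees with
  \<open>u\<close>. That \<open>pact (tau \<Lambda> b) K\<close> contains \<open>e\<close> and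
  belongs to \<open>V\<close> are open conditions on \<open>K\<close>, by continuity of the action
  of \<open>tau\<close>.\<close>

lemma continuous_phi:
  "continuous_map (subtopology spiel_top barrows) (gtop (germ_groupoid \<Lambda>)) phi"
proof -
  let ?S = "subtopology spiel_top barrows"
  have "continuous_map ?S (topology_generated_by germ_basis) phi"
  proof (rule continuous_on_generated_topo)
    show "phi ` topspace ?S \<subseteq> \<Union>germ_basis"
      unfolding topspace_spiel_boundary Union_germ_basis using phi_bij by (simp add: bij_betw_def)
    fix W assume "W \<in> germ_basis"
    then obtain u V where W: "W = germ \<Lambda> u ` (V \<inter> tight_paths \<Lambda>)" and u: "u \<in> inv_semigroup \<Lambda>"
      and V: "openin (path_topology \<Lambda>) V" "\<forall>F\<in>V. F \<inter> Domain u \<noteq> {}" by (rule germ_basisE)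
    show "openin ?S (phi -` W \<inter> topspace ?S)"
      unfolding topspace_spiel_boundary
    proof (subst openin_subopen, intro ballI)
      fix x assume x: "x \<in> phi -` W \<inter> barrows"
      then obtain a b F where bt: "(a, b, F) \<in> btriples" and xc: "x = spiel_class \<Lambda> a b F"
        using in_barrows_iff by blast
      have t: "(a, b, F) \<in> triples \<Lambda>" using bt by (simp add: btriples_iff)
      note d = triplesD[OF t]
      have "germ \<Lambda> (ts a b) (pact (tau \<Lambda> b) F) \<in> W" using x xc phi_class[OF bt] by simp
      then have T: "pact (tau \<Lambda> b) F \<in> V" "agree (pact (tau \<Lambda> b) F) (ts a b) u"
        unfolding W germ_in_image_iff[OF btriple_germ_pairs[OF bt] u V(2)] by auto
      obtain e y where e: "e \<in> pact (tau \<Lambda> b) F" "(e, y) \<in> ts a b" "(e, y) \<in> u"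
        using T(2) by (rule agreeE)
      define U where "U = {K \<in> path_space \<Lambda>. K \<inter> Domain (tau \<Lambda> b) \<noteq> {} \<and> pact (tau \<Lambda> b) K \<in> V} \<inter>
        {K \<in> path_space \<Lambda>. e \<in> pact (tau \<Lambda> b) K}"
      have U: "openin (path_topology \<Lambda>) U"
        unfolding U_def
        by (intro openin_Int openin_pact_vimage openin_pact_mem equivariant_tau d(2) V(1))
      let ?X = "{spiel_class \<Lambda> a b F | F. F \<in> U \<and> (a, b, F) \<in> triples \<Lambda>}"
      have "?X \<in> spiel_basis" unfolding spiel_basis_def using d(1,2,4) U by blast
      then have "openin spiel_top ?X" by (rule topology_generated_by_Basis)
      then have "openin ?S (?X \<inter> barrows)" unfolding openin_subtopology by blast
      moreover have "F \<in> U"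
        unfolding U_def using d(3) tau_meets[OF d(2,5)] T(1) e(1) by simp
      then have "x \<in> ?X \<inter> barrows" using x xc t by blast
      moreover have "?X \<inter> barrows \<subseteq> phi -` W \<inter> barrows"
      proof
        fix z assume z: "z \<in> ?X \<inter> barrows"
        then obtain K where K: "z = spiel_class \<Lambda> a b K" "K \<in> U" "(a, b, K) \<in> triples \<Lambda>" by blast
        have bK: "(a, b, K) \<in> btriples" using btriple_rep[OF K(3)] z K(1) by simp
        have "e \<in> pact (tau \<Lambda> b) K" "pact (tau \<Lambda> b) K \<in> V" using K(2) unfolding U_def by auto
        then have "germ \<Lambda> (ts a b) (pact (tau \<Lambda> b) K) \<in> W"
          unfolding W germ_in_image_iff[OF btriple_germ_pairs[OF bK] u V(2)]
          using agreeI[OF _ e(2,3)] by blast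
        then show "z \<in> phi -` W \<inter> barrows" using z K(1) phi_class[OF bK] by simp
      qed
      ultimately show "\<exists>T. openin ?S T \<and> x \<in> T \<and> T \<subseteq> phi -` W \<inter> barrows" by blast
    qed
  qed
  then show ?thesis unfolding gtop_germ_groupoid .
qed

text \<open>\<Phi> moves the base path by \<open>tau\<close> at \<open>b\<close>, so the generator
  for \<open>a\<close>, \<open>b\<close>, \<open>U\<close> goes to the basic set of
  \<open>ts a b\<close> over the translate of \<open>U\<close>. That translate is \<open>V\<close>:
  the paths through \<open>b\<close> which \<open>sigma\<close> at \<open>b\<close> carries into
  \<open>U\<close>.\<close>

lemma open_phi_image:
  assumes "W \<in> spiel_basis"
  shows "openin (gtop (germ_groupoid \<Lambda>)) (phi ` (W \<inter> barrows))"
proof -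
  obtain a b U where W: "W = {spiel_class \<Lambda> a b F | F. F \<in> U \<and> (a, b, F) \<in> triples \<Lambda>}"
    and ab: "a \<in> Mor \<Lambda>" "b \<in> Mor \<Lambda>" "src \<Lambda> a = src \<Lambda> b" and U: "openin (path_topology \<Lambda>) U"
    using assms unfolding spiel_basis_def by blast
  define V where "V = {T \<in> path_space \<Lambda>. T \<inter> Domain (sigma \<Lambda> b) \<noteq> {} \<and> pact (sigma \<Lambda> b) T \<in> U} \<inter>
    {T \<in> path_space \<Lambda>. b \<in> T}"
  have V: "openin (path_topology \<Lambda>) V"
    unfolding V_def
    by (intro openin_Int openin_pact_vimage openin_path_mem equivariant_sigma ab(2) U)
  have Vd: "T \<inter> Domain (ts a b) \<noteq> {}" if "T \<in> V" for T
    using that ts_self[OF ab] unfolding V_def by blast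
  have "phi ` (W \<inter> barrows) = germ \<Lambda> (ts a b) ` (V \<inter> tight_paths \<Lambda>)"
  proof
    show "phi ` (W \<inter> barrows) \<subseteq> germ \<Lambda> (ts a b) ` (V \<inter> tight_paths \<Lambda>)"
    proof
      fix z assume "z \<in> phi ` (W \<inter> barrows)"
      then obtain F where F: "z = phi (spiel_class \<Lambda> a b F)" "F \<in> U" "(a, b, F) \<in> triples \<Lambda>"
        "spiel_class \<Lambda> a b F \<in> barrows" unfolding W by blast
      have bt: "(a, b, F) \<in> btriples" by (rule btriple_rep[OF F(3,4)])
      note d = triplesD[OF F(3)]
      have bT: "b \<in> pact (tau \<Lambda> b) F" by (rule mem_pact_tau[OF d(2,5)])
      have "pact (tau \<Lambda> b) F \<in> V"
        unfolding V_def using path_tau[OF d(2,3,5)] sigma_meets[OF d(2) bT] bT F(2)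
          pact_sigma_tau[OF d(2,3,5)] by simp
      moreover have "pact (tau \<Lambda> b) F \<in> tight_paths \<Lambda>" by (rule germ_pairsD(3)[OF btriple_germ_pairs[OF bt]])
      ultimately show "z \<in> germ \<Lambda> (ts a b) ` (V \<inter> tight_paths \<Lambda>)" using F(1) phi_class[OF bt] by simp
    qed
    show "germ \<Lambda> (ts a b) ` (V \<inter> tight_paths \<Lambda>) \<subseteq> phi ` (W \<inter> barrows)"
    proof
      fix z assume "z \<in> germ \<Lambda> (ts a b) ` (V \<inter> tight_paths \<Lambda>)"
      then obtain T where T: "z = germ \<Lambda> (ts a b) T" "T \<in> V" "T \<in> tight_paths \<Lambda>" by blast
      have g: "(ts a b, T) \<in> germ_pairs \<Lambda>"
        unfolding germ_pairs_iff by (intro conjI ts_inv_semigroup ab T(3) Vd[OF T(2)])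
      have b: "b \<in> T" "pact (sigma \<Lambda> b) T \<in> U" using T(2) unfolding V_def by auto
      note e = germ_eq_ts[OF g b(1) ts_self[OF ab]]
      have "spiel_class \<Lambda> a b (pact (sigma \<Lambda> b) T) \<in> W \<inter> barrows"
        using e(1) b(2) in_barrows_iff unfolding W btriples_iff by blast
      moreover have "z = phi (spiel_class \<Lambda> a b (pact (sigma \<Lambda> b) T))" using e(2) T(1) phi_class[OF e(1)] by simp
      ultimately show "z \<in> phi ` (W \<inter> barrows)" by blast
    qed
  qed
  then show ?thesis using openin_germ_image[OF ts_inv_semigroup[OF ab(1,2)] V] Vd by simp
qed

text \<open>The generators are only known as a subbasis, so openness of \<Phi> is obtained as
  continuity of its inverse, which may be tested on generators; their preimages are the images
  computed in \<open>open_phi_image\<close>.\<close>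

lemma homeomorphic_phi:
  "homeomorphic_map (subtopology spiel_top barrows) (gtop (germ_groupoid \<Lambda>)) phi"
proof -
  let ?S = "subtopology spiel_top barrows" and ?T = "gtop (germ_groupoid \<Lambda>)"
  define g where "g = inv_into barrows phi"
  have inj: "inj_on phi barrows" and im: "phi ` barrows = topspace ?T"
    using phi_bij by (auto simp: bij_betw_def topspace_germ)
  have gphi: "g (phi x) = x" if "x \<in> barrows" for x using that inj by (simp add: g_def)
  have gb: "g z \<in> barrows" and phig: "phi (g z) = z" if "z \<in> topspace ?T" for z
    using that im by (auto simp: g_def inv_into_into f_inv_into_f)
  have "continuous_map ?T spiel_top g"
  proof (rule continuous_on_generated_topo)
    show "g ` topspace ?T \<subseteq> \<Union>spiel_basis"
      using gb barrows_subset_spiel_top unfolding topology_generated_by_topspace by blast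
    fix W assume W: "W \<in> spiel_basis"
    have "g -` W \<inter> topspace ?T = phi ` (W \<inter> barrows)"
    proof
      show "g -` W \<inter> topspace ?T \<subseteq> phi ` (W \<inter> barrows)"
      proof
        fix z assume z: "z \<in> g -` W \<inter> topspace ?T"
        then have "z = phi (g z)" "g z \<in> W \<inter> barrows" using gb phig by auto
        then show "z \<in> phi ` (W \<inter> barrows)" by (rule image_eqI)
      qed
      show "phi ` (W \<inter> barrows) \<subseteq> g -` W \<inter> topspace ?T" using im gphi by auto
    qed
    then show "openin ?T (g -` W \<inter> topspace ?T)" using open_phi_image[OF W] by simp
  qed
  then have "continuous_map ?T ?S g"
    unfolding continuous_map_in_subtopology using gb by blast
  then have "homeomorphic_maps ?S ?T phi g"
    unfolding homeomorphic_maps_def topspace_spiel_boundary using continuous_phi gphi phig by blast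
  then show ?thesis by (rule homeomorphic_maps_imp_map)
qed

lemma top_groupoid_iso_phi:
  "top_groupoid_iso (spiel_boundary_groupoid \<Lambda>) (germ_groupoid \<Lambda>) phi"
proof (rule top_groupoid_iso_transfer[OF is_top_groupoid_germ])
  let ?G = "spiel_boundary_groupoid \<Lambda>"
  show sub: "composable ?G \<subseteq> arrows ?G \<times> arrows ?G"
    unfolding spiel_boundary_simps
    by (auto simp: spiel_boundary_groupoid_def restrict_groupoid_def barrows_def)
  show "bij_betw phi (arrows ?G) (arrows (germ_groupoid \<Lambda>))"
    unfolding spiel_boundary_simps arrows_germ_groupoid by (rule phi_bij)
  show "(x, y) \<in> composable ?G \<longleftrightarrow> (phi x, phi y) \<in> composable (germ_groupoid \<Lambda>)"
    if "x \<in> arrows ?G" "y \<in> arrows ?G" for x y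
  proof -
    have xy: "x \<in> barrows" "y \<in> barrows" using that spiel_boundary_simps by auto
    obtain a b F where x: "(a, b, F) \<in> btriples" "x = spiel_class \<Lambda> a b F"
      using xy(1) in_barrows_iff by blast
    obtain c d G where y: "(c, d, G) \<in> btriples" "y = spiel_class \<Lambda> c d G"
      using xy(2) in_barrows_iff by blast
    show ?thesis
    proof
      assume "(x, y) \<in> composable ?G"
      then show "(phi x, phi y) \<in> composable (germ_groupoid \<Lambda>)"
        unfolding spiel_boundary_composable[OF xy] using phi_composable by blast
    next
      assume "(phi x, phi y) \<in> composable (germ_groupoid \<Lambda>)"
      then have "pact (tau \<Lambda> b) F = pact (tau \<Lambda> c) G"
        using phi_composable[OF x(1) y(1)] x(2) y(2) by simp
      then show "(x, y) \<in> composable ?G"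
        unfolding spiel_boundary_composable[OF xy] using x y by blast
    qed
  qed
  show "gmult ?G x y \<in> arrows ?G \<and> phi (gmult ?G x y) = gmult (germ_groupoid \<Lambda>) (phi x) (phi y)"
    if comp: "(x, y) \<in> composable ?G" for x y
  proof -
    have xy: "x \<in> barrows" "y \<in> barrows" using sub comp unfolding spiel_boundary_simps by auto
    obtain a b F c d G where t: "(a, b, F) \<in> btriples" "(c, d, G) \<in> btriples"
      "x = spiel_class \<Lambda> a b F" "y = spiel_class \<Lambda> c d G" "pact (tau \<Lambda> b) F = pact (tau \<Lambda> c) G"
      using comp unfolding spiel_boundary_composable[OF xy] by blast
    show ?thesis
      unfolding spiel_boundary_simps gmult_germ_groupoid t(3,4) using phi_mult[OF t(1,2,5)] by blast
  qed
  show "ginv ?G x \<in> arrows ?G \<and> phi (ginv ?G x) = ginv (germ_groupoid \<Lambda>) (phi x)"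
    if x_in: "x \<in> arrows ?G" for x
  proof -
    obtain a b F where x: "(a, b, F) \<in> btriples" "x = spiel_class \<Lambda> a b F"
      using x_in unfolding spiel_boundary_simps in_barrows_iff by blast
    show ?thesis
      unfolding spiel_boundary_simps ginv_germ_groupoid x(2) using phi_inv[OF x(1)] by blast
  qed
  show "topspace (gtop ?G) = arrows ?G"
    unfolding spiel_boundary_simps by (rule topspace_spiel_boundary)
  show "homeomorphic_map (gtop ?G) (gtop (germ_groupoid \<Lambda>)) phi"
    unfolding spiel_boundary_simps by (rule homeomorphic_phi)
qed

end

theorem proposition5p2:
  fixes \<Lambda> :: "'a category"
  assumes "small_category \<Lambda>"
    and "countable (Mor \<Lambda>)"
    and "finitely_aligned \<Lambda>"
    and "left_cancellative \<Lambda>"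
  shows "\<exists>\<Phi> :: 'a spiel \<Rightarrow> 'a germ.
    (\<forall>\<alpha> \<beta> F. (\<alpha>, \<beta>, F) \<in> triples \<Lambda> \<and> F \<in> tight_paths \<Lambda> \<longrightarrow>
       \<Phi> (spiel_class \<Lambda> \<alpha> \<beta> F) =
         germ \<Lambda> (tau \<Lambda> \<alpha> \<circ>\<^sub>p sigma \<Lambda> \<beta>) (act \<Lambda> (tau \<Lambda> \<beta>) F)) \<and>
    top_groupoid_iso (spiel_boundary_groupoid \<Lambda>) (germ_groupoid \<Lambda>) \<Phi>"
proof -
  interpret finitely_aligned_lcsc \<Lambda>
    using assms by (simp add: finitely_aligned_lcsc_def finitely_aligned_lcsc_axioms_def)
  have "phi (spiel_class \<Lambda> \<alpha> \<beta> F) = germ \<Lambda> (ts \<alpha> \<beta>) (act \<Lambda> (tau \<Lambda> \<beta>) F)"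
    if "(\<alpha>, \<beta>, F) \<in> triples \<Lambda> \<and> F \<in> tight_paths \<Lambda>" for \<alpha> \<beta> F
    using that phi_class[of \<alpha> \<beta> F] act_tau[of \<beta> F] triplesD[of \<alpha> \<beta> F] by (simp add: btriples_iff)
  then show ?thesis using top_groupoid_iso_phi by blast
qed

end
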